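(* Let $K$ be a field of characteristic $0$ containing an element of multiplicative order $12$. Then $\beta_{\mathrm{sep}}^K(\mathrm{Dic}_{12}\times \mathrm{C}_2)=8$, where \[\mathrm{Dic}_{12}\times \mathrm{C}_2=\langle a,b\mid a^6=1,\ b^2=a^3,\ ba=a^{-1}b\rangle \times \langle c\mid c^2=1\rangle .\]
   Context: Let $K$ be a field and $G$ a finite group with $\mathrm{char}(K)\nmid |G|$. For a finite dimensional $KG$-module $V$, $K[V]$ is the polynomial ring in the coordinate functions on $V$, on which $G$ acts by $(g\cdot f)(v)=f(g^{-1}v)$, and $K[V]^G$ is the subalgebra of $G$-invariants. A subset $S\subseteq K[V]^G$ is a separating set if whenever $v,w\in V$ have different $G$-orbits, there is $f\in S$ with $f(v)\ne f(w)$. The number $\beta_{\mathrm{sep}}(G,V)$ is the minimal positive integer $d$ such that the elements of $K[V]^G$ of degree at most $d$ form a separating set, and $\beta_{\mathrm{sep}}^K(G)$ is the supremum of $\beta_{\mathrm{sep}}(G,V)$ over all finite dimensional $KG$-modules $V$. *)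

theory Defs
  imports
    "HOL-Algebra.Group"
    "HOL-Library.Extended_Nat"
    "HOL-Library.Poly_Mapping"
    "Jordan_Normal_Form.Matrix"
begin

section \<open>Groups given by generators and relations\<close>

text \<open>
  A letter \<^term>\<open>(x, True)\<close> stands for the generator \<open>x\<close>, and \<^term>\<open>(x, False)\<close> for its
  formal inverse. A relation \<open>l = r\<close> is given as the pair \<open>(l, r)\<close> of words. The generators are
  all elements of the type \<open>'x\<close>.
\<close>

type_synonym 'x word = "('x \<times> bool) list"

inductive word_eq :: "('x word \<times> 'x word) set \<Rightarrow> 'x word \<Rightarrow> 'x word \<Rightarrow> bool"
  for R :: "('x word \<times> 'x word) set" where
  refl: "word_eq R u u"
| sym: "word_eq R u v \<Longrightarrow> word_eq R v u"
| trans: "word_eq R u v \<Longrightarrow> word_eq R v w \<Longrightarrow> word_eq R u w"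
| cancel: "word_eq R (u @ [(x, e), (x, \<not> e)] @ v) (u @ v)"
| rel: "(l, r) \<in> R \<Longrightarrow> word_eq R (u @ l @ v) (u @ r @ v)"

definition word_class :: "('x word \<times> 'x word) set \<Rightarrow> 'x word \<Rightarrow> 'x word set" where
  "word_class R u = {v. word_eq R u v}"

definition presented_group :: "('x word \<times> 'x word) set \<Rightarrow> 'x word set monoid" where
  "presented_group R =
     \<lparr> carrier = range (word_class R),
       mult = (\<lambda>A B. \<Union>u\<in>A. \<Union>v\<in>B. word_class R (u @ v)),
       one = word_class R [] \<rparr>"

lemma word_class_eq_iff: "word_class R u = word_class R v \<longleftrightarrow> word_eq R u v"
  unfolding word_class_def by (blast intro: word_eq.refl word_eq.sym word_eq.trans)

lemma word_eq_append_left: "word_eq R u u' \<Longrightarrow> word_eq R (w @ u) (w @ u')"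
proof (induction rule: word_eq.induct)
  case (cancel u x e v)
  show ?case using word_eq.cancel[of R "w @ u" x e v] by simp
next
  case (rel l r u v)
  show ?case using word_eq.rel[OF rel, of "w @ u" v] by simp
qed (blast intro: word_eq.refl word_eq.sym word_eq.trans)+

lemma word_eq_append_right: "word_eq R u u' \<Longrightarrow> word_eq R (u @ w) (u' @ w)"
proof (induction rule: word_eq.induct)
  case (cancel u x e v)
  show ?case using word_eq.cancel[of R u x e "v @ w"] by simp
next
  case (rel l r u v)
  show ?case using word_eq.rel[OF rel, of u "v @ w"] by simp
qed (blast intro: word_eq.refl word_eq.sym word_eq.trans)+

lemma word_eq_append: "word_eq R u u' \<Longrightarrow> word_eq R v v' \<Longrightarrow> word_eq R (u @ v) (u' @ v')"
  by (blast intro: word_eq_append_left word_eq_append_right word_eq.trans)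

lemma presented_group_mult:
  "word_class R u \<otimes>\<^bsub>presented_group R\<^esub> word_class R v = word_class R (u @ v)"
proof -
  have eq: "word_class R (u' @ v') = word_class R (u @ v)"
    if "u' \<in> word_class R u" "v' \<in> word_class R v" for u' v'
    using that word_class_eq_iff[of R "u' @ v'" "u @ v"]
    by (auto simp: word_class_def intro: word_eq_append word_eq.sym)
  have mem: "u \<in> word_class R u" "v \<in> word_class R v"
    by (simp_all add: word_class_def word_eq.refl)
  have "(\<Union>u'\<in>word_class R u. \<Union>v'\<in>word_class R v. word_class R (u' @ v')) =
      word_class R (u @ v)"
  proof (rule equalityI)
    show "(\<Union>u'\<in>word_class R u. \<Union>v'\<in>word_class R v. word_class R (u' @ v')) \<subseteq>
        word_class R (u @ v)"
      by (intro UN_least equalityD1 eq)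
    show "word_class R (u @ v) \<subseteq>
        (\<Union>u'\<in>word_class R u. \<Union>v'\<in>word_class R v. word_class R (u' @ v'))"
      using mem by blast
  qed
  then show ?thesis by (simp add: presented_group_def)
qed

lemma word_eq_inverse: "word_eq R (map (\<lambda>(x, e). (x, \<not> e)) (rev u) @ u) []"
proof (induction u)
  case Nil
  show ?case by (simp add: word_eq.refl)
next
  case (Cons p u)
  obtain x e where p: "p = (x, e)" by fastforce
  have "word_eq R (map (\<lambda>(x, e). (x, \<not> e)) (rev u) @ [(x, \<not> e), (x, \<not> \<not> e)] @ u)
                  (map (\<lambda>(x, e). (x, \<not> e)) (rev u) @ u)"
    by (rule word_eq.cancel)
  with Cons show ?case by (auto simp: p intro: word_eq.trans)
qed

lemma group_presented_group: "group (presented_group R)"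
proof (rule groupI)
  fix A assume "A \<in> carrier (presented_group R)"
  then obtain u where A: "A = word_class R u" by (auto simp: presented_group_def)
  have one: "\<one>\<^bsub>presented_group R\<^esub> = word_class R []" by (simp add: presented_group_def)
  show "\<one>\<^bsub>presented_group R\<^esub> \<otimes>\<^bsub>presented_group R\<^esub> A = A"
    unfolding A one presented_group_mult by simp
  show "\<exists>B\<in>carrier (presented_group R). B \<otimes>\<^bsub>presented_group R\<^esub> A = \<one>\<^bsub>presented_group R\<^esub>"
  proof
    show "word_class R (map (\<lambda>(x, e). (x, \<not> e)) (rev u)) \<otimes>\<^bsub>presented_group R\<^esub> A
            = \<one>\<^bsub>presented_group R\<^esub>"
      unfolding A one presented_group_mult by (simp add: word_class_eq_iff word_eq_inverse)
  qed (simp add: presented_group_def)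
next
  fix A B C
  assume "A \<in> carrier (presented_group R)" "B \<in> carrier (presented_group R)"
    "C \<in> carrier (presented_group R)"
  then obtain u v w where "A = word_class R u" "B = word_class R v" "C = word_class R w"
    by (auto simp: presented_group_def)
  then show "A \<otimes>\<^bsub>presented_group R\<^esub> B \<otimes>\<^bsub>presented_group R\<^esub> C
      = A \<otimes>\<^bsub>presented_group R\<^esub> (B \<otimes>\<^bsub>presented_group R\<^esub> C)"
    by (simp add: presented_group_mult)
next
  fix A B assume "A \<in> carrier (presented_group R)" "B \<in> carrier (presented_group R)"
  then obtain u v where "A = word_class R u" "B = word_class R v"
    by (auto simp: presented_group_def)
  then have "A \<otimes>\<^bsub>presented_group R\<^esub> B = word_class R (u @ v)"
    by (simp add: presented_group_mult)
  then show "A \<otimes>\<^bsub>presented_group R\<^esub> B \<in> carrier (presented_group R)"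
    by (simp add: presented_group_def)
qed (simp add: presented_group_def)

datatype dic_gen = gen_a | gen_b

definition Dic12 :: "dic_gen word set monoid" where
  "Dic12 = presented_group
     {(replicate 6 (gen_a, True), []),
      (replicate 2 (gen_b, True), replicate 3 (gen_a, True)),
      ([(gen_b, True), (gen_a, True)], [(gen_a, False), (gen_b, True)])}"

datatype cyc_gen = gen_c

definition C2 :: "cyc_gen word set monoid" where
  "C2 = presented_group {(replicate 2 (gen_c, True), [])}"


section \<open>Polynomials in coordinate functions\<close>

text \<open>
  Formal polynomials in variables indexed by \<open>nat\<close>: the exponent vectors are finitely supported
  functions, and so is the map from exponent vectors to coefficients.
\<close>

type_synonym 'k mpoly = "(nat \<Rightarrow>\<^sub>0 nat) \<Rightarrow>\<^sub>0 'k"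

text \<open>The value in \<open>'r\<close> of a polynomial, with \<open>c\<close> applied to its coefficients and \<open>x i\<close> put for
  the \<open>i\<close>-th variable.\<close>

definition mpoly_subst ::
  "('k::comm_ring_1 \<Rightarrow> 'r::comm_ring_1) \<Rightarrow> (nat \<Rightarrow> 'r) \<Rightarrow> 'k mpoly \<Rightarrow> 'r" where
  "mpoly_subst c x p =
     (\<Sum>m\<in>Poly_Mapping.keys p. c (Poly_Mapping.lookup p m) *
        (\<Prod>i\<in>Poly_Mapping.keys m. x i ^ Poly_Mapping.lookup m i))"

definition mpoly_const :: "'k::comm_ring_1 \<Rightarrow> 'k mpoly" where
  "mpoly_const a = Poly_Mapping.single 0 a"

definition mpoly_var :: "nat \<Rightarrow> 'k::comm_ring_1 mpoly" where
  "mpoly_var i = Poly_Mapping.single (Poly_Mapping.single i 1) 1"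

definition mpoly_eval :: "'k::comm_ring_1 mpoly \<Rightarrow> 'k vec \<Rightarrow> 'k" where
  "mpoly_eval p v = mpoly_subst (\<lambda>a. a) (\<lambda>i. v $ i) p"

text \<open>The total degree; the zero polynomial gets degree \<open>0\<close>.\<close>

definition mpoly_degree :: "'k::comm_ring_1 mpoly \<Rightarrow> nat" where
  "mpoly_degree p =
     Max (insert 0 ((\<lambda>m. \<Sum>i\<in>Poly_Mapping.keys m. Poly_Mapping.lookup m i) ` Poly_Mapping.keys p))"

text \<open>The polynomial ring \<open>K[V]\<close> for \<open>V = K\<^sup>n\<close>: only the variables \<open>0, \<dots>, n - 1\<close> occur.\<close>

definition coord_ring :: "nat \<Rightarrow> 'k::comm_ring_1 mpoly set" where
  "coord_ring n = {p. \<forall>m\<in>Poly_Mapping.keys p. Poly_Mapping.keys m \<subseteq> {..<n}}"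


section \<open>Modules, invariants and separating sets\<close>

text \<open>
  A \<open>KG\<close>-module of dimension \<open>n\<close>, described in a basis: the space is \<^term>\<open>carrier_vec n\<close>, on
  which \<open>g\<close> acts as the matrix \<open>\<rho> g\<close>.
\<close>

definition kg_module ::
  "('g, 'm) monoid_scheme \<Rightarrow> nat \<Rightarrow> ('g \<Rightarrow> 'k::field mat) \<Rightarrow> bool" where
  "kg_module G n \<rho> \<longleftrightarrow>
     (\<forall>g\<in>carrier G. \<rho> g \<in> carrier_mat n n) \<and>
     \<rho> \<one>\<^bsub>G\<^esub> = 1\<^sub>m n \<and>
     (\<forall>g\<in>carrier G. \<forall>h\<in>carrier G. \<rho> (g \<otimes>\<^bsub>G\<^esub> h) = \<rho> g * \<rho> h)"

definition orbit_of ::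
  "('g, 'm) monoid_scheme \<Rightarrow> ('g \<Rightarrow> 'k::field mat) \<Rightarrow> 'k vec \<Rightarrow> 'k vec set" where
  "orbit_of G \<rho> v = (\<lambda>g. \<rho> g *\<^sub>v v) ` carrier G"

text \<open>
  The action of \<open>G\<close> on \<open>K[V]\<close> by algebra automorphisms: \<open>g\<close> sends the \<open>i\<close>-th coordinate function
  \<open>x\<^sub>i\<close> to \<open>v \<mapsto> x\<^sub>i (g\<inverse> v)\<close>, which is the linear form whose coefficients are the \<open>i\<close>-th row of
  \<open>\<rho> (g\<inverse>)\<close>. The lemma \<open>mpoly_eval_act\<close> below states that \<open>(g \<cdot> f) v = f (g\<inverse> v)\<close>.
\<close>

definition mpoly_act ::
  "('g, 'm) monoid_scheme \<Rightarrow> nat \<Rightarrow> ('g \<Rightarrow> 'k::field mat) \<Rightarrow> 'g \<Rightarrow> 'k mpoly \<Rightarrow> 'k mpoly" where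
  "mpoly_act G n \<rho> g f =
     mpoly_subst mpoly_const
       (\<lambda>i. \<Sum>j<n. mpoly_const (\<rho> (inv\<^bsub>G\<^esub> g) $$ (i, j)) * mpoly_var j) f"

definition invariants ::
  "('g, 'm) monoid_scheme \<Rightarrow> nat \<Rightarrow> ('g \<Rightarrow> 'k::field mat) \<Rightarrow> 'k mpoly set" where
  "invariants G n \<rho> = {f \<in> coord_ring n. \<forall>g\<in>carrier G. mpoly_act G n \<rho> g f = f}"

definition separating_set ::
  "('g, 'm) monoid_scheme \<Rightarrow> nat \<Rightarrow> ('g \<Rightarrow> 'k::field mat) \<Rightarrow> 'k mpoly set \<Rightarrow> bool" where
  "separating_set G n \<rho> S \<longleftrightarrow>
     S \<subseteq> invariants G n \<rho> \<and>
     (\<forall>v\<in>carrier_vec n. \<forall>w\<in>carrier_vec n.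
        orbit_of G \<rho> v \<noteq> orbit_of G \<rho> w \<longrightarrow> (\<exists>f\<in>S. mpoly_eval f v \<noteq> mpoly_eval f w))"

text \<open>The minimum is taken in \<^typ>\<open>enat\<close>, so that it would be \<open>\<infinity>\<close> if no such \<open>d\<close> existed.\<close>

definition beta_sep_module ::
  "('g, 'm) monoid_scheme \<Rightarrow> nat \<Rightarrow> ('g \<Rightarrow> 'k::field mat) \<Rightarrow> enat" where
  "beta_sep_module G n \<rho> =
     Inf {enat d | d. 0 < d \<and> separating_set G n \<rho> {f \<in> invariants G n \<rho>. mpoly_degree f \<le> d}}"

text \<open>The field \<open>K\<close> is the type \<open>'k\<close>; the argument of type \<open>'k itself\<close> makes it explicit.\<close>

definition beta_sep :: "'k::field itself \<Rightarrow> ('g, 'm) monoid_scheme \<Rightarrow> enat" where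
  "beta_sep K G =
     Sup {beta_sep_module G n \<rho> | n (\<rho> :: 'g \<Rightarrow> 'k mat). kg_module G n \<rho>}"

definition has_mult_order :: "'k::field \<Rightarrow> nat \<Rightarrow> bool" where
  "has_mult_order z n \<longleftrightarrow> 0 < n \<and> z ^ n = 1 \<and> (\<forall>m. 0 < m \<and> m < n \<longrightarrow> z ^ m \<noteq> 1)"


section \<open>The action on polynomials as an action on functions\<close>

lemma mpoly_subst_superset:
  assumes "finite S" "Poly_Mapping.keys p \<subseteq> S" "c 0 = 0"
  shows "mpoly_subst c x p =
    (\<Sum>m\<in>S. c (Poly_Mapping.lookup p m) *
      (\<Prod>i\<in>Poly_Mapping.keys m. x i ^ Poly_Mapping.lookup m i))"
  unfolding mpoly_subst_def
  by (rule sum.mono_neutral_left) (use assms in \<open>auto simp: in_keys_iff\<close>)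

lemma mpoly_eval_add: "mpoly_eval (p + q) v = mpoly_eval p v + mpoly_eval q v"
proof -
  let ?S = "Poly_Mapping.keys p \<union> Poly_Mapping.keys q"
  have "Poly_Mapping.keys (p + q) \<subseteq> ?S" by (rule keys_add)
  then show ?thesis
    unfolding mpoly_eval_def
    by (subst (1 2 3) mpoly_subst_superset[where S = ?S])
       (auto simp: lookup_add distrib_right sum.distrib)
qed

lemma mpoly_eval_zero [simp]: "mpoly_eval 0 v = 0"
  by (simp add: mpoly_eval_def mpoly_subst_def)

lemma mpoly_eval_sum: "mpoly_eval (\<Sum>i\<in>A. p i) v = (\<Sum>i\<in>A. mpoly_eval (p i) v)"
  by (induction A rule: infinite_finite_induct) (simp_all add: mpoly_eval_add)

lemma mpoly_eval_single:
  "mpoly_eval (Poly_Mapping.single m a) v =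
     a * (\<Prod>i\<in>Poly_Mapping.keys m. (v $ i) ^ Poly_Mapping.lookup m i)"
  unfolding mpoly_eval_def by (subst mpoly_subst_superset[where S = "{m}"]) auto

lemma mpoly_sum_single:
  "(\<Sum>m\<in>Poly_Mapping.keys p. Poly_Mapping.single m (Poly_Mapping.lookup p m)) = p"
  by (rule poly_mapping_eqI)
     (auto simp: lookup_sum lookup_single when_def in_keys_iff if_distrib cong: if_cong)

lemma monom_eval_add:
  "(\<Prod>i\<in>Poly_Mapping.keys (l + m). (v $ i) ^ Poly_Mapping.lookup (l + m) i) =
   (\<Prod>i\<in>Poly_Mapping.keys l. (v $ i :: 'k::comm_ring_1) ^ Poly_Mapping.lookup l i) *
   (\<Prod>i\<in>Poly_Mapping.keys m. (v $ i) ^ Poly_Mapping.lookup m i)"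
proof -
  let ?S = "Poly_Mapping.keys l \<union> Poly_Mapping.keys m"
  have *: "(\<Prod>i\<in>Poly_Mapping.keys k. (v $ i) ^ Poly_Mapping.lookup k i) =
      (\<Prod>i\<in>?S. (v $ i) ^ Poly_Mapping.lookup k i)" if "Poly_Mapping.keys k \<subseteq> ?S" for k
    by (rule prod.mono_neutral_left) (use that in \<open>auto simp: in_keys_iff\<close>)
  have "Poly_Mapping.keys (l + m) \<subseteq> ?S" by (rule keys_add)
  then show ?thesis
    by (simp only: *[OF Un_upper1] *[OF Un_upper2] *[of "l + m"])
       (simp only: lookup_add power_add prod.distrib)
qed

lemma mpoly_eval_mult: "mpoly_eval (p * q) v = mpoly_eval p v * mpoly_eval q v"
proof -
  have single: "mpoly_eval (Poly_Mapping.single l a * Poly_Mapping.single m b) v =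
      mpoly_eval (Poly_Mapping.single l a) v * mpoly_eval (Poly_Mapping.single m b) v" for l m a b
    by (simp add: mult_single mpoly_eval_single monom_eval_add)
  have "mpoly_eval
      ((\<Sum>l\<in>Poly_Mapping.keys p. Poly_Mapping.single l (Poly_Mapping.lookup p l)) *
       (\<Sum>m\<in>Poly_Mapping.keys q. Poly_Mapping.single m (Poly_Mapping.lookup q m))) v =
    mpoly_eval (\<Sum>l\<in>Poly_Mapping.keys p. Poly_Mapping.single l (Poly_Mapping.lookup p l)) v *
    mpoly_eval (\<Sum>m\<in>Poly_Mapping.keys q. Poly_Mapping.single m (Poly_Mapping.lookup q m)) v"
    by (simp add: sum_product mpoly_eval_sum single)
  then show ?thesis by (simp add: mpoly_sum_single)
qed

lemma mpoly_eval_const [simp]: "mpoly_eval (mpoly_const a) v = a"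
  by (simp add: mpoly_const_def mpoly_eval_single)

lemma mpoly_eval_one [simp]: "mpoly_eval 1 v = 1"
  using mpoly_eval_const[of 1 v] by (simp add: mpoly_const_def)

lemma mpoly_eval_var [simp]: "mpoly_eval (mpoly_var i) v = v $ i"
  by (simp add: mpoly_var_def mpoly_eval_single)

lemma mpoly_eval_power: "mpoly_eval (p ^ k) v = mpoly_eval p v ^ k"
  by (induction k) (simp_all add: mpoly_eval_mult)

lemma mpoly_eval_prod: "mpoly_eval (\<Prod>i\<in>A. p i) v = (\<Prod>i\<in>A. mpoly_eval (p i) v)"
  by (induction A rule: infinite_finite_induct) (simp_all add: mpoly_eval_mult)

lemma mpoly_eval_act:
  assumes G: "group G" and M: "kg_module G n \<rho>" and g: "g \<in> carrier G"
    and f: "f \<in> coord_ring n" and v: "v \<in> carrier_vec n"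
  shows "mpoly_eval (mpoly_act G n \<rho> g f) v = mpoly_eval f (\<rho> (inv\<^bsub>G\<^esub> g) *\<^sub>v v)"
proof -
  let ?A = "\<rho> (inv\<^bsub>G\<^esub> g)"
  have A: "?A \<in> carrier_mat n n"
    using M group.inv_closed[OF G g] by (simp add: kg_module_def)
  have form: "(\<Sum>j<n. ?A $$ (i, j) * v $ j) = (?A *\<^sub>v v) $ i" if "i < n" for i
    using that A v by (auto simp: scalar_prod_def lessThan_atLeast0 intro!: sum.cong)
  have "(\<Prod>i\<in>Poly_Mapping.keys m. (\<Sum>j<n. ?A $$ (i, j) * v $ j) ^ Poly_Mapping.lookup m i) =
        (\<Prod>i\<in>Poly_Mapping.keys m. ((?A *\<^sub>v v) $ i) ^ Poly_Mapping.lookup m i)"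
    if "m \<in> Poly_Mapping.keys f" for m
  proof (rule prod.cong)
    fix i assume "i \<in> Poly_Mapping.keys m"
    with f that have "i < n" by (auto simp: coord_ring_def)
    then show "(\<Sum>j<n. ?A $$ (i, j) * v $ j) ^ Poly_Mapping.lookup m i =
        ((?A *\<^sub>v v) $ i) ^ Poly_Mapping.lookup m i" by (simp only: form)
  qed simp
  then show ?thesis
    unfolding mpoly_act_def mpoly_subst_def mpoly_eval_sum mpoly_eval_mult mpoly_eval_prod
      mpoly_eval_power mpoly_eval_const mpoly_eval_var
    by (simp add: mpoly_eval_def[of f] mpoly_subst_def)
qed

end

(*
  Let A be the abelian subgroup generated by a and c. It has index 2, and every linear form is a
  sum of weight forms, i.e. eigenvectors of A, whose weights b inverts. A product f of at most
  eight weight forms of total weight zero is A-invariant, so f + b f is an invariant of degree at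
  most 8 and f(v) + f(bv) is determined by the invariants of v.

  If an f of degree m \<le> 4 takes different values at v and bv, then applying this to f, f^2, g and
  f g shows that v agrees with w or with bw on all such g of degree at most 8 - m. Splitting
  according to which weights do not vanish at v and w, these agreements (or, when such an f does
  not exist, the equality f(v) = f(bv) itself) are enough to move w onto v by an element of A.

  For the lower bound, on the two-dimensional faithful representation of Dic12 the octic
  x y (x^6 - y^6) separates (1, 2) from (1, -2), while invariants of degree at most 7 do not.
*)
theory Submission
  imports Defs
begin

section \<open>Separation by products of weight forms\<close>

text \<open>Knowing \<open>f v + f (b v)\<close> for every \<open>f\<close> leaves open whether the
  value at \<open>v\<close> belongs to \<open>w\<close> or to \<open>b w\<close>, and the answer
  could vary with \<open>f\<close>. A distinguishing product fixes one answer for all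
  \<open>f\<close>, at the price of its degree: 8 = 2 + 6 pays for such a product of degree 2 and
  for the sixth power of a form. Since the square of \<open>b\<close> is the cube of
  \<open>a\<close>, it acts on weight \<open>i\<close> by \<open>(-1) ^ i\<close>. For odd
  \<open>i\<close> the product of a form with its image under \<open>b\<close> therefore changes
  sign under \<open>b\<close> and distinguishes wherever it is nonzero. For even \<open>i\<close>
  that product is fixed by \<open>b\<close>. There degree 4 is enough, unless only the types (0, 0),
  (2, 1) and (4, 1) survive; these need sixth powers again, and the fixed product then serves as an
  additional known value. The same sign explains the octic: \<open>b\<close> negates both x y and
  x^6 - y^6. The group elements are never listed: the upper bound rests on the relations, the lower
  bound on matrices that satisfy them. The locale keeps the separation argument free of polynomials,
  with forms and their products as plain functions graded by weight.\<close>

locale weighted_forms =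
  fixes V :: "'v set" and a b c :: "'v \<Rightarrow> 'v"
    and F :: "nat \<Rightarrow> nat \<Rightarrow> ('v \<Rightarrow> 'k::field_char_0) set"
    and \<zeta> :: 'k and Orb :: "'v \<Rightarrow> 'o"
  assumes a_closed: "u \<in> V \<Longrightarrow> a u \<in> V"
    and b_closed: "u \<in> V \<Longrightarrow> b u \<in> V"
    and c_closed: "u \<in> V \<Longrightarrow> c u \<in> V"
    and b_b: "u \<in> V \<Longrightarrow> b (b u) = a (a (a u))"
    and form_a: "x \<in> F i e \<Longrightarrow> u \<in> V \<Longrightarrow> x (a u) = \<zeta> ^ i * x u"
    and form_c: "x \<in> F i e \<Longrightarrow> u \<in> V \<Longrightarrow> x (c u) = (-1) ^ e * x u"
    and form_b: "x \<in> F i e \<Longrightarrow> (\<lambda>u. x (b u)) \<in> F (5 * i) e"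
    and form_mod: "F (i mod 6) (e mod 2) = F i e"
    and forms_separate: "v \<in> V \<Longrightarrow> w \<in> V \<Longrightarrow>
      (\<And>i e x. i < 6 \<Longrightarrow> e < 2 \<Longrightarrow> x \<in> F i e \<Longrightarrow> x v = x w) \<Longrightarrow> v = w"
    and root_cube: "\<zeta> ^ 3 = -1"
    and root_square: "\<zeta> ^ 2 = \<zeta> - 1"
    and orb_a: "u \<in> V \<Longrightarrow> Orb (a u) = Orb u"
    and orb_b: "u \<in> V \<Longrightarrow> Orb (b u) = Orb u"
    and orb_c: "u \<in> V \<Longrightarrow> Orb (c u) = Orb u"
begin

text \<open>The weights are accumulated as natural numbers and compared modulo 6 and 2 only in
  \<open>inv_mon\<close>, so that a product needs no reduction. A function may carry several
  weights, for instance when it is zero.\<close>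

inductive mon :: "nat \<Rightarrow> nat \<Rightarrow> nat \<Rightarrow> ('v \<Rightarrow> 'k) \<Rightarrow> bool" where
  mon_one: "mon 0 0 0 (\<lambda>_. 1)"
| mon_times: "x \<in> F i e \<Longrightarrow> mon n j d g \<Longrightarrow> mon (Suc n) (i + j) (e + d) (\<lambda>u. x u * g u)"

definition inv_mon :: "nat \<Rightarrow> ('v \<Rightarrow> 'k) \<Rightarrow> bool" where
  "inv_mon n f \<longleftrightarrow> (\<exists>m i e. m \<le> n \<and> mon m i e f \<and> 6 dvd i \<and> 2 dvd e)"

definition agree :: "nat \<Rightarrow> 'v \<Rightarrow> 'v \<Rightarrow> bool" where
  "agree n v w \<longleftrightarrow> (\<forall>f. inv_mon n f \<longrightarrow> f v = f w)"

text \<open>Up to the factor 12, \<open>f u + f (b u)\<close> is the value at \<open>u\<close> of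
  the invariant obtained by symmetrising \<open>f\<close>; this is all that invariants of degree at
  most 8 are asked to provide.\<close>

definition sum_agree :: "'v \<Rightarrow> 'v \<Rightarrow> bool" where
  "sum_agree v w \<longleftrightarrow> (\<forall>f. inv_mon 8 f \<longrightarrow> f v + f (b v) = f w + f (b w))"

lemma root_sixth: "\<zeta> ^ 6 = 1"
  using root_cube power_mult[of \<zeta> 3 2] by simp

lemma mon_form: "x \<in> F i e \<Longrightarrow> mon 1 i e x"
  using mon_times[OF _ mon_one] by fastforce

lemma mon_mult:
  "mon n i e f \<Longrightarrow> mon m j d g \<Longrightarrow> mon (n + m) (i + j) (e + d) (\<lambda>u. f u * g u)"
proof (induction rule: mon.induct)
  case (mon_times x i e n j' d' h)
  from mon.mon_times[OF mon_times(1) mon_times.IH[OF mon_times.prems]]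
  show ?case by (simp add: mult.assoc add.assoc)
qed simp

lemma mon_power: "mon n i e f \<Longrightarrow> mon (k * n) (k * i) (k * e) (\<lambda>u. f u ^ k)"
proof (induction k)
  case 0
  show ?case using mon_one by simp
next
  case (Suc k)
  then show ?case using mon_mult[of n i e f "k * n" "k * i" "k * e" "\<lambda>u. f u ^ k"] by simp
qed

lemma mon_form_power: "x \<in> F i e \<Longrightarrow> mon k (k * i) (k * e) (\<lambda>u. x u ^ k)"
  using mon_power[OF mon_form] by fastforce

lemma mon_a: "mon n i e f \<Longrightarrow> u \<in> V \<Longrightarrow> f (a u) = \<zeta> ^ i * f u"
  by (induction rule: mon.induct) (simp_all add: form_a power_add)

lemma mon_c: "mon n i e f \<Longrightarrow> u \<in> V \<Longrightarrow> f (c u) = (-1) ^ e * f u"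
  by (induction rule: mon.induct) (simp_all add: form_c power_add)

lemma mon_b: "mon n i e f \<Longrightarrow> mon n (5 * i) e (\<lambda>u. f (b u))"
proof (induction rule: mon.induct)
  case mon_one
  show ?case using mon.mon_one by simp
next
  case (mon_times x i e n j d g)
  from mon.mon_times[OF form_b[OF mon_times(1)] mon_times.IH]
  show ?case by (simp add: algebra_simps)
qed

lemma inv_monI: "mon m i e f \<Longrightarrow> m \<le> n \<Longrightarrow> 6 dvd i \<Longrightarrow> 2 dvd e \<Longrightarrow> inv_mon n f"
  unfolding inv_mon_def by blast

lemma inv_mon_mono: "inv_mon m f \<Longrightarrow> m \<le> n \<Longrightarrow> inv_mon n f"
  unfolding inv_mon_def using le_trans by blast

lemma inv_mon_mult:
  assumes "inv_mon m f" "inv_mon n g" "m + n \<le> k" shows "inv_mon k (\<lambda>u. f u * g u)"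
proof -
  obtain m' i e where f: "m' \<le> m" "mon m' i e f" "6 dvd i" "2 dvd e"
    using assms(1) by (auto simp: inv_mon_def)
  obtain n' j d where g: "n' \<le> n" "mon n' j d g" "6 dvd j" "2 dvd d"
    using assms(2) by (auto simp: inv_mon_def)
  show ?thesis by (rule inv_monI[OF mon_mult[OF f(2) g(2)]]) (use f g assms(3) in auto)
qed

lemma inv_mon_a: assumes "inv_mon n f" "u \<in> V" shows "f (a u) = f u"
proof -
  obtain m i e where "mon m i e f" "6 dvd i" using assms by (auto simp: inv_mon_def)
  then show ?thesis using mon_a[of m i e f u] assms(2) root_sixth by (auto simp: dvd_def power_mult)
qed

lemma inv_mon_c: assumes "inv_mon n f" "u \<in> V" shows "f (c u) = f u"
proof -
  obtain m i e where "mon m i e f" "2 dvd e" using assms by (auto simp: inv_mon_def)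
  then show ?thesis using mon_c[of m i e f u] assms(2) by auto
qed

lemma inv_mon_b: assumes "inv_mon n f" shows "inv_mon n (\<lambda>u. f (b u))"
proof -
  obtain m i e where "m \<le> n" "mon m i e f" "6 dvd i" "2 dvd e"
    using assms by (auto simp: inv_mon_def)
  then show ?thesis by (intro inv_monI[OF mon_b]) auto
qed

lemma inv_mon_b_b: assumes "inv_mon n f" "u \<in> V" shows "f (b (b u)) = f u"
  by (simp only: b_b[OF assms(2)] inv_mon_a[OF assms(1)] a_closed assms(2))

text \<open>The square of \<open>b\<close> is the cube of \<open>a\<close>, and
  \<open>\<zeta> ^ 3 = -1\<close>. This sign is what makes odd and even weights behave differently
  below.\<close>

lemma form_b_b: assumes "x \<in> F i e" "u \<in> V" shows "x (b (b u)) = (-1) ^ i * x u"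
proof -
  have "x (b (b u)) = (\<zeta> ^ i * \<zeta> ^ i * \<zeta> ^ i) * x u"
    using assms by (simp add: b_b form_a a_closed)
  also have "\<zeta> ^ i * \<zeta> ^ i * \<zeta> ^ i = (\<zeta> ^ 3) ^ i"
    by (simp add: power_mult_distrib power3_eq_cube)
  finally show ?thesis by (simp add: root_cube)
qed

section \<open>Agreement is unaffected by moving \<open>w\<close> within its orbit\<close>

lemma sum_agree_sym: "sum_agree v w \<Longrightarrow> sum_agree w v"
  by (simp add: sum_agree_def)

lemma sum_agree_a:
  assumes "sum_agree v w" "w \<in> V" shows "sum_agree v (a w)"
  unfolding sum_agree_def
proof (intro allI impI)
  fix f assume f: "inv_mon 8 f"
  show "f v + f (b v) = f (a w) + f (b (a w))"
    using assms(1) f inv_mon_a[OF f assms(2)] inv_mon_a[OF inv_mon_b[OF f] assms(2)]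
    by (simp only: sum_agree_def)
qed

lemma sum_agree_c:
  assumes "sum_agree v w" "w \<in> V" shows "sum_agree v (c w)"
  unfolding sum_agree_def
proof (intro allI impI)
  fix f assume f: "inv_mon 8 f"
  show "f v + f (b v) = f (c w) + f (b (c w))"
    using assms(1) f inv_mon_c[OF f assms(2)] inv_mon_c[OF inv_mon_b[OF f] assms(2)]
    by (simp only: sum_agree_def)
qed

lemma sum_agree_b:
  assumes "sum_agree v w" "w \<in> V" shows "sum_agree v (b w)"
  unfolding sum_agree_def
proof (intro allI impI)
  fix f assume f: "inv_mon 8 f"
  show "f v + f (b v) = f (b w) + f (b (b w))"
    using assms(1) f inv_mon_b_b[OF f assms(2)] by (simp only: sum_agree_def add.commute)
qed

lemma agree_a:
  assumes "agree n v w" "w \<in> V" shows "agree n v (a w)"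
  unfolding agree_def
proof (intro allI impI)
  fix f assume f: "inv_mon n f"
  show "f v = f (a w)" using assms(1) f inv_mon_a[OF f assms(2)] by (simp only: agree_def)
qed

lemma agree_c:
  assumes "agree n v w" "w \<in> V" shows "agree n v (c w)"
  unfolding agree_def
proof (intro allI impI)
  fix f assume f: "inv_mon n f"
  show "f v = f (c w)" using assms(1) f inv_mon_c[OF f assms(2)] by (simp only: agree_def)
qed

lemma agreeD: "agree n v w \<Longrightarrow> mon m i e f \<Longrightarrow> m \<le> n \<Longrightarrow> 6 dvd i \<Longrightarrow> 2 dvd e \<Longrightarrow> f v = f w"
  unfolding agree_def using inv_monI by blast

lemma sum_agreeD: "sum_agree v w \<Longrightarrow> mon m i e f \<Longrightarrow> m \<le> 8 \<Longrightarrow> 6 dvd i \<Longrightarrow> 2 dvd e \<Longrightarrow>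
    f v + f (b v) = f w + f (b w)"
  unfolding sum_agree_def using inv_monI by blast

section \<open>From symmetric sums to single values\<close>

lemma two_values:
  fixes p q r s :: 'k
  assumes "p + q = r + s" "p * q = r * s"
  shows "p = r \<and> q = s \<or> p = s \<and> q = r"
proof -
  have "(p - r) * (p - s) = p * (p + q) - p * q - p * (r + s) + r * s"
    by (simp add: algebra_simps)
  then have "(p - r) * (p - s) = 0" using assms by (simp add: algebra_simps)
  then show ?thesis using assms(1) by auto
qed

text \<open>The first two power sums determine the product, since 2 is invertible.\<close>

lemma two_values_squares:
  fixes p q r s :: 'k
  assumes "p + q = r + s" "p * p + q * q = r * r + s * s"
  shows "p = r \<and> q = s \<or> p = s \<and> q = r"
proof (rule two_values[OF assms(1)])
  have "2 * (p * q) = (p + q) * (p + q) - (p * p + q * q)" by (simp add: algebra_simps)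
  also have "\<dots> = 2 * (r * s)" unfolding assms by (simp add: algebra_simps)
  finally show "p * q = r * s" by simp
qed

text \<open>\<open>M\<close> and its square, of degree at most 8 because \<open>m \<le> 4\<close>,
  determine the unordered pair of values of \<open>M\<close> at \<open>v\<close> and
  \<open>b v\<close>, and thereby match \<open>v\<close> with \<open>w\<close> or with
  \<open>b w\<close>. For any \<open>f\<close> of degree at most \<open>8 - m\<close>, the sums for
  \<open>f\<close> and for \<open>M * f\<close> are a linear system in \<open>f v\<close> and
  \<open>f (b v)\<close> whose determinant is, up to sign, \<open>M v - M (b v)\<close>. Hence the
  one matching made by \<open>M\<close> is valid for all such \<open>f\<close>.\<close>

lemma agree_of_distinguishing:
  assumes sa: "sum_agree v w" and w: "w \<in> V" and M: "inv_mon m M" "M v \<noteq> M (b v)"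
    and m: "m \<le> 4"
  shows "agree (8 - m) v w \<or> agree (8 - m) v (b w)"
proof -
  have s: "f v + f (b v) = f w + f (b w)" if "inv_mon n f" "n \<le> 8" for n f
    using sa inv_mon_mono[OF that] by (simp add: sum_agree_def)
  have M1: "M v + M (b v) = M w + M (b w)" using s M m by fastforce
  have M2: "M v * M v + M (b v) * M (b v) = M w * M w + M (b w) * M (b w)"
    using s[OF inv_mon_mult[OF M(1) M(1) order_refl]] m by simp
  have N1: "M v = M w \<Longrightarrow> M (b v) = M (b w) \<Longrightarrow> f v = f w"
    and N2: "M v = M (b w) \<Longrightarrow> M (b v) = M w \<Longrightarrow> f v = f (b w)" if f: "inv_mon (8 - m) f" for f
  proof -
    have 1: "f (b v) = f w + f (b w) - f v" using s[OF f] by (simp add: algebra_simps)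
    have 2: "M v * f v + M (b v) * f (b v) = M w * f w + M (b w) * f (b w)"
      using s[OF inv_mon_mult[OF M(1) f order_refl]] m by simp
    show N1: "f v = f w" if "M v = M w" "M (b v) = M (b w)"
    proof -
      have "(M v - M (b v)) * (f v - f w) = 0"
        using 2[unfolded 1] that by (simp add: algebra_simps)
      then show ?thesis using M by simp
    qed
    show N2: "f v = f (b w)" if "M v = M (b w)" "M (b v) = M w"
    proof -
      have "(M v - M (b v)) * (f v - f (b w)) = 0"
        using 2[unfolded 1] that by (simp add: algebra_simps)
      then show ?thesis using M by simp
    qed
  qed
  show ?thesis using two_values_squares[OF M1 M2] N1 N2 unfolding agree_def by blast
qed

text \<open>Apply the hypothesis to \<open>f\<close> composed with \<open>b\<close>; the double
  application of \<open>b\<close> is not seen by products of weight zero.\<close>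

lemma agree_swap:
  assumes "agree n w v \<or> agree n w (b v)" "v \<in> V"
  shows "agree n v w \<or> agree n v (b w)"
  using assms(1)
proof
  assume "agree n w v"
  then show ?thesis by (auto simp: agree_def)
next
  assume *: "agree n w (b v)"
  have "f v = f (b w)" if f: "inv_mon n f" for f
  proof -
    have "f (b w) = f (b (b v))" using * inv_mon_b[OF f] unfolding agree_def by blast
    then show ?thesis using inv_mon_b_b[OF f assms(2)] by simp
  qed
  then show ?thesis by (simp add: agree_def)
qed

text \<open>If no product of degree at most 4 distinguishes \<open>v\<close> from \<open>b v\<close>
  or \<open>w\<close> from \<open>b w\<close>, the symmetric sums are just twice the values, so
  symmetrising loses nothing.\<close>

lemma agree_four:
  assumes sa: "sum_agree v w" and v: "v \<in> V" and w: "w \<in> V"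
  shows "agree 4 v w \<or> agree 4 v (b w)"
proof -
  consider M where "inv_mon 4 M" "M v \<noteq> M (b v)" | M where "inv_mon 4 M" "M w \<noteq> M (b w)"
    | "\<And>M. inv_mon 4 M \<Longrightarrow> M v = M (b v) \<and> M w = M (b w)" by blast
  then show ?thesis
  proof cases
    case 1
    then show ?thesis using agree_of_distinguishing[OF sa w 1] by simp
  next
    case 2
    then have "agree 4 w v \<or> agree 4 w (b v)"
      using agree_of_distinguishing[OF sum_agree_sym[OF sa] v 2] by simp
    then show ?thesis by (rule agree_swap[OF _ v])
  next
    case 3
    have "f v = f w" if f: "inv_mon 4 f" for f
    proof -
      have "f v + f (b v) = f w + f (b w)"
        using sa inv_mon_mono[OF f, of 8] by (simp add: sum_agree_def)
      then have "2 * f v = 2 * f w" using 3[OF f] by (metis mult_2)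
      then show ?thesis by simp
    qed
    then show ?thesis by (simp add: agree_def)
  qed
qed

section \<open>Roots of unity as powers of \<open>\<zeta>\<close>\<close>

lemma cube_root_cases:
  assumes "r ^ 3 = (1::'k)"
  shows "\<exists>k<3. r = \<zeta> ^ (2 * k)"
proof -
  have 4: "\<zeta> ^ (2 * 2) = - \<zeta>"
    using root_cube power_add[of \<zeta> 3 1] by simp
  \<comment> \<open>The two primitive cube roots of unity have sum -1 and product 1, which yields
    the factorisation of \<open>r ^ 3 - 1\<close>.\<close>
  have "(r - \<zeta> ^ 2) * (r - \<zeta> ^ (2 * 2)) =
      r ^ 2 - (\<zeta> ^ 2 + \<zeta> ^ (2 * 2)) * r + \<zeta> ^ 2 * \<zeta> ^ (2 * 2)"
    by (simp add: algebra_simps power2_eq_square)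
  also have "\<zeta> ^ 2 + \<zeta> ^ (2 * 2) = -1" unfolding 4 root_square by simp
  also have "\<zeta> ^ 2 * \<zeta> ^ (2 * 2) = 1" using root_sixth power_add[of \<zeta> 2 4] by simp
  finally have "(r - 1) * ((r - \<zeta> ^ 2) * (r - \<zeta> ^ (2 * 2))) = (r - 1) * (r ^ 2 + r + 1)"
    by simp
  also have "\<dots> = r ^ 3 - 1" by (simp add: algebra_simps power2_eq_square power3_eq_cube)
  finally have "r = \<zeta> ^ (2 * 0) \<or> r = \<zeta> ^ (2 * 1) \<or> r = \<zeta> ^ (2 * 2)" using assms by simp
  moreover have "0 < (3::nat)" "1 < (3::nat)" "2 < (3::nat)" by simp_all
  ultimately show ?thesis by blast
qed

text \<open>By \<open>\<zeta> ^ 6 = 1\<close> the exponent \<open>2 * k\<close> may be replaced by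
  \<open>8 * k\<close>, which is both 2 times \<open>4 * k\<close> and 4 times \<open>2 * k\<close>.
  An even exponent is wanted because an even power of \<open>a\<close> fixes all forms of weight
  3.\<close>

lemma cube_root_cases_even:
  assumes "r ^ 3 = (1::'k)" "i = 2 \<or> i = 4"
  shows "\<exists>k. even k \<and> r = \<zeta> ^ (i * k)"
proof -
  obtain k where k: "k < 3" "r = \<zeta> ^ (2 * k)" using cube_root_cases[OF assms(1)] by blast
  have "\<zeta> ^ (8 * k) = (\<zeta> ^ 6) ^ k * \<zeta> ^ (2 * k)"
    by (simp flip: power_mult power_add)
  then have "\<zeta> ^ (8 * k) = r" by (simp add: root_sixth k(2))
  moreover have "8 * k = 2 * (4 * k)" "8 * k = 4 * (2 * k)" by simp_all
  ultimately have "r = \<zeta> ^ (2 * (4 * k))" "r = \<zeta> ^ (4 * (2 * k))" by metis+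
  then show ?thesis using assms(2) by (metis dvd_triv_left even_mult_iff even_numeral)
qed

lemma sixth_root_cases:
  assumes "r ^ 6 = (1::'k)"
  shows "\<exists>s l. s ^ 3 = 1 \<and> r = (-1) ^ l * s"
proof -
  have "(r ^ 3 - 1) * (r ^ 3 + 1) = r ^ 6 - 1"
    by (simp add: algebra_simps flip: power_add)
  then consider "r ^ 3 = 1" | "r ^ 3 = -1" using assms by (auto simp: eq_neg_iff_add_eq_0)
  then show ?thesis
  proof cases
    case 1
    then show ?thesis by (intro exI[of _ r] exI[of _ 0]) simp
  next
    case 2
    then show ?thesis by (intro exI[of _ "- r"] exI[of _ 1]) (simp add: power3_eq_cube)
  qed
qed

lemma sixth_root_is_power:
  assumes "r ^ 6 = (1::'k)"
  shows "\<exists>k. r = \<zeta> ^ k"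
proof -
  obtain s l where s: "s ^ 3 = 1" "r = (-1) ^ l * s" using sixth_root_cases[OF assms] by blast
  obtain k where "s = \<zeta> ^ (2 * k)" using cube_root_cases[OF s(1)] by blast
  then have "r = \<zeta> ^ (3 * l + 2 * k)" unfolding power_add power_mult root_cube using s(2) by (simp add: power_mult)
  then show ?thesis ..
qed

section \<open>Translates under A, and weights that vanish at a point\<close>

definition twist :: "nat \<Rightarrow> nat \<Rightarrow> 'v \<Rightarrow> 'v" where
  "twist k l w = (a ^^ k) ((c ^^ l) w)"

lemma twist_closed: "w \<in> V \<Longrightarrow> twist k l w \<in> V"
proof -
  assume "w \<in> V"
  then have "(c ^^ l) w \<in> V" by (induction l) (simp_all add: c_closed)
  then show ?thesis unfolding twist_def by (induction k) (simp_all add: a_closed)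
qed

lemma twist_Suc: "twist (Suc k) l w = a (twist k l w)" "twist 0 (Suc l) w = c (twist 0 l w)"
    "twist 0 0 w = w"
  by (simp_all add: twist_def)

lemma twist_induct:
  assumes "w \<in> V" "Q w" "\<And>u. u \<in> V \<Longrightarrow> Q u \<Longrightarrow> Q (a u)" "\<And>u. u \<in> V \<Longrightarrow> Q u \<Longrightarrow> Q (c u)"
  shows "Q (twist k l w)"
proof -
  have "Q (twist 0 l w)"
    by (induction l) (simp_all add: twist_Suc(2,3) assms(1,2) assms(4) twist_closed)
  then show ?thesis by (induction k) (simp_all add: twist_Suc(1) assms(1) assms(3) twist_closed)
qed

lemma orb_twist: "w \<in> V \<Longrightarrow> Orb (twist k l w) = Orb w"
  by (rule twist_induct[where Q = "\<lambda>u. Orb u = Orb w"]) (simp_all add: orb_a orb_c)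

lemma agree_twist: "agree n v w \<Longrightarrow> w \<in> V \<Longrightarrow> agree n v (twist k l w)"
  by (rule twist_induct[where Q = "agree n v"]) (auto intro: agree_a agree_c)

lemma sum_agree_twist: "sum_agree v w \<Longrightarrow> w \<in> V \<Longrightarrow> sum_agree v (twist k l w)"
  by (rule twist_induct[where Q = "sum_agree v"]) (auto intro: sum_agree_a sum_agree_c)

lemma form_twist:
  assumes "x \<in> F i e" "w \<in> V"
  shows "x (twist k l w) = \<zeta> ^ (i * k) * (-1) ^ (e * l) * x w"
proof -
  have "x (twist 0 l w) = (-1) ^ (e * l) * x w"
    by (induction l) (simp_all add: twist_Suc(2,3) form_c[OF assms(1)] twist_closed assms(2) power_add)
  then show ?thesis
    by (induction k) (simp_all add: twist_Suc(1) form_a[OF assms(1)] twist_closed assms(2) power_add)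
qed

text \<open>The weights range over all natural numbers, not over residues, so the sets
  \<open>S\<close> in use are given by parity and divisibility conditions that do not change modulo
  6 and 2.\<close>

definition vanishes_on :: "(nat \<Rightarrow> nat \<Rightarrow> bool) \<Rightarrow> 'v \<Rightarrow> bool" where
  "vanishes_on S u \<longleftrightarrow> (\<forall>i e x. S i e \<longrightarrow> x \<in> F i e \<longrightarrow> x u = 0)"

lemma vanishes_onD: "vanishes_on S u \<Longrightarrow> x \<in> F i e \<Longrightarrow> S i e \<Longrightarrow> x u = 0"
  unfolding vanishes_on_def by blast

lemma vanishes_on_twist: "vanishes_on S u \<Longrightarrow> u \<in> V \<Longrightarrow> vanishes_on S (twist k l u)"
  unfolding vanishes_on_def using form_twist by (metis mult_zero_right)

lemma vanishes_on_b:
  assumes "vanishes_on S u" "\<And>i e. S i e \<Longrightarrow> S (5 * i) e"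
  shows "vanishes_on S (b u)"
  unfolding vanishes_on_def using vanishes_onD[OF assms(1) form_b] assms(2) by blast

lemma coprime_six: "i < 6 \<Longrightarrow> coprime i 6 \<longleftrightarrow> i = 1 \<or> i = (5::nat)"
proof -
  assume "i < 6"
  then have "i = 0 \<or> i = 1 \<or> i = 2 \<or> i = 3 \<or> i = 4 \<or> i = 5" by presburger
  then show ?thesis by (elim disjE) (simp_all add: coprime_iff_gcd_eq_1 gcd_non_0_nat)
qed

text \<open>Equal products force every form of type \<open>Out\<close> to take values at
  \<open>v\<close> and \<open>w\<close> that differ by one common sign: a single form with different
  values at \<open>v\<close> and \<open>w\<close> transmits its sign to all others. For the sign +1
  the points coincide, and for -1 the given translate of \<open>w\<close> is
  \<open>v\<close>.\<close>

lemma orb_eq_sign: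
  assumes v: "v \<in> V" and w: "w \<in> V"
    and same: "\<And>i e x. i < 6 \<Longrightarrow> e < 2 \<Longrightarrow> x \<in> F i e \<Longrightarrow> \<not> Out i e \<Longrightarrow>
        x v = x w \<and> x (twist k l w) = x w"
    and out: "\<And>i e x. i < 6 \<Longrightarrow> e < 2 \<Longrightarrow> x \<in> F i e \<Longrightarrow> Out i e \<Longrightarrow> x (twist k l w) = - x w"
    and pair: "\<And>i e x j d y. i < 6 \<Longrightarrow> e < 2 \<Longrightarrow> x \<in> F i e \<Longrightarrow> Out i e \<Longrightarrow>
        j < 6 \<Longrightarrow> d < 2 \<Longrightarrow> y \<in> F j d \<Longrightarrow> Out j d \<Longrightarrow> x v * y v = x w * y w"
  shows "Orb v = Orb w"
proof (cases "\<forall>i e x. i < 6 \<longrightarrow> e < 2 \<longrightarrow> x \<in> F i e \<longrightarrow> Out i e \<longrightarrow> x v = x w")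
  case True
  have "v = w" by (rule forms_separate[OF v w]) (use True same in blast)
  then show ?thesis by simp
next
  case False
  then obtain j d y where y: "j < 6" "d < 2" "y \<in> F j d" "Out j d" "y v \<noteq> y w" by blast
  have "(y v - y w) * (y v + y w) = y v * y v - y w * y w" by (simp add: algebra_simps)
  then have "(y v - y w) * (y v + y w) = 0" using pair[OF y(1-4) y(1-4)] by simp
  then have yw: "y w = - y v" using y(5) by (simp add: eq_neg_iff_add_eq_0 add.commute)
  have "v = twist k l w"
  proof (rule forms_separate[OF v twist_closed[OF w]])
    fix i e x assume x: "i < 6" "e < 2" "x \<in> F i e"
    show "x v = x (twist k l w)"
    proof (cases "Out i e")
      case True
      have "x v * y v = - x w * y v" using pair[OF x True y(1-4)] yw by simp
      moreover have "y v \<noteq> 0" using y(5) yw by auto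
      ultimately have "x v = - x w" by (metis mult_right_cancel)
      then show ?thesis using out[OF x True] by simp
    next
      case False
      then show ?thesis using same[OF x] by simp
    qed
  qed
  then show ?thesis using orb_twist[OF w] by metis
qed

lemma form_b':
  assumes "x \<in> F i e" "(5 * i) mod 6 = j mod 6"
  shows "(\<lambda>u. x (b u)) \<in> F j e"
  using form_b[OF assms(1)] form_mod assms(2) by metis

text \<open>The weights with \<open>e + \<epsilon> * i\<close> even form the cyclic group generated
  by (1, \<open>\<epsilon>\<close>), of index 2 among all weights. The product of \<open>c\<close>
  with the \<open>3 * \<epsilon>\<close>-th power of \<open>a\<close> acts trivially on them and by
  -1 on the other coset. Two forms from that coset multiply into the subgroup, which is why products
  of degree 2 suffice.\<close>

lemma orb_eq_via_generating_form:
  assumes v: "v \<in> V" and w: "w \<in> V"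
    and comp: "\<And>m i e f. mon m i e f \<Longrightarrow> m \<le> 2 \<Longrightarrow> even (e + \<epsilon> * i) \<Longrightarrow> f v = f w"
  shows "Orb v = Orb w"
proof (rule orb_eq_sign[OF v w, where Out = "\<lambda>i e. odd (e + \<epsilon> * i)" and k = "3 * \<epsilon>" and l = 1])
  fix i e x assume x: "x \<in> F i e"
  have "\<zeta> ^ (i * (3 * \<epsilon>)) = (\<zeta> ^ 3) ^ (\<epsilon> * i)" by (simp flip: power_mult add: mult_ac)
  then have tw: "x (twist (3 * \<epsilon>) 1 w) = (-1) ^ (e + \<epsilon> * i) * x w"
    using form_twist[OF x w, of "3 * \<epsilon>" 1] by (simp add: root_cube power_add)
  show "x (twist (3 * \<epsilon>) 1 w) = - x w" if "odd (e + \<epsilon> * i)" using tw that by simp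
  show "x v = x w \<and> x (twist (3 * \<epsilon>) 1 w) = x w" if "\<not> odd (e + \<epsilon> * i)"
    using tw that comp[OF mon_form[OF x]] by simp
  show "x v * y v = x w * y w"
    if out: "odd (e + \<epsilon> * i)" and y: "y \<in> F j d" "odd (d + \<epsilon> * j)" for j d y
  proof -
    have "even ((e + d) + \<epsilon> * (i + j))" using out y(2) by (auto simp: algebra_simps)
    then show ?thesis using comp[OF mon_mult[OF mon_form[OF x] mon_form[OF y(1)]]] by simp
  qed
qed

section \<open>Moving \<open>w\<close> by A so that a chosen form takes the same value at both
  points\<close>

lemma twist_normalise:
  assumes x: "x \<in> F 1 e" and w: "w \<in> V" and eq: "x v ^ 6 = x w ^ 6" and nz: "x v \<noteq> 0"
  obtains k where "x (twist k 0 w) = x v"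
proof -
  have "x w \<noteq> 0" using eq nz by (metis power_eq_0_iff zero_less_numeral)
  then have "(x v / x w) ^ 6 = 1" using eq by (simp add: power_divide)
  then obtain k where "x v / x w = \<zeta> ^ k" using sixth_root_is_power by blast
  then have "x (twist k 0 w) = x v"
    using form_twist[OF x w, of k 0] \<open>x w \<noteq> 0\<close> by (simp add: field_simps)
  then show ?thesis by (rule that)
qed

lemma twist_normalise_even:
  assumes x: "x \<in> F i e" and i: "i = 2 \<or> i = 4" and w: "w \<in> V"
    and eq: "x v ^ 3 = x w ^ 3" and nz: "x v \<noteq> 0"
  obtains k where "even k" "x (twist k 0 w) = x v"
proof -
  have "x w \<noteq> 0" using eq nz by (metis power_eq_0_iff zero_less_numeral)
  then have "(x v / x w) ^ 3 = 1" using eq by (simp add: power_divide)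
  then obtain k where k: "even k" "x v / x w = \<zeta> ^ (i * k)" using cube_root_cases_even i by blast
  then have "x (twist k 0 w) = x v"
    using form_twist[OF x w, of k 0] \<open>x w \<noteq> 0\<close> by (simp add: field_simps)
  then show ?thesis using that k by blast
qed

text \<open>A power of \<open>c\<close> corrects the sign and an even power of \<open>a\<close> the
  cube root of unity. The additional \<open>3 * \<epsilon> * l\<close> steps of \<open>a\<close> are
  invisible to even weights and cancel the sign that \<open>c\<close> puts on forms of weight (3,
  \<open>\<epsilon>\<close>), so a form of that weight already normalised stays so.\<close>

lemma twist_normalise_sign:
  assumes x: "x \<in> F i 1" and i: "i = 2 \<or> i = 4" and w: "w \<in> V"
    and eq: "x v ^ 6 = x w ^ 6" and nz: "x v \<noteq> 0"
  obtains k l where "even k" "x (twist (k + 3 * \<epsilon> * l) l w) = x v"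
proof -
  have "x w \<noteq> 0" using eq nz by (metis power_eq_0_iff zero_less_numeral)
  then have "(x v / x w) ^ 6 = 1" using eq by (simp add: power_divide)
  then obtain s l where s: "s ^ 3 = 1" "x v / x w = (-1) ^ l * s" using sixth_root_cases by blast
  obtain k where k: "even k" "s = \<zeta> ^ (i * k)" using cube_root_cases_even[OF s(1) i] by blast
  have "\<zeta> ^ (i * (3 * \<epsilon> * l)) = (\<zeta> ^ 3) ^ (i * \<epsilon> * l)" by (simp flip: power_mult add: mult_ac)
  also have "\<dots> = 1" using i by (auto simp: root_cube)
  finally have "\<zeta> ^ (i * (k + 3 * \<epsilon> * l)) = s" using k by (simp add: distrib_left power_add)
  then have "x (twist (k + 3 * \<epsilon> * l) l w) = x v"
    using form_twist[OF x w, of "k + 3 * \<epsilon> * l" l] s(2) \<open>x w \<noteq> 0\<close> by (simp add: field_simps)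
  then show ?thesis using that k by blast
qed

section \<open>A form of weight 1 that does not vanish at \<open>v\<close>\<close>

lemma orb_eq_weight_one_split:
  assumes v: "v \<in> V" and w: "w \<in> V" and ag: "agree 6 v w"
    and x: "x \<in> F 1 \<epsilon>" "x v \<noteq> 0" and xb: "x (b v) \<noteq> 0"
  shows "Orb v = Orb w"
proof -
  have "x v ^ 6 = x w ^ 6" by (rule agreeD[OF ag mon_form_power[OF x(1)]]) auto
  then obtain k where k: "x (twist k 0 w) = x v" using twist_normalise[OF x(1) w _ x(2)] by blast
  define w' where "w' = twist k 0 w"
  have w': "w' \<in> V" and ag': "agree 6 v w'" and xw': "x w' = x v"
    using twist_closed[OF w] agree_twist[OF ag w] k by (simp_all add: w'_def)
  define y where "y = (\<lambda>u. x (b u))"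
  have y: "y \<in> F 5 \<epsilon>" using form_b[OF x(1)] by (simp add: y_def)
  have "x v * y v = x w' * y w'"
    by (rule agreeD[OF ag' mon_mult[OF mon_form[OF x(1)] mon_form[OF y]]]) auto
  then have yw': "y w' = y v" using xw' x(2) by simp
  have yv: "y v \<noteq> 0" using xb by (simp add: y_def)
  have "Orb v = Orb w'"
  proof (rule orb_eq_via_generating_form[OF v w', where \<epsilon> = \<epsilon>])
    fix m i e f assume f: "mon m i e f" and m: "m \<le> 2" and ev: "even (e + \<epsilon> * i)"
    \<comment> \<open>The weight is brought to zero with copies of \<open>x\<close> (weight 1) or of
      \<open>y\<close> (weight 5), whichever takes fewer: at most three. With
      \<open>m \<le> 2\<close> this stays below degree 6, the degree already spent on
      \<open>x v ^ 6 = x w ^ 6\<close>.\<close>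
    define j where "j = i mod 6"
    have dj: "6 dvd i + (6 - j)" "6 dvd i + j * 5" "j < 6" unfolding j_def by presburger+
    have pj: "even j \<longleftrightarrow> even i" unfolding j_def by presburger
    show "f v = f w'"
    proof (cases "j \<ge> 3")
      case True
      have "even (e + (6 - j) * \<epsilon>)" using ev pj dj(3) by (auto simp: even_diff_nat)
      then have "f v * x v ^ (6 - j) = f w' * x w' ^ (6 - j)"
        by (intro agreeD[OF ag' mon_mult[OF f mon_form_power[OF x(1)]]]) (use m True dj in auto)
      then show ?thesis using x(2) xw' by simp
    next
      case False
      have "even (e + j * \<epsilon>)" using ev pj by auto
      then have "f v * y v ^ j = f w' * y w' ^ j"
        by (intro agreeD[OF ag' mon_mult[OF f mon_form_power[OF y]]]) (use m False dj in auto)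
      then show ?thesis using yv yw' by simp
    qed
  qed
  then show ?thesis using orb_twist[OF w] by (simp add: w'_def)
qed

text \<open>Here a product that contains \<open>x\<close> vanishes at \<open>b v\<close> and \<open>b w\<close>, so all eight degrees can be used.\<close>

lemma orb_eq_weight_one_isotropic:
  assumes v: "v \<in> V" and w: "w \<in> V" and sa: "sum_agree v w"
    and x: "x \<in> F 1 \<epsilon>" "x v \<noteq> 0" "x (b v) = 0" "x (b w) = 0"
  shows "Orb v = Orb w"
proof -
  have "x v ^ 6 + x (b v) ^ 6 = x w ^ 6 + x (b w) ^ 6"
    by (rule sum_agreeD[OF sa mon_form_power[OF x(1)]]) auto
  then have "x v ^ 6 = x w ^ 6" using x by simp
  then obtain k where k: "x (twist k 0 w) = x v" using twist_normalise[OF x(1) w _ x(2)] by blast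
  define w' where "w' = twist k 0 w"
  have w': "w' \<in> V" and sa': "sum_agree v w'" and xw': "x w' = x v"
    using twist_closed[OF w] sum_agree_twist[OF sa w] k by (simp_all add: w'_def)
  have "x (b w') = 0"
    unfolding w'_def using form_twist[OF form_b[OF x(1)] w] x(4) by simp
  have "Orb v = Orb w'"
  proof (rule orb_eq_via_generating_form[OF v w', where \<epsilon> = \<epsilon>])
    fix m i e f assume f: "mon m i e f" and m: "m \<le> 2" and ev: "even (e + \<epsilon> * i)"
    \<comment> \<open>For a weight divisible by 6 this gives 6, not 0: at least one factor
      \<open>x\<close> must occur so that the summands at \<open>b v\<close> and \<open>b w'\<close>
      vanish. The total degree reaches 2 + 6 = 8.\<close>
    define k where "k = 6 - i mod 6"
    have dk: "6 dvd i + k" "k \<le> 6" "k > 0" "even k \<longleftrightarrow> even i" unfolding k_def by presburger+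
    have "f v * x v ^ k + f (b v) * x (b v) ^ k = f w' * x w' ^ k + f (b w') * x (b w') ^ k"
      by (rule sum_agreeD[OF sa' mon_mult[OF f mon_form_power[OF x(1)]]]) (use m dk ev in auto)
    then show "f v = f w'" using x xw' \<open>x (b w') = 0\<close> dk(3) by (simp add: power_0_left)
  qed
  then show ?thesis using orb_twist[OF w] by (simp add: w'_def)
qed

text \<open>The product of \<open>x\<close> and \<open>y\<close> changes sign under
  \<open>b\<close>. Nonzero at \<open>v\<close>, it distinguishes \<open>v\<close> from
  \<open>b v\<close> with degree 2 and leaves degree 6. If it is zero at \<open>v\<close>, then it
  is zero at \<open>w\<close> too, so \<open>x\<close> vanishes at \<open>b w\<close> or at
  \<open>w\<close>, and the latter case becomes the former on replacing \<open>w\<close> by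
  \<open>b w\<close>.\<close>

lemma orb_eq_weight_one:
  assumes v: "v \<in> V" and w: "w \<in> V" and sa: "sum_agree v w" and x: "x \<in> F 1 \<epsilon>" "x v \<noteq> 0"
  shows "Orb v = Orb w"
proof -
  define y where "y = (\<lambda>u. x (b u))"
  have y: "y \<in> F 5 \<epsilon>" using form_b[OF x(1)] by (simp add: y_def)
  have xy: "mon 2 6 (2 * \<epsilon>) (\<lambda>u. x u * y u)"
    using mon_mult[OF mon_form[OF x(1)] mon_form[OF y]] by (simp add: mult_2 numeral_2_eq_2)
  have yb: "y (b u) = - x u" if "u \<in> V" for u using form_b_b[OF x(1) that] by (simp add: y_def)
  show ?thesis
  proof (cases "x (b v) = 0")
    case False
    have "agree (8 - 2) v w \<or> agree (8 - 2) v (b w)"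
    proof (rule agree_of_distinguishing[OF sa w])
      show "inv_mon 2 (\<lambda>u. x u * y u)" by (rule inv_monI[OF xy]) auto
      have "x (b v) * y (b v) = - (x v * x (b v))" by (simp add: yb v)
      then show "x v * y v \<noteq> x (b v) * y (b v)" using False x(2) by (simp add: y_def)
    qed simp
    then show ?thesis
      using orb_eq_weight_one_split[OF v _ _ x False] w b_closed[OF w] orb_b[OF w] by auto
  next
    case True
    \<comment> \<open>The square is taken because the symmetric sum of the product itself is
      identically zero.\<close>
    have "(x v * y v) ^ 2 + (x (b v) * y (b v)) ^ 2 = (x w * y w) ^ 2 + (x (b w) * y (b w)) ^ 2"
      by (rule sum_agreeD[OF sa mon_power[OF xy]]) auto
    moreover have "y v = 0" "y w = x (b w)" using True by (simp_all add: y_def)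
    ultimately have "2 * (x w * x (b w)) ^ 2 = 0"
      using True by (simp add: yb[OF w] power2_eq_square mult_ac)
    then consider "x (b w) = 0" | "x w = 0" by auto
    then show ?thesis
    proof cases
      case 1
      then show ?thesis using orb_eq_weight_one_isotropic[OF v w sa x True] by simp
    next
      case 2
      have "x (b (b w)) = 0" using 2 form_b_b[OF x(1) w] by simp
      then show ?thesis
        using orb_eq_weight_one_isotropic[OF v b_closed[OF w] sum_agree_b[OF sa w] x True] orb_b[OF w]
        by simp
    qed
  qed
qed

section \<open>A form of weight 3 that does not vanish, while weights 1 and 5 do\<close>

text \<open>The lemma is applied with \<open>q = 2\<close> when all even weights can be completed to
  zero, and with \<open>q = 6\<close> when weights 2 and 4 vanish. The remaining ambiguity is the
  sign of \<open>c\<close> combined with the power of \<open>a\<close> that fixes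
  \<open>s\<close>.\<close>

lemma orb_eq_weight_three_aux:
  assumes v: "v \<in> V" and w: "w \<in> V"
    and s: "s \<in> F 3 \<epsilon>" "s v = s w" "s v \<noteq> 0"
    and q: "even q"
    and vanish: "\<And>i e x. i < 6 \<Longrightarrow> e < 2 \<Longrightarrow> x \<in> F i e \<Longrightarrow> \<not> q dvd i \<Longrightarrow> i \<noteq> 3 \<Longrightarrow> x v = 0 \<and> x w = 0"
    and comp: "\<And>m i e f. mon m i e f \<Longrightarrow> m \<le> 4 \<Longrightarrow> q dvd i \<Longrightarrow> even e \<Longrightarrow> f v = f w"
    and q6: "q dvd 6"
  shows "Orb v = Orb w"
proof -
  \<comment> \<open>Among the weights that may be nonzero these are the ones on which the translate
    by \<open>a\<close> (\<open>3 * \<epsilon>\<close> times) and \<open>c\<close> acts by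
    -1.\<close>
  define Out where "Out = (\<lambda>i e::nat. q dvd i \<and> odd e \<or> i = 3 \<and> odd (e + \<epsilon>))"
  have q3: "\<not> q dvd 3" using q dvd_trans[of 2 q 3] by auto
  have evq: "even i" if "q dvd i" for i using q dvd_trans that by blast
  \<comment> \<open>Multiplication by \<open>s\<close> turns a form of weight 3 into a product of
    weight 6. So every form in \<open>Out\<close> is represented, up to a nonzero factor common to
    both points, by a product of degree at most 2 with odd \<open>c\<close>-weight, and a pair of
    forms by a product of degree at most 4, as \<open>comp\<close> requires.\<close>
  have hat: "\<exists>m i' e' f t. m \<le> 2 \<and> mon m i' e' f \<and> q dvd i' \<and> odd e' \<and>
      t \<noteq> 0 \<and> f v = x v * t \<and> f w = x w * t" if x: "x \<in> F i e" "Out i e" for i e x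
  proof (cases "q dvd i \<and> odd e")
    case True
    then show ?thesis
      using mon_form[OF x(1)]
      by - (rule exI[of _ 1], rule exI[of _ i], rule exI[of _ e], rule exI[of _ x], rule exI[of _ 1], simp)
  next
    case False
    then have i: "i = 3" "odd (e + \<epsilon>)" using x(2) by (auto simp: Out_def)
    have "mon (1 + 1) (3 + 3) (e + \<epsilon>) (\<lambda>u. x u * s u)"
      using mon_mult[OF mon_form[OF x(1)] mon_form[OF s(1)]] i(1) by simp
    then show ?thesis
      using i s q6
      by - (rule exI[of _ "1 + 1"], rule exI[of _ "3 + 3"], rule exI[of _ "e + \<epsilon>"],
        rule exI[of _ "\<lambda>u. x u * s u"], rule exI[of _ "s v"], simp)
  qed
  have tw: "x (twist (3 * \<epsilon>) 1 w) = (-1) ^ (i * \<epsilon> + e) * x w" if x: "x \<in> F i e" for x i e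
  proof -
    have "\<zeta> ^ (i * (3 * \<epsilon>)) = (\<zeta> ^ 3) ^ (i * \<epsilon>)" by (simp flip: power_mult add: mult_ac)
    then show ?thesis using form_twist[OF x w, of "3 * \<epsilon>" 1] by (simp add: root_cube power_add)
  qed
  show ?thesis
  proof (rule orb_eq_sign[OF v w, where Out = Out and k = "3 * \<epsilon>" and l = 1])
    fix i e x assume x: "i < 6" "e < 2" "x \<in> F i e" and o: "\<not> Out i e"
    consider "q dvd i" "even e" | "i = 3" "even (e + \<epsilon>)" | "\<not> q dvd i" "i \<noteq> 3"
      using o unfolding Out_def by blast
    then show "x v = x w \<and> x (twist (3 * \<epsilon>) 1 w) = x w"
    proof cases
      case 1
      then show ?thesis using comp[OF mon_form[OF x(3)]] tw[OF x(3)] evq[of i] by simp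
    next
      case 2
      have "mon (1 + 1) (3 + 3) (e + \<epsilon>) (\<lambda>u. x u * s u)"
        using mon_mult[OF mon_form[OF x(3)] mon_form[OF s(1)]] 2(1) by simp
      then have "x v * s v = x w * s w" using comp[of "1 + 1" "3 + 3" "e + \<epsilon>"] 2(2) q6 by simp
      then show ?thesis using s tw[OF x(3)] 2 by simp
    next
      case 3
      then show ?thesis using vanish[OF x] tw[OF x(3)] by simp
    qed
  next
    fix i e x assume x: "x \<in> F i e" "Out i e"
    then have "odd (i * \<epsilon> + e)" using evq[of i] by (auto simp: Out_def)
    then show "x (twist (3 * \<epsilon>) 1 w) = - x w" using tw[OF x(1)] by simp
  next
    fix i e x j d y assume x: "x \<in> F i e" "Out i e" and y: "y \<in> F j d" "Out j d"
    obtain m i' e' f t where f: "m \<le> 2" "mon m i' e' f" "q dvd i'" "odd e'"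
      "t \<noteq> 0" "f v = x v * t" "f w = x w * t" using hat[OF x] by blast
    obtain n j' d' g r where g: "n \<le> 2" "mon n j' d' g" "q dvd j'" "odd d'"
      "r \<noteq> 0" "g v = y v * r" "g w = y w * r" using hat[OF y] by blast
    have "f v * g v = f w * g w"
      by (rule comp[OF mon_mult[OF f(2) g(2)]]) (use f g in auto)
    then have "x v * y v * (t * r) = x w * y w * (t * r)" using f g by (simp add: mult_ac)
    then show "x v * y v = x w * y w" using f(5) g(5) by simp
  qed
qed

text \<open>The weight of \<open>z\<close> has order 3, hence at most two copies of \<open>z\<close>
  bring any even weight to a multiple of 6.\<close>

lemma complement_even:
  assumes ag: "agree (n + 2) v w" and z: "z \<in> F j 0" "j = 2 \<or> j = 4" "z v = z w" "z v \<noteq> 0"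
    and f: "mon m i e f" "m \<le> n" "even i" "even e"
  shows "f v = f w"
proof -
  have "\<exists>k\<le>2. 6 dvd i + k * j"
  proof -
    have "6 dvd i + 0 * j \<or> 6 dvd i + 1 * j \<or> 6 dvd i + 2 * j" using z(2) f(3) by presburger
    moreover have "(0::nat) \<le> 2" "(1::nat) \<le> 2" "(2::nat) \<le> 2" by simp_all
    ultimately show ?thesis by blast
  qed
  then obtain k where k: "k \<le> 2" "6 dvd i + k * j" by blast
  have "f v * z v ^ k = f w * z w ^ k"
    by (rule agreeD[OF ag mon_mult[OF f(1) mon_form_power[OF z(1)]]]) (use f k in auto)
  then show ?thesis using z by simp
qed

text \<open>The cases differ in what accompanies \<open>s\<close>. A form of type (2, 0) or (4, 0)
  completes all even weights for two degrees, leaving degree 4 of 6. Failing that, a form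
  \<open>u\<close> of type (2, 1) or (4, 1) generates all weights together with \<open>s\<close>;
  once both values are normalised no sign is left and the points coincide. With neither, weights 2
  and 4 vanish altogether.\<close>

lemma orb_eq_weight_three_normalised:
  assumes v: "v \<in> V" and w: "w \<in> V" and ag: "agree 6 v w"
    and vanish: "vanishes_on (\<lambda>i e. coprime i 6) v" "vanishes_on (\<lambda>i e. coprime i 6) w"
    and s: "s \<in> F 3 \<epsilon>" "s v = s w" "s v \<noteq> 0"
  shows "Orb v = Orb w"
proof -
  consider j z where "z \<in> F j 0" "j = 2 \<or> j = 4" "z v \<noteq> 0"
    | j u where "\<And>j z. z \<in> F j 0 \<Longrightarrow> j = 2 \<or> j = 4 \<Longrightarrow> z v = 0" "u \<in> F j 1" "j = 2 \<or> j = 4" "u v \<noteq> 0"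
    | "\<And>j e u. u \<in> F j e \<Longrightarrow> e < 2 \<Longrightarrow> j = 2 \<or> j = 4 \<Longrightarrow> u v = 0"
    using less_2_cases by (metis One_nat_def)
  then show ?thesis
  proof cases
    case z: 1
    have "z v ^ 3 = z w ^ 3" by (rule agreeD[OF ag mon_form_power[OF z(1)]]) (use z in auto)
    then obtain k where k: "even k" "z (twist k 0 w) = z v"
      using twist_normalise_even[OF z(1,2) w _ z(3)] by blast
    define w' where "w' = twist k 0 w"
    have ag': "agree (4 + 2) v w'" using agree_twist[OF ag w] by (simp add: w'_def)
    have "\<zeta> ^ (3 * k) = 1" using k(1) by (simp add: power_mult root_cube)
    then have s': "s v = s w'" using form_twist[OF s(1) w, of k 0] s(2) by (simp add: w'_def)
    have "Orb v = Orb w'"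
    proof (rule orb_eq_weight_three_aux[OF v _ s(1) s' s(3), of 2])
      show "w' \<in> V" using twist_closed[OF w] by (simp add: w'_def)
      fix i e x assume "i < 6" "x \<in> F i e" "\<not> 2 dvd i" "i \<noteq> (3::nat)"
      moreover from this have "i = 1 \<or> i = 5" by presburger
      ultimately show "x v = 0 \<and> x w' = 0"
        using vanishes_onD[OF vanish(1)] vanishes_onD[OF vanishes_on_twist[OF vanish(2) w]] coprime_six
        by (simp add: w'_def)
    next
      fix m i e f assume "mon m i e f" "m \<le> 4" "2 dvd i" "even e"
      then show "f v = f w'" using complement_even[OF ag' z(1,2) _ z(3)] k(2) by (simp add: w'_def)
    qed auto
    then show ?thesis using orb_twist[OF w] by (simp add: w'_def)
  next
    case u: 2
    have zv: "z v = 0 \<and> z w = 0" if z: "z \<in> F j 0" "j = 2 \<or> j = 4" for j z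
    proof -
      have "z v ^ 3 = z w ^ 3" by (rule agreeD[OF ag mon_form_power[OF z(1)]]) (use z in auto)
      then show ?thesis using u(1)[OF z] by (simp add: power_0_left)
    qed
    have "u v ^ 6 = u w ^ 6" by (rule agreeD[OF ag mon_form_power[OF u(2)]]) (use u in auto)
    then obtain k l where kl: "even k" "u (twist (k + 3 * \<epsilon> * l) l w) = u v"
      using twist_normalise_sign[OF u(2,3) w _ u(4)] by blast
    define w' where "w' = twist (k + 3 * \<epsilon> * l) l w"
    have w': "w' \<in> V" using twist_closed[OF w] by (simp add: w'_def)
    have ag': "agree 6 v w'" using agree_twist[OF ag w] by (simp add: w'_def)
    have uw': "u w' = u v" using kl by (simp add: w'_def)
    have "\<zeta> ^ (3 * (k + 3 * \<epsilon> * l)) * (-1) ^ (\<epsilon> * l) = (1::'k)"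
      unfolding power_mult root_cube using kl(1)
    by (auto simp: power_add minus_one_power_iff)
    then have s': "s w' = s v" using form_twist[OF s(1) w, of "k + 3 * \<epsilon> * l" l] s(2) by (simp add: w'_def)
    have vanish': "x w' = 0" if "x \<in> F i e" "x w = 0" for x i e
      using form_twist[OF that(1) w] that(2) by (simp add: w'_def)
    have "v = w'"
    proof (rule forms_separate[OF v w'])
      fix i e x assume ie: "i < 6" "e < (2::nat)" and x: "x \<in> F i e"
      have "i = 0 \<or> i = 1 \<or> i = 2 \<or> i = 3 \<or> i = 4 \<or> i = 5" "e = 0 \<or> e = 1"
        using ie by presburger+
      \<comment> \<open>Each surviving type is completed to weight zero by a product of copies of
        \<open>u\<close> and \<open>s\<close>; the longest, five copies of \<open>u\<close> for the
        type of \<open>u\<close> itself, uses all six degrees.\<close>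
      then consider "i = 1 \<or> i = 5" | "i = 2 \<or> i = 4" "e = 0" | "i = 0" "e = 0" | "i = 0" "e = 1"
        | "i = j" "e = 1" | "i + j = 6" "e = 1" | "i = 3" "even (e + \<epsilon>)" | "i = 3" "odd (e + \<epsilon>)"
        using u(3) by (elim disjE) auto
      then show "x v = x w'"
      proof cases
        case 1
        then show ?thesis using vanishes_onD[OF vanish(1) x] vanishes_onD[OF vanish(2) x] vanish'[OF x] coprime_six[OF ie(1)]
          by simp
      next
        case 2
        then show ?thesis using zv x vanish'[OF x] by auto
      next
        case 3
        then show ?thesis using agreeD[OF ag' mon_form[OF x]] by simp
      next
        case 4
        have "x v * u v ^ 3 = x w' * u w' ^ 3"
          by (rule agreeD[OF ag' mon_mult[OF mon_form[OF x] mon_form_power[OF u(2)]]]) (use 4 u in auto)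
        then show ?thesis using uw' u(4) by simp
      next
        case 5
        have "x v * u v ^ 5 = x w' * u w' ^ 5"
          by (rule agreeD[OF ag' mon_mult[OF mon_form[OF x] mon_form_power[OF u(2)]]]) (use 5 u in auto)
        then show ?thesis using uw' u(4) by simp
      next
        case 6
        have "x v * u v = x w' * u w'"
          by (rule agreeD[OF ag' mon_mult[OF mon_form[OF x] mon_form[OF u(2)]]]) (use 6 u in auto)
        then show ?thesis using uw' u(4) by simp
      next
        case 7
        have "x v * s v = x w' * s w'"
          by (rule agreeD[OF ag' mon_mult[OF mon_form[OF x] mon_form[OF s(1)]]]) (use 7 in auto)
        then show ?thesis using s' s(3) by simp
      next
        case 8
        have "x v * (s v * u v ^ 3) = x w' * (s w' * u w' ^ 3)"
          by (rule agreeD[OF ag' mon_mult[OF mon_form[OF x]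
                mon_mult[OF mon_form[OF s(1)] mon_form_power[OF u(2)]]]]) (use 8 u in auto)
        then show ?thesis using s' s(3) uw' u(4) by simp
      qed
    qed
    then show ?thesis using orb_twist[OF w] by (simp add: w'_def)
  next
    case none: 3
    show ?thesis
    proof (rule orb_eq_weight_three_aux[OF v w s, of 6])
      fix i e x assume i: "i < 6" "e < 2" and x: "x \<in> F i e" and n: "\<not> 6 dvd i" "i \<noteq> (3::nat)"
      have "i = 1 \<or> i = 5 \<or> i = 2 \<or> i = 4" using i n by presburger
      moreover have "x v = 0 \<and> x w = 0" if j: "i = 2 \<or> i = 4"
      proof -
        have "x v ^ 6 = x w ^ 6" by (rule agreeD[OF ag mon_form_power[OF x]]) (use j in auto)
        then show ?thesis using none[OF x i(2) j] by (simp add: power_0_left)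
      qed
      moreover have "x v = 0 \<and> x w = 0" if j: "i = 1 \<or> i = 5"
        using vanishes_onD[OF vanish(1) x] vanishes_onD[OF vanish(2) x] coprime_six[OF i(1)] j by simp
      ultimately show "x v = 0 \<and> x w = 0" by blast
    next
      fix m i e f assume "mon m i e f" "m \<le> 4" "6 dvd i" "even e"
      then show "f v = f w" using agreeD[OF ag] by simp
    qed auto
  qed
qed

text \<open>The value of \<open>s\<close> is known up to sign, and \<open>a\<close> reverses that
  sign.\<close>

lemma orb_eq_weight_three:
  assumes v: "v \<in> V" and w: "w \<in> V" and ag: "agree 6 v w"
    and vanish: "vanishes_on (\<lambda>i e. coprime i 6) v" "vanishes_on (\<lambda>i e. coprime i 6) w"
    and s: "s \<in> F 3 \<epsilon>" "s v \<noteq> 0"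
  shows "Orb v = Orb w"
proof -
  have "s v ^ 2 = s w ^ 2" by (rule agreeD[OF ag mon_form_power[OF s(1)]]) auto
  then have "s w = s v \<or> s w = - s v" by (auto simp: power2_eq_iff)
  then have "s (twist 0 0 w) = s v \<or> s (twist 1 0 w) = s v"
    using form_twist[OF s(1) w] by (auto simp: root_cube)
  then obtain k where k: "s v = s (twist k 0 w)" by metis
  have "Orb v = Orb (twist k 0 w)"
    by (rule orb_eq_weight_three_normalised[OF v twist_closed[OF w] agree_twist[OF ag w]
          vanish(1) vanishes_on_twist[OF vanish(2) w] s(1) k s(2)])
  then show ?thesis using orb_twist[OF w] by simp
qed

section \<open>Only even weights survive\<close>

text \<open>Degree 4 is exactly enough: two copies of \<open>z\<close> complete a weight, and two
  degrees remain for the pairs of forms with odd \<open>c\<close>-weight, whose common sign is then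
  absorbed by \<open>c\<close>.\<close>

lemma orb_eq_even_forms:
  assumes v: "v \<in> V" and w: "w \<in> V" and ag: "agree 4 v w"
    and vanish: "vanishes_on (\<lambda>i e. odd i) v" "vanishes_on (\<lambda>i e. odd i) w"
    and z: "z \<in> F j 0" "j = 2 \<or> j = 4" "z v \<noteq> 0"
  shows "Orb v = Orb w"
proof -
  have "z v ^ 3 = z w ^ 3" by (rule agreeD[OF ag mon_form_power[OF z(1)]]) (use z in auto)
  then obtain k where k: "z (twist k 0 w) = z v"
    using twist_normalise_even[OF z(1,2) w _ z(3)] by blast
  define w' where "w' = twist k 0 w"
  have w': "w' \<in> V" using twist_closed[OF w] by (simp add: w'_def)
  have ag': "agree (2 + 2) v w'" using agree_twist[OF ag w] by (simp add: w'_def)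
  have comp: "f v = f w'" if "mon m i e f" "m \<le> 2" "even i" "even e" for m i e f
    using complement_even[OF ag' z(1,2) _ z(3) that] k by (simp add: w'_def)
  have "Orb v = Orb w'"
  proof (rule orb_eq_sign[OF v w', where Out = "\<lambda>i e. even i \<and> odd e" and k = 0 and l = 1])
    fix i e x assume x: "i < 6" "e < 2" "x \<in> F i e" and o: "\<not> (even i \<and> odd e)"
    show "x v = x w' \<and> x (twist 0 1 w') = x w'"
    proof (cases "even i")
      case True
      then show ?thesis using comp[OF mon_form[OF x(3)]] form_twist[OF x(3) w', of 0 1] o by simp
    next
      case False
      then show ?thesis
        using vanishes_onD[OF vanish(1) x(3)] vanishes_onD[OF vanishes_on_twist[OF vanish(2) w] x(3)]
          form_twist[OF x(3) w', of 0 1]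
        by (simp add: w'_def)
    qed
  next
    fix i e x assume x: "x \<in> F i e" and o: "even i \<and> odd e"
    then show "x (twist 0 1 w') = - x w'" using form_twist[OF x w', of 0 1] by simp
    fix j d y assume y: "y \<in> F j d" "even j \<and> odd d"
    show "x v * y v = x w' * y w'"
      by (rule comp[OF mon_mult[OF mon_form[OF x] mon_form[OF y(1)]]]) (use o y in auto)
  qed
  then show ?thesis using orb_twist[OF w] by (simp add: w'_def)
qed

text \<open>The form \<open>h\<close> makes up for an odd \<open>c\<close>-weight. So
  \<open>h * u ^ 3\<close>, of degree 4, replaces the sixth power of a form \<open>u\<close> of type
  (2, 1) or (4, 1), and determines \<open>u ^ 3\<close> once \<open>h\<close> is normalised by
  \<open>c\<close>; powers of \<open>a\<close> do not disturb \<open>h\<close>.\<close>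

lemma orb_eq_sign_form:
  assumes v: "v \<in> V" and w: "w \<in> V" and ag: "agree 4 v w"
    and vanish: "vanishes_on (\<lambda>i e. odd i \<or> \<not> 6 dvd i \<and> even e) v"
      "vanishes_on (\<lambda>i e. odd i \<or> \<not> 6 dvd i \<and> even e) w"
    and h: "h \<in> F 0 1" "h v \<noteq> 0"
  shows "Orb v = Orb w"
proof -
  have "h v ^ 2 = h w ^ 2" by (rule agreeD[OF ag mon_form_power[OF h(1)]]) auto
  then have "h w = h v \<or> h w = - h v" by (auto simp: power2_eq_iff)
  then have "h (twist 0 0 w) = h v \<or> h (twist 0 1 w) = h v"
    using form_twist[OF h(1) w] by auto
  then obtain l where l: "h (twist 0 l w) = h v" by metis
  define w' where "w' = twist 0 l w"
  have w': "w' \<in> V" using twist_closed[OF w] by (simp add: w'_def)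
  have ag': "agree 4 v w'" using agree_twist[OF ag w] by (simp add: w'_def)
  have hw': "h w' = h v" using l by (simp add: w'_def)
  have cube: "u v ^ 3 = u w' ^ 3" if u: "u \<in> F j 1" "j = 2 \<or> j = 4" for u j
  proof -
    have "h v * u v ^ 3 = h w' * u w' ^ 3"
      by (rule agreeD[OF ag' mon_mult[OF mon_form[OF h(1)] mon_form_power[OF u(1)]]]) (use u in auto)
    then show ?thesis using hw' h(2) by simp
  qed
  have rest: "x v = x w''"
    if w'': "w'' = twist k l' w" "agree 4 v w''" "h w'' = h v"
      and x: "i < 6" "e < 2" "x \<in> F i e" "i \<noteq> 2 \<and> i \<noteq> 4 \<or> e \<noteq> 1" for i e x w'' k l'
  proof -
    consider "odd i \<or> i \<noteq> 0 \<and> e = 0" | "i = 0" "e = 0" | "i = 0" "e = 1" using x by fastforce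
    then show ?thesis
    proof cases
      case 1
      then have "odd i \<or> \<not> 6 dvd i \<and> even e" using x(1) by presburger
      then show ?thesis
        using vanishes_onD[OF vanish(1) x(3)] vanishes_onD[OF vanish(2) x(3)] form_twist[OF x(3) w] w''(1)
        by simp
    next
      case 2
      then show ?thesis using agreeD[OF w''(2) mon_form[OF x(3)]] by simp
    next
      case 3
      have "x v * h v = x w'' * h w''"
        by (rule agreeD[OF w''(2) mon_mult[OF mon_form[OF x(3)] mon_form[OF h(1)]]]) (use 3 in auto)
      then show ?thesis using w''(3) h(2) by simp
    qed
  qed
  show ?thesis
  proof (cases "\<exists>u j. u \<in> F j 1 \<and> (j = 2 \<or> j = 4) \<and> u v \<noteq> 0")
    case True
    then obtain u j where u: "u \<in> F j 1" "j = 2 \<or> j = 4" "u v \<noteq> 0" by blast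
    obtain k where k: "u (twist k 0 w') = u v"
      using twist_normalise_even[OF u(1,2) w' cube[OF u(1,2)] u(3)] by blast
    define w'' where "w'' = twist k 0 w'"
    have w'': "w'' \<in> V" using twist_closed[OF w'] by (simp add: w''_def)
    have ag'': "agree 4 v w''" using agree_twist[OF ag' w'] by (simp add: w''_def)
    have hw'': "h w'' = h v" using form_twist[OF h(1) w', of k 0] hw' by (simp add: w''_def)
    have tw: "w'' = twist k l w" by (simp add: w''_def w'_def twist_def)
    have uw'': "u w'' = u v" using k by (simp add: w''_def)
    have "v = w''"
    proof (rule forms_separate[OF v w''])
      fix i e x assume x: "i < 6" "e < 2" "x \<in> F i e"
      consider "i = j" "e = 1" | "i + j = 6" "e = 1" | "i \<noteq> 2 \<and> i \<noteq> 4 \<or> e \<noteq> 1" using u(2) by fastforce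
      then show "x v = x w''"
      proof cases
        case 1
        \<comment> \<open>Three factors of type (\<open>j\<close>, 1) have \<open>c\<close>-weight
          1, and \<open>h\<close> makes it even within degree 4.\<close>
        have "x v * (u v ^ 2 * h v) = x w'' * (u w'' ^ 2 * h w'')"
          by (rule agreeD[OF ag'' mon_mult[OF mon_form[OF x(3)]
                mon_mult[OF mon_form_power[OF u(1)] mon_form[OF h(1)]]]]) (use 1 u in auto)
        then show ?thesis using uw'' hw'' u(3) h(2) by simp
      next
        case 2
        have "x v * u v = x w'' * u w''"
          by (rule agreeD[OF ag'' mon_mult[OF mon_form[OF x(3)] mon_form[OF u(1)]]]) (use 2 in auto)
        then show ?thesis using uw'' u(3) by simp
      next
        case 3
        then show ?thesis using rest[OF tw ag'' hw'' x] by simp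
      qed
    qed
    then show ?thesis using orb_twist[OF w] tw by simp
  next
    case False
    have "v = w'"
    proof (rule forms_separate[OF v w'])
      fix i e x assume x: "i < 6" "e < 2" "x \<in> F i e"
      show "x v = x w'"
      proof (cases "(i = 2 \<or> i = 4) \<and> e = 1")
        case True
        then have "x v = 0" using False x(3) by blast
        then show ?thesis using cube[of x i] True x(3) by (simp add: power_0_left)
      next
        case F: False
        then show ?thesis using rest[OF w'_def ag' hw' x] by blast
      qed
    qed
    then show ?thesis using orb_twist[OF w] by (simp add: w'_def)
  qed
qed

text \<open>The weights other than zero and those of the two-dimensional representation on which
  \<open>a\<close> has order 3 and \<open>c\<close> acts as \<open>-1\<close>.\<close>

definition off_type :: "nat \<Rightarrow> nat \<Rightarrow> bool" where
  "off_type i e \<longleftrightarrow> odd i \<or> (6 dvd i) \<noteq> even e"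

lemma off_type_b: "vanishes_on off_type u \<Longrightarrow> vanishes_on off_type (b u)"
  by (rule vanishes_on_b, assumption) (unfold off_type_def, presburger)

text \<open>The hypotheses are stated at \<open>w\<close> itself because each product in them is
  invariant under A and so has the same value at the normalised translate. The alternative in the
  last one reflects two ways to complete weight (\<open>j\<close>, 1): five copies of
  \<open>u\<close>, or a single nonzero form of the opposite weight, which needs degree 2
  only.\<close>

lemma orb_eq_single_type_finish:
  assumes v: "v \<in> V" and w: "w \<in> V"
    and vanish: "vanishes_on off_type v" "vanishes_on off_type w"
    and u: "u \<in> F j 1" "j = 2 \<or> j = 4" "u v \<noteq> 0" "u v ^ 6 = u w ^ 6"
    and const: "\<And>x. x \<in> F 0 0 \<Longrightarrow> x v = x w"
    and opp: "\<And>x. x \<in> F (6 - j) 1 \<Longrightarrow> x v * u v = x w * u w"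
    and same: "\<And>x. x \<in> F j 1 \<Longrightarrow> x v * u v ^ 5 = x w * u w ^ 5 \<or>
      (\<exists>y. y \<in> F (6 - j) 1 \<and> y v \<noteq> 0 \<and> x v * y v = x w * y w)"
  shows "Orb v = Orb w"
proof -
  obtain k l where kl: "even k" "u (twist (k + 3 * 0 * l) l w) = u v"
    using twist_normalise_sign[OF u(1,2) w u(4,3)] by blast
  define w' where "w' = twist k l w"
  have w': "w' \<in> V" using twist_closed[OF w] by (simp add: w'_def)
  have uw': "u w' = u v" using kl by (simp add: w'_def)
  have inv: "f w' = f w" if "mon m i e f" "6 dvd i" "2 dvd e" for m i e f
  proof -
    have "agree m w w" by (simp add: agree_def)
    then show ?thesis using agreeD[OF agree_twist that(1)] w that(2,3) by (simp add: w'_def)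
  qed
  have opp': "x v = x w'" if x: "x \<in> F (6 - j) 1" for x
  proof -
    have "x w' * u w' = x w * u w"
      by (rule inv[OF mon_mult[OF mon_form[OF x] mon_form[OF u(1)]]]) (use u in auto)
    then have "x v * u v = x w' * u v" using opp[OF x] uw' by simp
    then show ?thesis using u(3) by simp
  qed
  have same': "x v = x w'" if x: "x \<in> F j 1" for x
    using same[OF x]
  proof
    assume *: "x v * u v ^ 5 = x w * u w ^ 5"
    have "x w' * u w' ^ 5 = x w * u w ^ 5"
      by (rule inv[OF mon_mult[OF mon_form[OF x] mon_form_power[OF u(1)]]]) (use u in auto)
    then have "x v * u v ^ 5 = x w' * u v ^ 5" using * uw' by simp
    then show ?thesis using u(3) by simp
  next
    assume "\<exists>y. y \<in> F (6 - j) 1 \<and> y v \<noteq> 0 \<and> x v * y v = x w * y w"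
    then obtain y where y: "y \<in> F (6 - j) 1" "y v \<noteq> 0" "x v * y v = x w * y w" by blast
    have "x w' * y w' = x w * y w"
      by (rule inv[OF mon_mult[OF mon_form[OF x] mon_form[OF y(1)]]]) (use u in auto)
    then have "x v * y v = x w' * y v" using y opp'[OF y(1)] by simp
    then show ?thesis using y(2) by simp
  qed
  have "v = w'"
  proof (rule forms_separate[OF v w'])
    fix i e x assume x: "i < 6" "e < (2::nat)" "x \<in> F i e"
    have "i = 0 \<or> i = 2 \<or> i = 4 \<or> odd i" "e = 0 \<or> e = 1" using x by presburger+
    then consider "odd i \<or> (i = 0) \<noteq> (e = 0)" | "i = 0" "e = 0" | "i = j" "e = 1" | "i = 6 - j" "e = 1"
      using u(2) by (elim disjE) auto
    then show "x v = x w'"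
    proof cases
      case 1
      then have "off_type i e" using x unfolding off_type_def by presburger
      then show ?thesis
        using vanishes_onD[OF vanish(1) x(3)] vanishes_onD[OF vanishes_on_twist[OF vanish(2) w] x(3)]
        by (simp add: w'_def)
    next
      case 2
      then show ?thesis using const[of x] inv[OF mon_form[OF x(3)]] x(3) by simp
    next
      case 3
      then show ?thesis using same' x by simp
    next
      case 4
      then show ?thesis using opp' x by simp
    qed
  qed
  then show ?thesis using orb_twist[OF w] by (simp add: w'_def)
qed

lemma orb_eq_single_type_six:
  assumes v: "v \<in> V" and w: "w \<in> V"
    and vanish: "vanishes_on off_type v" "vanishes_on off_type w"
    and u: "u \<in> F j 1" "j = 2 \<or> j = 4" "u v \<noteq> 0" and ag: "agree 6 v w"
  shows "Orb v = Orb w"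
proof (rule orb_eq_single_type_finish[OF v w vanish u])
  show "u v ^ 6 = u w ^ 6" by (rule agreeD[OF ag mon_form_power[OF u(1)]]) (use u in auto)
  show "x v = x w" if "x \<in> F 0 0" for x by (rule agreeD[OF ag mon_form[OF that]]) auto
  show "x v * u v = x w * u w" if "x \<in> F (6 - j) 1" for x
    by (rule agreeD[OF ag mon_mult[OF mon_form[OF that] mon_form[OF u(1)]]]) (use u in auto)
  show "x v * u v ^ 5 = x w * u w ^ 5 \<or> (\<exists>y. y \<in> F (6 - j) 1 \<and> y v \<noteq> 0 \<and> x v * y v = x w * y w)"
    if "x \<in> F j 1" for x
    by (rule disjI1, rule agreeD[OF ag mon_mult[OF mon_form[OF that] mon_form_power[OF u(1)]]])
      (use u in auto)
qed

text \<open>On the types (2, 1) and (4, 1) a product of weight zero has either opposite pairs only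
  or at least six factors, so agreement up to degree 4 says nothing about \<open>u ^ 6\<close>.
  However, \<open>u * y\<close> is fixed by \<open>b\<close>, so its value is known, and with the
  symmetric sum of \<open>u ^ 6\<close> it determines the values of \<open>u ^ 6\<close> at
  \<open>v\<close> and \<open>b v\<close> up to order. If \<open>u (b v) = 0\<close>, products with
  a factor \<open>u\<close> use all eight degrees. Otherwise a product of degree 2 distinguishes and
  leaves degree 6, or degree 2 alone completes the weights by means of \<open>y\<close>.\<close>

lemma orb_eq_single_type:
  assumes v: "v \<in> V" and w: "w \<in> V" and sa: "sum_agree v w"
    and van: "vanishes_on off_type v" "vanishes_on off_type w"
    and u: "u \<in> F j 1" "j = 2 \<or> j = 4" "u v \<noteq> 0"
  shows "Orb v = Orb w"
proof -
  note vanb = off_type_b[OF van(2)]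
  define y where "y = (\<lambda>u'. u (b u'))"
  have y: "y \<in> F (6 - j) 1" unfolding y_def by (rule form_b'[OF u(1)]) (use u in auto)
  have yb: "y (b t) = u t" if "t \<in> V" for t using form_b_b[OF u(1) that] u(2) by (auto simp: y_def)
  have uy: "mon 2 6 2 (\<lambda>t. u t * y t)"
    using mon_mult[OF mon_form[OF u(1)] mon_form[OF y]] u(2) by (auto simp: numeral_2_eq_2)
  have "u v * y v + u (b v) * y (b v) = u w * y w + u (b w) * y (b w)"
    by (rule sum_agreeD[OF sa uy]) auto
  then have "2 * (u v * u (b v)) = 2 * (u w * u (b w))"
    unfolding yb[OF v] yb[OF w] by (simp add: y_def mult.commute)
  then have prod: "u v * u (b v) = u w * u (b w)" by simp
  have "u v ^ 6 + u (b v) ^ 6 = u w ^ 6 + u (b w) ^ 6"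
    by (rule sum_agreeD[OF sa mon_form_power[OF u(1)]]) (use u in auto)
  moreover have "u v ^ 6 * u (b v) ^ 6 = u w ^ 6 * u (b w) ^ 6"
    using prod by (simp flip: power_mult_distrib)
  ultimately have sixth: "u v ^ 6 = u w ^ 6 \<or> u v ^ 6 = u (b w) ^ 6" using two_values by blast
  have six: ?thesis if "agree 6 v w \<or> agree 6 v (b w)"
    using that orb_eq_single_type_six[OF v w van u]
      orb_eq_single_type_six[OF v b_closed[OF w] van(1) vanb u] orb_b[OF w] by auto
  have two: "Orb v = Orb w'"
    if w': "w' \<in> V" "u v ^ 6 = u w' ^ 6" "\<And>f. inv_mon 2 f \<Longrightarrow> f v = f w'" "u (b v) \<noteq> 0"
      and vw': "vanishes_on off_type w'"
    for w'
  proof -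
    have ag: "agree 2 v w'" using w'(3) by (simp add: agree_def)
    show ?thesis
    proof (rule orb_eq_single_type_finish[OF v w'(1) van(1) vw' u w'(2)])
      show "x v = x w'" if "x \<in> F 0 0" for x by (rule agreeD[OF ag mon_form[OF that]]) auto
      show "x v * u v = x w' * u w'" if "x \<in> F (6 - j) 1" for x
        by (rule agreeD[OF ag mon_mult[OF mon_form[OF that] mon_form[OF u(1)]]]) (use u in auto)
      show "x v * u v ^ 5 = x w' * u w' ^ 5 \<or> (\<exists>y. y \<in> F (6 - j) 1 \<and> y v \<noteq> 0 \<and> x v * y v = x w' * y w')"
        if "x \<in> F j 1" for x
      proof (rule disjI2, rule exI[of _ y], intro conjI)
        show "y v \<noteq> 0" using w'(4) by (simp add: y_def)
        show "x v * y v = x w' * y w'"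
          by (rule agreeD[OF ag mon_mult[OF mon_form[OF that] mon_form[OF y]]]) (use u in auto)
      qed (rule y)
    qed
  qed
  \<comment> \<open>As \<open>u\<close> vanishes at \<open>b v\<close> and \<open>b w'\<close>, any
    product with at least one factor \<open>u\<close> has only its first summand left.\<close>
  have zero: "Orb v = Orb w'"
    if w': "w' \<in> V" "u v ^ 6 = u w' ^ 6" "sum_agree v w'" "u (b v) = 0" "u (b w') = 0"
      and vw': "vanishes_on off_type w'"
    for w'
  proof -
    have eq: "f v * u v ^ k = f w' * u w' ^ k"
      if f: "mon m i e f" "m + k \<le> 8" "6 dvd i + k * j" "even (e + k)" "0 < k" for m i e f k
    proof -
      have "f v * u v ^ k + f (b v) * u (b v) ^ k = f w' * u w' ^ k + f (b w') * u (b w') ^ k"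
        by (rule sum_agreeD[OF w'(3) mon_mult[OF f(1) mon_form_power[OF u(1)]]]) (use f in auto)
      then show ?thesis using w'(4,5) f(5) by (simp add: power_0_left)
    qed
    have uw': "u w' \<noteq> 0" using w'(2) u(3) by (metis power_eq_0_iff zero_less_numeral)
    show ?thesis
    proof (rule orb_eq_single_type_finish[OF v w'(1) van(1) vw' u w'(2)])
      show "x v = x w'" if "x \<in> F 0 0" for x using eq[OF mon_form[OF that], of 6] w'(2) uw' by simp
      show "x v * u v = x w' * u w'" if "x \<in> F (6 - j) 1" for x
        using eq[OF mon_form[OF that], of 1] u(2) by auto
      show "x v * u v ^ 5 = x w' * u w' ^ 5 \<or> (\<exists>y. y \<in> F (6 - j) 1 \<and> y v \<noteq> 0 \<and> x v * y v = x w' * y w')"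
        if "x \<in> F j 1" for x
        using eq[OF mon_form[OF that], of 5] u(2) by auto
    qed
  qed
  show ?thesis
  proof (cases "u (b v) = 0")
    case True
    show ?thesis
    proof (cases "u v ^ 6 = u w ^ 6")
      case eq: True
      then have "u w \<noteq> 0" using u(3) by (metis power_eq_0_iff zero_less_numeral)
      then have "u (b w) = 0" using prod True by simp
      then show ?thesis using zero[OF w eq sa True _ van(2)] by simp
    next
      case False
      then have eq: "u v ^ 6 = u (b w) ^ 6" using sixth by blast
      then have "u (b w) \<noteq> 0" using u(3) by (metis power_eq_0_iff zero_less_numeral)
      then have "u w = 0" using prod True by simp
      then have "u (b (b w)) = 0" using form_b_b[OF u(1) w] by simp
      then show ?thesis
        using zero[OF b_closed[OF w] eq sum_agree_b[OF sa w] True _ vanb] orb_b[OF w] by simp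
    qed
  next
    case False
    consider M where "inv_mon 2 M" "M v \<noteq> M (b v)" | M where "inv_mon 2 M" "M w \<noteq> M (b w)"
      | "\<And>M. inv_mon 2 M \<Longrightarrow> M v = M (b v) \<and> M w = M (b w)" by blast
    then show ?thesis
    proof cases
      case 1
      then show ?thesis using agree_of_distinguishing[OF sa w 1] six by simp
    next
      case 2
      have "agree 6 w v \<or> agree 6 w (b v)"
        using agree_of_distinguishing[OF sum_agree_sym[OF sa] v 2] by simp
      then have "agree 6 v w \<or> agree 6 v (b w)" using agree_swap v by blast
      then show ?thesis by (rule six)
    next
      case 3
      \<comment> \<open>Products of degree 2 now coincide at \<open>v\<close>, \<open>b v\<close>,
        \<open>w\<close> and \<open>b w\<close>, so the choice between \<open>w\<close> and
        \<open>b w\<close> is free and can be made by the sixth power of \<open>u\<close>.\<close>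
      have "f v = f w \<and> f v = f (b w)" if f: "inv_mon 2 f" for f
      proof -
        have "f v + f (b v) = f w + f (b w)"
          using sa inv_mon_mono[OF f, of 8] by (simp add: sum_agree_def)
        then have "2 * f v = 2 * f w" using 3[OF f] by (metis mult_2)
        then show ?thesis using 3[OF f] by simp
      qed
      then show ?thesis
        using sixth two[OF w _ _ False van(2)] two[OF b_closed[OF w] _ _ False vanb] orb_b[OF w] by auto
    qed
  qed
qed

section \<open>Assembly of the cases\<close>

lemma orb_eq_if_sum_agree:
  assumes v: "v \<in> V" and w: "w \<in> V" and sa: "sum_agree v w"
  shows "Orb v = Orb w"
proof -
  have one: "Orb t = Orb r"
    if "t \<in> V" "r \<in> V" "sum_agree t r" "i = 1 \<or> i = 5" "x \<in> F i e" "x t \<noteq> 0" for t r i e x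
  proof (cases "i = 1")
    case True
    then show ?thesis using orb_eq_weight_one that by blast
  next
    case False
    then have x: "x \<in> F 5 e" using that by simp
    \<comment> \<open>Since 25 is 1 modulo 6, weight 5 at \<open>t\<close> becomes weight 1 at
      \<open>b t\<close>.\<close>
    have "(\<lambda>u. x (b u)) \<in> F 1 e" by (rule form_b'[OF x]) simp
    moreover have "x (b (b t)) \<noteq> 0" using form_b_b[OF x] that by simp
    moreover have "sum_agree (b t) r"
      using sum_agree_sym[OF sum_agree_b[OF sum_agree_sym[OF that(3)] that(1)]] .
    ultimately have "Orb (b t) = Orb r"
      using orb_eq_weight_one[of "b t" r "\<lambda>u. x (b u)" e] b_closed that by blast
    then show ?thesis using orb_b that by simp
  qed
  have three: "Orb t = Orb r"
    if t: "t \<in> V" and r: "r \<in> V" and tr: "sum_agree t r"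
      and van: "vanishes_on (\<lambda>i e. coprime i 6) t" "vanishes_on (\<lambda>i e. coprime i 6) r"
      and s: "s \<in> F 3 e" "s t \<noteq> 0" for t r s e
  proof -
    have sb: "(\<lambda>u. s (b u)) \<in> F 3 e" by (rule form_b'[OF s(1)]) simp
    \<comment> \<open>For weight 3, as for weight 1, the product with the image under
      \<open>b\<close> changes sign. If it vanishes at \<open>t\<close>, then \<open>s ^ 2\<close>
      distinguishes instead, being nonzero at \<open>t\<close> only.\<close>
    have "\<exists>M. inv_mon 2 M \<and> M t \<noteq> M (b t)"
    proof (cases "s (b t) = 0")
      case True
      have "inv_mon 2 (\<lambda>u. s u ^ 2)" by (rule inv_monI[OF mon_form_power[OF s(1)]]) auto
      moreover have "s t ^ 2 \<noteq> s (b t) ^ 2" using s True by simp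
      ultimately show ?thesis by blast
    next
      case False
      have "inv_mon 2 (\<lambda>u. s u * s (b u))"
        by (rule inv_monI[OF mon_mult[OF mon_form[OF s(1)] mon_form[OF sb]]]) auto
      moreover have "s t * s (b t) \<noteq> s (b t) * s (b (b t))"
        using s False form_b_b[OF s(1) t] by simp
      ultimately show ?thesis by blast
    qed
    then obtain M where "inv_mon 2 M" "M t \<noteq> M (b t)" by blast
    then have "agree 6 t r \<or> agree 6 t (b r)" using agree_of_distinguishing[OF tr r, of 2 M] by simp
    then show ?thesis
    proof
      assume "agree 6 t r"
      then show ?thesis using orb_eq_weight_three[OF t r _ van s] by simp
    next
      assume *: "agree 6 t (b r)"
      have "vanishes_on (\<lambda>i e. coprime i 6) (b r)"
      proof (rule vanishes_on_b[OF van(2)])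
        have "coprime (5::nat) 6" by (simp add: coprime_six)
        then show "coprime (5 * i) 6" if "coprime i 6" for i :: nat using that by simp
      qed
      then have "Orb t = Orb (b r)" using orb_eq_weight_three[OF t b_closed[OF r] * van(1) _ s] by simp
      then show ?thesis using orb_b[OF r] by simp
    qed
  qed
  \<comment> \<open>Both relations are carried along: agreement up to degree 4 settles the first two
    types of even form, and the symmetric sums up to degree 8 are needed for the last.\<close>
  have even: "Orb v = Orb r"
    if r: "r \<in> V" and ag: "agree 4 v r" and vr: "sum_agree v r"
      and odd: "vanishes_on (\<lambda>i e. odd i) v" "vanishes_on (\<lambda>i e. odd i) r" for r
  proof (cases "\<exists>j z. z \<in> F j 0 \<and> (j = 2 \<or> j = 4) \<and> z v \<noteq> 0")
    case True
    then show ?thesis using orb_eq_even_forms[OF v r ag odd] by blast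
  next
    case no_even: False
    have z: "z v = 0 \<and> z r = 0" if z: "z \<in> F i e" "even i" "\<not> 6 dvd i" "even e" for i e z
    proof -
      define j where "j = i mod 6"
      have j: "j = 2 \<or> j = 4" using z(2,3) unfolding j_def by presburger
      have z': "z \<in> F j 0" using z form_mod[of i e] by (simp add: j_def)
      have "z v ^ 3 = z r ^ 3" by (rule agreeD[OF ag mon_form_power[OF z']]) (use j in auto)
      moreover have "z v = 0" using no_even z' j by blast
      ultimately show ?thesis by simp
    qed
    have van: "vanishes_on (\<lambda>i e. odd i \<or> \<not> 6 dvd i \<and> even e) v"
      "vanishes_on (\<lambda>i e. odd i \<or> \<not> 6 dvd i \<and> even e) r"
      using vanishes_onD[OF odd(1)] vanishes_onD[OF odd(2)] z unfolding vanishes_on_def by blast+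
    show ?thesis
    proof (cases "\<exists>h. h \<in> F 0 1 \<and> h v \<noteq> 0")
      case True
      then show ?thesis using orb_eq_sign_form[OF v r ag van] by blast
    next
      case no_sign: False
      have h: "h v = 0 \<and> h r = 0" if h: "h \<in> F i e" "6 dvd i" "odd e" for h i e
      proof -
        have h': "h \<in> F 0 1" using h form_mod[of i e] by (simp add: odd_iff_mod_2_eq_one)
        have "h v ^ 2 = h r ^ 2" by (rule agreeD[OF ag mon_form_power[OF h']]) auto
        moreover have "h v = 0" using no_sign h' by blast
        ultimately show ?thesis by simp
      qed
      have off: "vanishes_on off_type v" "vanishes_on off_type r"
        using vanishes_onD[OF van(1)] vanishes_onD[OF van(2)] h
        unfolding vanishes_on_def off_type_def by blast+
      show ?thesis
      proof (cases "\<exists>u j. u \<in> F j 1 \<and> (j = 2 \<or> j = 4) \<and> (u v \<noteq> 0 \<or> u r \<noteq> 0)")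
        case True
        then obtain u j where u: "u \<in> F j 1" "j = 2 \<or> j = 4" "u v \<noteq> 0 \<or> u r \<noteq> 0" by blast
        then show ?thesis
          using orb_eq_single_type[OF v r vr off u(1,2)]
            orb_eq_single_type[OF r v sum_agree_sym[OF vr] off(2,1) u(1,2)] by auto
      next
        case none: False
        have "v = r"
        proof (rule forms_separate[OF v r])
          fix i e x assume x: "i < 6" "e < (2::nat)" "x \<in> F i e"
          have "off_type i e \<or> i = 0 \<and> e = 0 \<or> (i = 2 \<or> i = 4) \<and> e = 1"
            using x(1,2) unfolding off_type_def by presburger
          then consider "off_type i e" | "i = 0" "e = 0" | "i = 2 \<or> i = 4" "e = 1" by blast
          then show "x v = x r"
          proof cases
            case 1
            then show ?thesis using vanishes_onD[OF off(1) x(3)] vanishes_onD[OF off(2) x(3)] by simp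
          next
            case 2
            then show ?thesis using agreeD[OF ag mon_form[OF x(3)]] by simp
          next
            case 3
            then have "x v = 0" "x r = 0" using none x(3) by blast+
            then show ?thesis by simp
          qed
        qed
        then show ?thesis by simp
      qed
    qed
  qed
  show ?thesis
  proof (cases "\<exists>i e x. (i = 1 \<or> i = 5) \<and> x \<in> F i e \<and> (x v \<noteq> 0 \<or> x w \<noteq> 0)")
    case True
    then obtain i e x where x: "i = 1 \<or> i = 5" "x \<in> F i e" "x v \<noteq> 0 \<or> x w \<noteq> 0" by blast
    then show ?thesis
      using one[OF v w sa x(1,2)] one[OF w v sum_agree_sym[OF sa] x(1,2)] by auto
  next
    case no_unit: False
    have "x v = 0 \<and> x w = 0" if "coprime i 6" "x \<in> F i e" for i e x
    proof -
      have "coprime (i mod 6) 6" using that(1) by simp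
      then have "i mod 6 = 1 \<or> i mod 6 = 5" using coprime_six[of "i mod 6"] by simp
      moreover have "x \<in> F (i mod 6) e" using form_mod[of i e] form_mod[of "i mod 6" e] that(2) by simp
      ultimately show ?thesis using no_unit by blast
    qed
    then have unit: "vanishes_on (\<lambda>i e. coprime i 6) v" "vanishes_on (\<lambda>i e. coprime i 6) w"
      unfolding vanishes_on_def by blast+
    show ?thesis
    proof (cases "\<exists>e x. x \<in> F 3 e \<and> (x v \<noteq> 0 \<or> x w \<noteq> 0)")
      case True
      then obtain e x where x: "x \<in> F 3 e" "x v \<noteq> 0 \<or> x w \<noteq> 0" by blast
      then show ?thesis
        using three[OF v w sa unit x(1)] three[OF w v sum_agree_sym[OF sa] unit(2,1) x(1)] by auto
    next
      case no_three: False
      have "x v = 0 \<and> x w = 0" if "odd i" "x \<in> F i e" for i e x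
      proof -
        have x: "x \<in> F (i mod 6) e" using form_mod[of i e] form_mod[of "i mod 6" e] that(2) by simp
        have "i mod 6 = 1 \<or> i mod 6 = 5 \<or> i mod 6 = 3" using that by presburger
        then show ?thesis
        proof (elim disjE)
          assume "i mod 6 = 3"
          then show ?thesis using no_three x by simp
        qed (use no_unit x in blast)+
      qed
      then have odd: "vanishes_on (\<lambda>i e. odd i) v" "vanishes_on (\<lambda>i e. odd i) w"
        unfolding vanishes_on_def by blast+
      have oddb: "vanishes_on (\<lambda>i e. odd i) (b w)" by (rule vanishes_on_b[OF odd(2)]) simp
      show ?thesis
        using agree_four[OF sa v w] even[OF w _ sa odd]
          even[OF b_closed[OF w] _ sum_agree_b[OF sa w] odd(1) oddb] orb_b[OF w] by auto
    qed
  qed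
qed

end

section \<open>Substitution and degree\<close>

text \<open>The group acts by substitution with coefficient map \<open>mpoly_const\<close>; the
  predicate allows the homomorphism laws of substitution to be stated for that map.\<close>

definition coeff_hom :: "('k::comm_ring_1 \<Rightarrow> 'r::comm_ring_1) \<Rightarrow> bool" where
  "coeff_hom c \<longleftrightarrow> c 0 = 0 \<and> c 1 = 1 \<and> (\<forall>a b. c (a + b) = c a + c b) \<and> (\<forall>a b. c (a * b) = c a * c b)"

lemma coeff_hom_mpoly_const: "coeff_hom mpoly_const"
  by (auto simp: coeff_hom_def mpoly_const_def single_add mult_single)

lemma mpoly_subst_zero: "mpoly_subst c x 0 = 0"
  by (simp add: mpoly_subst_def)

lemma mpoly_subst_add:
  assumes "coeff_hom c"
  shows "mpoly_subst c x (p + q) = mpoly_subst c x p + mpoly_subst c x q"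
proof -
  let ?S = "Poly_Mapping.keys p \<union> Poly_Mapping.keys q"
  have c: "c 0 = 0" using assms by (simp add: coeff_hom_def)
  have "Poly_Mapping.keys (p + q) \<subseteq> ?S" by (rule keys_add)
  then show ?thesis
    using assms
    by (subst (1 2 3) mpoly_subst_superset[where S = ?S and c = c, OF _ _ c])
       (auto simp: coeff_hom_def lookup_add distrib_right sum.distrib)
qed

lemma mpoly_subst_sum:
  "coeff_hom c \<Longrightarrow> mpoly_subst c x (\<Sum>i\<in>A. p i) = (\<Sum>i\<in>A. mpoly_subst c x (p i))"
  by (induction A rule: infinite_finite_induct) (simp_all add: mpoly_subst_add mpoly_subst_zero)

lemma mpoly_subst_single:
  assumes "coeff_hom c"
  shows "mpoly_subst c x (Poly_Mapping.single m a) =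
     c a * (\<Prod>i\<in>Poly_Mapping.keys m. x i ^ Poly_Mapping.lookup m i)"
proof -
  have c: "c 0 = 0" using assms by (simp add: coeff_hom_def)
  show ?thesis by (subst mpoly_subst_superset[where S = "{m}" and c = c, OF _ _ c]) auto
qed

lemma monom_subst_add:
  fixes x :: "nat \<Rightarrow> 'r::comm_ring_1"
  shows "(\<Prod>i\<in>Poly_Mapping.keys (l + m). x i ^ Poly_Mapping.lookup (l + m) i) =
   (\<Prod>i\<in>Poly_Mapping.keys l. x i ^ Poly_Mapping.lookup l i) *
   (\<Prod>i\<in>Poly_Mapping.keys m. x i ^ Poly_Mapping.lookup m i)"
proof -
  let ?S = "Poly_Mapping.keys l \<union> Poly_Mapping.keys m"
  have *: "(\<Prod>i\<in>Poly_Mapping.keys k. x i ^ Poly_Mapping.lookup k i) =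
      (\<Prod>i\<in>?S. x i ^ Poly_Mapping.lookup k i)" if "Poly_Mapping.keys k \<subseteq> ?S" for k
    by (rule prod.mono_neutral_left) (use that in \<open>auto simp: in_keys_iff\<close>)
  have "Poly_Mapping.keys (l + m) \<subseteq> ?S" by (rule keys_add)
  then show ?thesis
    by (simp only: *[OF Un_upper1] *[OF Un_upper2] *[of "l + m"])
       (simp only: lookup_add power_add prod.distrib)
qed

lemma mpoly_subst_mult:
  assumes c: "coeff_hom c"
  shows "mpoly_subst c x (p * q) = mpoly_subst c x p * mpoly_subst c x q"
proof -
  have single: "mpoly_subst c x (Poly_Mapping.single l a * Poly_Mapping.single m b) =
      mpoly_subst c x (Poly_Mapping.single l a) * mpoly_subst c x (Poly_Mapping.single m b)" for l m a b
    using c by (simp add: mult_single mpoly_subst_single[OF c] monom_subst_add coeff_hom_def)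
  have "mpoly_subst c x
      ((\<Sum>l\<in>Poly_Mapping.keys p. Poly_Mapping.single l (Poly_Mapping.lookup p l)) *
       (\<Sum>m\<in>Poly_Mapping.keys q. Poly_Mapping.single m (Poly_Mapping.lookup q m))) =
    mpoly_subst c x (\<Sum>l\<in>Poly_Mapping.keys p. Poly_Mapping.single l (Poly_Mapping.lookup p l)) *
    mpoly_subst c x (\<Sum>m\<in>Poly_Mapping.keys q. Poly_Mapping.single m (Poly_Mapping.lookup q m))"
    by (simp add: sum_product mpoly_subst_sum[OF c] single)
  then show ?thesis by (simp add: mpoly_sum_single)
qed

lemma mpoly_subst_const: "coeff_hom c \<Longrightarrow> mpoly_subst c x (mpoly_const a) = c a"
  by (simp add: mpoly_const_def mpoly_subst_single)

lemma mpoly_subst_var: "coeff_hom c \<Longrightarrow> mpoly_subst c x (mpoly_var i) = x i"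
  by (simp add: mpoly_var_def mpoly_subst_single) (simp add: coeff_hom_def)

lemma mpoly_subst_one: "coeff_hom c \<Longrightarrow> mpoly_subst c x 1 = 1"
  using mpoly_subst_const[of c x 1] by (simp add: mpoly_const_def coeff_hom_def)

lemma mpoly_subst_power: "coeff_hom c \<Longrightarrow> mpoly_subst c x (p ^ k) = mpoly_subst c x p ^ k"
  by (induction k) (simp_all add: mpoly_subst_mult mpoly_subst_one)

lemma mpoly_subst_prod:
  "coeff_hom c \<Longrightarrow> mpoly_subst c x (\<Prod>i\<in>A. p i) = (\<Prod>i\<in>A. mpoly_subst c x (p i))"
  by (induction A rule: infinite_finite_induct) (simp_all add: mpoly_subst_mult mpoly_subst_one)

text \<open>Beyond index \<open>n\<close> the substituted forms of the action would read entries
  outside the matrix; membership in \<open>coord_ring n\<close> keeps such variables out.\<close>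

lemma mpoly_subst_cong:
  assumes "p \<in> coord_ring n" "\<And>i. i < n \<Longrightarrow> x i = y i"
  shows "mpoly_subst c x p = mpoly_subst c y p"
  unfolding mpoly_subst_def
proof (intro sum.cong arg_cong2[where f = "(*)"] prod.cong HOL.refl)
  fix m i assume "m \<in> Poly_Mapping.keys p" "i \<in> Poly_Mapping.keys m"
  then have "i < n" using assms(1) by (auto simp: coord_ring_def)
  then show "x i ^ Poly_Mapping.lookup m i = y i ^ Poly_Mapping.lookup m i" by (simp add: assms(2))
qed

lemma mpoly_subst_subst:
  assumes "coeff_hom c"
  shows "mpoly_subst c y (mpoly_subst mpoly_const x p) = mpoly_subst c (\<lambda>i. mpoly_subst c y (x i)) p"
  unfolding mpoly_subst_def[of mpoly_const x p]
  by (simp add: assms mpoly_subst_sum mpoly_subst_mult mpoly_subst_const mpoly_subst_prod mpoly_subst_power)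
    (simp add: mpoly_subst_def)

lemma mpoly_subst_const_var:
  fixes p :: "'k::comm_ring_1 mpoly"
  shows "mpoly_subst mpoly_const mpoly_var p = p"
proof -
  have "mpoly_subst mpoly_const mpoly_var (Poly_Mapping.single m a) = Poly_Mapping.single m a" for m and a :: 'k
  proof -
    have pow: "(mpoly_var i :: 'k mpoly) ^ k = Poly_Mapping.single (Poly_Mapping.single i k) 1" for i k
      by (induction k) (simp_all add: mpoly_var_def mult_single flip: single_add)
    have prod: "(\<Prod>i\<in>A. Poly_Mapping.single (f i) (1::'k)) = Poly_Mapping.single (\<Sum>i\<in>A. f i) 1"
      for A :: "nat set" and f :: "nat \<Rightarrow> nat \<Rightarrow>\<^sub>0 nat"
      by (induction A rule: infinite_finite_induct) (simp_all add: mult_single)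
    have "(\<Sum>i\<in>Poly_Mapping.keys m. Poly_Mapping.single i (Poly_Mapping.lookup m i)) = m"
      by (rule poly_mapping_eqI)
        (auto simp: lookup_sum lookup_single when_def in_keys_iff if_distrib cong: if_cong)
    then show ?thesis
      by (simp add: mpoly_subst_single[OF coeff_hom_mpoly_const] pow prod)
        (simp add: mpoly_const_def mult_single)
  qed
  then have "mpoly_subst mpoly_const mpoly_var
      (\<Sum>m\<in>Poly_Mapping.keys p. Poly_Mapping.single m (Poly_Mapping.lookup p m)) =
      (\<Sum>m\<in>Poly_Mapping.keys p. Poly_Mapping.single m (Poly_Mapping.lookup p m))"
    by (simp add: mpoly_subst_sum[OF coeff_hom_mpoly_const])
  then show ?thesis by (simp add: mpoly_sum_single)
qed

section \<open>Polynomials of bounded degree\<close>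

definition monom_degree :: "(nat \<Rightarrow>\<^sub>0 nat) \<Rightarrow> nat" where
  "monom_degree m = (\<Sum>i\<in>Poly_Mapping.keys m. Poly_Mapping.lookup m i)"

lemma monom_degree_add: "monom_degree (l + m) = monom_degree l + monom_degree m"
proof -
  let ?S = "Poly_Mapping.keys l \<union> Poly_Mapping.keys m"
  have *: "monom_degree k = (\<Sum>i\<in>?S. Poly_Mapping.lookup k i)" if "Poly_Mapping.keys k \<subseteq> ?S" for k
    unfolding monom_degree_def
    by (rule sum.mono_neutral_left) (use that in \<open>auto simp: in_keys_iff\<close>)
  have "Poly_Mapping.keys (l + m) \<subseteq> ?S" by (rule keys_add)
  then show ?thesis
    by (simp only: *[OF Un_upper1] *[OF Un_upper2] *[of "l + m"]) (simp only: lookup_add sum.distrib)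
qed

text \<open>Bounding each monomial separately gives closure under sums and products without handling
  the maximum in \<open>mpoly_degree\<close>.\<close>

definition coord_ring_upto :: "nat \<Rightarrow> nat \<Rightarrow> 'k::comm_ring_1 mpoly set" where
  "coord_ring_upto n d = {p. \<forall>m\<in>Poly_Mapping.keys p. Poly_Mapping.keys m \<subseteq> {..<n} \<and> monom_degree m \<le> d}"

lemma coord_ring_upto_iff: "p \<in> coord_ring_upto n d \<longleftrightarrow> p \<in> coord_ring n \<and> mpoly_degree p \<le> d"
  by (auto simp: coord_ring_upto_def coord_ring_def mpoly_degree_def monom_degree_def)

lemma coord_ring_upto_zero: "0 \<in> coord_ring_upto n d"
  by (simp add: coord_ring_upto_def)

lemma coord_ring_upto_add:
  "p \<in> coord_ring_upto n d \<Longrightarrow> q \<in> coord_ring_upto n d \<Longrightarrow> p + q \<in> coord_ring_upto n d"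
  using keys_add[of p q] by (fastforce simp: coord_ring_upto_def)

lemma coord_ring_upto_sum:
  "(\<And>i. i \<in> A \<Longrightarrow> p i \<in> coord_ring_upto n d) \<Longrightarrow> (\<Sum>i\<in>A. p i) \<in> coord_ring_upto n d"
  by (induction A rule: infinite_finite_induct) (auto simp: coord_ring_upto_zero coord_ring_upto_add)

lemma coord_ring_upto_mult:
  assumes "p \<in> coord_ring_upto n d" "q \<in> coord_ring_upto n e"
  shows "p * q \<in> coord_ring_upto n (d + e)"
  unfolding coord_ring_upto_def
proof (intro CollectI ballI)
  fix m assume "m \<in> Poly_Mapping.keys (p * q)"
  then obtain k l where m: "m = k + l" "k \<in> Poly_Mapping.keys p" "l \<in> Poly_Mapping.keys q"
    using keys_mult[of p q] by blast
  then have "Poly_Mapping.keys m \<subseteq> Poly_Mapping.keys k \<union> Poly_Mapping.keys l"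
    by (simp add: keys_add)
  moreover have "Poly_Mapping.keys k \<subseteq> {..<n}" "Poly_Mapping.keys l \<subseteq> {..<n}"
    "monom_degree k \<le> d" "monom_degree l \<le> e"
    using m assms by (auto simp: coord_ring_upto_def)
  ultimately show "Poly_Mapping.keys m \<subseteq> {..<n} \<and> monom_degree m \<le> d + e"
    using m(1) monom_degree_add[of k l] by auto
qed

lemma coord_ring_upto_const: "mpoly_const a \<in> coord_ring_upto n d"
  by (simp add: coord_ring_upto_def mpoly_const_def monom_degree_def)

lemma coord_ring_upto_var: "i < n \<Longrightarrow> mpoly_var i \<in> coord_ring_upto n 1"
  by (simp add: coord_ring_upto_def mpoly_var_def monom_degree_def)

lemma coord_ring_upto_one: "1 \<in> coord_ring_upto n d"
  using coord_ring_upto_const[of 1] by (simp add: mpoly_const_def)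

lemma coord_ring_upto_linear: "(\<Sum>j<n. mpoly_const (r j) * mpoly_var j) \<in> coord_ring_upto n 1"
proof (rule coord_ring_upto_sum)
  fix j assume "j \<in> {..<n}"
  then have "mpoly_const (r j) * mpoly_var j \<in> coord_ring_upto n (0 + 1)"
    by (intro coord_ring_upto_mult coord_ring_upto_const coord_ring_upto_var) simp
  then show "mpoly_const (r j) * mpoly_var j \<in> coord_ring_upto n 1" by simp
qed

lemma coord_ring_upto_power: "p \<in> coord_ring_upto n d \<Longrightarrow> p ^ k \<in> coord_ring_upto n (k * d)"
  by (induction k) (simp_all add: coord_ring_upto_one coord_ring_upto_mult)

lemma coord_ring_upto_prod:
  "(\<And>i. i \<in> A \<Longrightarrow> p i \<in> coord_ring_upto n (d i)) \<Longrightarrow> (\<Prod>i\<in>A. p i) \<in> coord_ring_upto n (\<Sum>i\<in>A. d i)"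
  by (induction A rule: infinite_finite_induct) (auto simp: coord_ring_upto_one coord_ring_upto_mult)

lemma coord_ring_upto_mono: "p \<in> coord_ring_upto n d \<Longrightarrow> d \<le> e \<Longrightarrow> p \<in> coord_ring_upto n e"
  by (auto simp: coord_ring_upto_def)

lemma mpoly_subst_linear_upto:
  assumes "p \<in> coord_ring_upto n d" "\<And>i. i < n \<Longrightarrow> x i \<in> coord_ring_upto n 1"
  shows "mpoly_subst mpoly_const x p \<in> coord_ring_upto n d"
  unfolding mpoly_subst_def
proof (rule coord_ring_upto_sum)
  fix m assume "m \<in> Poly_Mapping.keys p"
  then have m: "Poly_Mapping.keys m \<subseteq> {..<n}" "monom_degree m \<le> d"
    using assms(1) by (auto simp: coord_ring_upto_def)
  have "(\<Prod>i\<in>Poly_Mapping.keys m. x i ^ Poly_Mapping.lookup m i) \<in> coord_ring_upto n (monom_degree m)"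
    unfolding monom_degree_def
    by (rule coord_ring_upto_prod) (use coord_ring_upto_power[of _ n 1] assms(2) m(1) in auto)
  then have "mpoly_const (Poly_Mapping.lookup p m) * (\<Prod>i\<in>Poly_Mapping.keys m. x i ^ Poly_Mapping.lookup m i)
      \<in> coord_ring_upto n (0 + monom_degree m)"
    by (rule coord_ring_upto_mult[OF coord_ring_upto_const])
  then show "mpoly_const (Poly_Mapping.lookup p m) * (\<Prod>i\<in>Poly_Mapping.keys m. x i ^ Poly_Mapping.lookup m i)
      \<in> coord_ring_upto n d"
    using m(2) coord_ring_upto_mono by fastforce
qed

section \<open>The group action on formal polynomials\<close>

lemma mpoly_act_upto: "p \<in> coord_ring_upto n d \<Longrightarrow> mpoly_act G n \<rho> g p \<in> coord_ring_upto n d"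
  unfolding mpoly_act_def by (rule mpoly_subst_linear_upto, assumption, rule coord_ring_upto_linear)

lemma mpoly_act_add: "mpoly_act G n \<rho> g (p + q) = mpoly_act G n \<rho> g p + mpoly_act G n \<rho> g q"
  by (simp add: mpoly_act_def mpoly_subst_add coeff_hom_mpoly_const)

lemma mpoly_act_sum: "mpoly_act G n \<rho> g (\<Sum>i\<in>A. p i) = (\<Sum>i\<in>A. mpoly_act G n \<rho> g (p i))"
  by (simp add: mpoly_act_def mpoly_subst_sum coeff_hom_mpoly_const)

lemma mpoly_act_one:
  fixes \<rho> :: "'g \<Rightarrow> 'k::field mat"
  assumes G: "group G" and M: "kg_module G n \<rho>" and p: "p \<in> coord_ring n"
  shows "mpoly_act G n \<rho> \<one>\<^bsub>G\<^esub> p = p"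
proof -
  interpret group G by fact
  have "\<rho> (inv\<^bsub>G\<^esub> \<one>\<^bsub>G\<^esub>) = 1\<^sub>m n" using M by (simp add: kg_module_def)
  then have "(\<Sum>j<n. mpoly_const (\<rho> (inv\<^bsub>G\<^esub> \<one>\<^bsub>G\<^esub>) $$ (i, j)) * mpoly_var j) = mpoly_var i" if "i < n" for i
  proof -
    have "(\<Sum>j<n. mpoly_const (1\<^sub>m n $$ (i, j)) * mpoly_var j) =
        (\<Sum>j<n. if j = i then mpoly_var j else (0 :: 'k mpoly))"
      by (intro sum.cong) (use that in \<open>auto simp: mpoly_const_def\<close>)
    then show ?thesis using \<open>\<rho> (inv\<^bsub>G\<^esub> \<one>\<^bsub>G\<^esub>) = 1\<^sub>m n\<close> that by simp
  qed
  then show ?thesis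
    unfolding mpoly_act_def by (subst mpoly_subst_cong[OF p, where y = mpoly_var])
      (auto simp: mpoly_subst_const_var)
qed

text \<open>Substituting the rows for \<open>h\<close> into the rows for \<open>g\<close> multiplies
  the matrices of the inverses as \<open>g\<close> before \<open>h\<close>, which is the matrix of
  the inverse of the product of \<open>h\<close> and \<open>g\<close>: a left action.\<close>

lemma mpoly_act_act:
  fixes \<rho> :: "'g \<Rightarrow> 'k::field mat"
  assumes G: "group G" and M: "kg_module G n \<rho>" and g: "g \<in> carrier G" and h: "h \<in> carrier G"
    and p: "p \<in> coord_ring n"
  shows "mpoly_act G n \<rho> h (mpoly_act G n \<rho> g p) = mpoly_act G n \<rho> (h \<otimes>\<^bsub>G\<^esub> g) p"
proof -
  interpret group G by fact
  let ?A = "\<rho> (inv\<^bsub>G\<^esub> g)" and ?B = "\<rho> (inv\<^bsub>G\<^esub> h)"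
  have AB: "?A \<in> carrier_mat n n" "?B \<in> carrier_mat n n" "\<rho> (inv\<^bsub>G\<^esub> (h \<otimes>\<^bsub>G\<^esub> g)) = ?A * ?B"
    using M g h by (simp_all add: kg_module_def inv_mult_group)
  have const_sum: "mpoly_const (\<Sum>j\<in>S. f j) = (\<Sum>j\<in>S. mpoly_const (f j))" for S and f :: "nat \<Rightarrow> 'k"
    by (induction S rule: infinite_finite_induct) (simp_all add: mpoly_const_def single_add)
  have const_mult: "mpoly_const (s * t) = mpoly_const s * mpoly_const t" for s t :: 'k
    by (simp add: mpoly_const_def mult_single)
  have "mpoly_subst mpoly_const (\<lambda>i. \<Sum>j<n. mpoly_const (?B $$ (i, j)) * mpoly_var j)
      (\<Sum>j<n. mpoly_const (?A $$ (i, j)) * mpoly_var j) =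
      (\<Sum>j<n. mpoly_const ((?A * ?B) $$ (i, j)) * mpoly_var j)" if i: "i < n" for i
  proof -
    have "(\<Sum>j<n. mpoly_const (?A $$ (i, j)) * (\<Sum>k<n. mpoly_const (?B $$ (j, k)) * mpoly_var k)) =
        (\<Sum>k<n. (\<Sum>j<n. mpoly_const (?A $$ (i, j) * ?B $$ (j, k))) * mpoly_var k)"
      unfolding sum_distrib_left sum_distrib_right
      by (subst sum.swap) (simp add: const_mult mult.assoc)
    also have "\<dots> = (\<Sum>k<n. mpoly_const ((?A * ?B) $$ (i, k)) * mpoly_var k)"
      by (intro sum.cong HOL.refl arg_cong2[where f = "(*)"])
        (use AB i in \<open>auto simp: scalar_prod_def lessThan_atLeast0 simp flip: const_sum\<close>)
    finally show ?thesis
      by (simp add: coeff_hom_mpoly_const mpoly_subst_sum mpoly_subst_mult mpoly_subst_const mpoly_subst_var)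
  qed
  then show ?thesis
    unfolding mpoly_act_def AB(3) mpoly_subst_subst[OF coeff_hom_mpoly_const]
    by (rule mpoly_subst_cong[OF p])
qed

section \<open>Generators and relations\<close>

definition dic_rels :: "(dic_gen word \<times> dic_gen word) set" where
  "dic_rels = {(replicate 6 (gen_a, True), []),
      (replicate 2 (gen_b, True), replicate 3 (gen_a, True)),
      ([(gen_b, True), (gen_a, True)], [(gen_a, False), (gen_b, True)])}"

definition cyc_rels :: "(cyc_gen word \<times> cyc_gen word) set" where
  "cyc_rels = {(replicate 2 (gen_c, True), [])}"

abbreviation dic_cyc :: "(dic_gen word set \<times> cyc_gen word set) monoid" where
  "dic_cyc \<equiv> Dic12 \<times>\<times> C2"

definition cls :: "dic_gen word \<Rightarrow> cyc_gen word \<Rightarrow> dic_gen word set \<times> cyc_gen word set" where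
  "cls u v = (word_class dic_rels u, word_class cyc_rels v)"

definition elt_a :: "dic_gen word set \<times> cyc_gen word set" where "elt_a = cls [(gen_a, True)] []"
definition elt_b :: "dic_gen word set \<times> cyc_gen word set" where "elt_b = cls [(gen_b, True)] []"
definition elt_c :: "dic_gen word set \<times> cyc_gen word set" where "elt_c = cls [] [(gen_c, True)]"

lemma Dic12_eq: "Dic12 = presented_group dic_rels"
  by (simp add: Dic12_def dic_rels_def)

lemma C2_eq: "C2 = presented_group cyc_rels"
  by (simp add: C2_def cyc_rels_def)

lemma group_dic_cyc: "group dic_cyc"
  unfolding Dic12_eq C2_eq by (intro DirProd_group group_presented_group)

lemma cls_carrier: "cls u v \<in> carrier dic_cyc"
  by (simp add: Dic12_eq C2_eq cls_def presented_group_def)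

lemma carrier_cls: "g \<in> carrier dic_cyc \<Longrightarrow> \<exists>u v. g = cls u v"
  by (auto simp: Dic12_eq C2_eq cls_def presented_group_def)

lemma cls_mult: "cls u v \<otimes>\<^bsub>dic_cyc\<^esub> cls u' v' = cls (u @ u') (v @ v')"
  by (simp add: Dic12_eq C2_eq cls_def presented_group_mult)

lemma cls_one: "\<one>\<^bsub>dic_cyc\<^esub> = cls [] []"
  by (simp add: Dic12_eq C2_eq cls_def presented_group_def)

lemma cls_eq: "word_eq dic_rels u u' \<Longrightarrow> word_eq cyc_rels v v' \<Longrightarrow> cls u v = cls u' v'"
  by (simp add: cls_def word_class_eq_iff)

lemma rel_a6: "word_eq dic_rels (replicate 6 (gen_a, True)) []"
  using word_eq.rel[of "replicate 6 (gen_a, True)" "[]" dic_rels "[]" "[]"] by (simp add: dic_rels_def)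

lemma rel_bb: "word_eq dic_rels [(gen_b, True), (gen_b, True)] (replicate 3 (gen_a, True))"
  using word_eq.rel[of "replicate 2 (gen_b, True)" "replicate 3 (gen_a, True)" dic_rels "[]" "[]"]
  by (simp add: dic_rels_def numeral_2_eq_2)

lemma rel_aba: "word_eq dic_rels [(gen_a, True), (gen_b, True), (gen_a, True)] [(gen_b, True)]"
proof -
  have "word_eq dic_rels ([(gen_a, True)] @ [(gen_b, True), (gen_a, True)] @ [])
      ([(gen_a, True)] @ [(gen_a, False), (gen_b, True)] @ [])"
    by (rule word_eq.rel) (simp add: dic_rels_def)
  moreover have "word_eq dic_rels ([] @ [(gen_a, True), (gen_a, \<not> True)] @ [(gen_b, True)]) ([] @ [(gen_b, True)])"
    by (rule word_eq.cancel)
  ultimately show ?thesis using word_eq.trans by fastforce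
qed

lemma rel_cc: "word_eq cyc_rels [(gen_c, True), (gen_c, True)] []"
  using word_eq.rel[of "replicate 2 (gen_c, True)" "[]" cyc_rels "[]" "[]"]
  by (simp add: cyc_rels_def numeral_2_eq_2)

lemma rel_a_inv: "word_eq dic_rels [(gen_a, False)] (replicate 5 (gen_a, True))"
proof -
  have "word_eq dic_rels ([(gen_a, False)] @ replicate 6 (gen_a, True)) ([(gen_a, False)] @ [])"
    by (rule word_eq_append_left[OF rel_a6])
  moreover have "word_eq dic_rels ([] @ [(gen_a, False), (gen_a, \<not> False)] @ replicate 5 (gen_a, True))
      ([] @ replicate 5 (gen_a, True))"
    by (rule word_eq.cancel)
  moreover have "replicate 6 (gen_a, True) = (gen_a, True) # replicate 5 (gen_a, True)"
    by (simp add: numeral_eq_Suc)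
  ultimately show ?thesis using word_eq.trans word_eq.sym by fastforce
qed

text \<open>The relations give b^2 a^3 = a^6 = 1.\<close>

lemma rel_b_inv: "word_eq dic_rels [(gen_b, False)] ((gen_b, True) # replicate 3 (gen_a, True))"
proof -
  let ?bb = "[(gen_b, True), (gen_b, True)]"
  have "word_eq dic_rels (?bb @ replicate 3 (gen_a, True)) (replicate 3 (gen_a, True) @ replicate 3 (gen_a, True))"
    by (rule word_eq_append_right[OF rel_bb])
  then have "word_eq dic_rels (?bb @ replicate 3 (gen_a, True)) []"
    using rel_a6 word_eq.trans by (fastforce simp flip: replicate_add)
  then have "word_eq dic_rels ([(gen_b, False)] @ ?bb @ replicate 3 (gen_a, True)) ([(gen_b, False)] @ [])"
    by (rule word_eq_append_left)
  moreover have "word_eq dic_rels ([] @ [(gen_b, False), (gen_b, \<not> False)] @ ((gen_b, True) # replicate 3 (gen_a, True)))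
      ([] @ ((gen_b, True) # replicate 3 (gen_a, True)))"
    by (rule word_eq.cancel)
  ultimately show ?thesis using word_eq.trans word_eq.sym by fastforce
qed

lemma rel_c_inv: "word_eq cyc_rels [(gen_c, False)] [(gen_c, True)]"
proof -
  have "word_eq cyc_rels ([(gen_c, False)] @ [(gen_c, True), (gen_c, True)]) ([(gen_c, False)] @ [])"
    by (rule word_eq_append_left[OF rel_cc])
  moreover have "word_eq cyc_rels ([] @ [(gen_c, False), (gen_c, \<not> False)] @ [(gen_c, True)]) ([] @ [(gen_c, True)])"
    by (rule word_eq.cancel)
  ultimately show ?thesis using word_eq.trans word_eq.sym by fastforce
qed

lemma elt_carrier [simp]: "elt_a \<in> carrier dic_cyc" "elt_b \<in> carrier dic_cyc" "elt_c \<in> carrier dic_cyc"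
  unfolding elt_a_def elt_b_def elt_c_def by (rule cls_carrier)+

text \<open>The inverses of the generators are the positive words a^5, b a^3 and c, so left
  multiplication by generators reaches every class of words. This induction takes the place of an
  enumeration of the group.\<close>

lemma dic_cyc_induct [consumes 1, case_names one a b c]:
  assumes g: "g \<in> carrier dic_cyc" and one: "P \<one>\<^bsub>dic_cyc\<^esub>"
    and a: "\<And>h. h \<in> carrier dic_cyc \<Longrightarrow> P h \<Longrightarrow> P (elt_a \<otimes>\<^bsub>dic_cyc\<^esub> h)"
    and b: "\<And>h. h \<in> carrier dic_cyc \<Longrightarrow> P h \<Longrightarrow> P (elt_b \<otimes>\<^bsub>dic_cyc\<^esub> h)"
    and c: "\<And>h. h \<in> carrier dic_cyc \<Longrightarrow> P h \<Longrightarrow> P (elt_c \<otimes>\<^bsub>dic_cyc\<^esub> h)"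
  shows "P g"
proof -
  have a': "P (cls ((gen_a, True) # u) v)" and b': "P (cls ((gen_b, True) # u) v)"
    and c': "P (cls u ((gen_c, True) # v))" if "P (cls u v)" for u v
    using a[OF cls_carrier that] b[OF cls_carrier that] c[OF cls_carrier that]
    by (simp_all add: elt_a_def elt_b_def elt_c_def cls_mult)
  have v: "P (cls [] v)" for v
  proof (induction v)
    case Nil
    show ?case using one unfolding cls_one .
  next
    case (Cons l v)
    obtain x e where "l = (x, e)" by (rule prod.exhaust)
    then have l: "l = (gen_c, e)" by (cases x) simp
    have "cls [] ((gen_c, False) # v) = cls [] ((gen_c, True) # v)"
      using word_eq_append_right[OF rel_c_inv, of v] by (intro cls_eq word_eq.refl) simp
    then show ?case using c'[OF Cons] l by (cases e) simp_all
  qed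
  have "P (cls u v)" for u v
  proof (induction u)
    case Nil
    show ?case by (rule v)
  next
    case (Cons l u)
    have "cls ((gen_a, False) # u) v = cls (replicate 5 (gen_a, True) @ u) v"
      using word_eq_append_right[OF rel_a_inv, of u] by (intro cls_eq word_eq.refl) simp
    then have "P (cls ((gen_a, False) # u) v)"
      using a'[OF a'[OF a'[OF a'[OF a'[OF Cons]]]]] by (simp add: numeral_eq_Suc)
    moreover have "cls ((gen_b, False) # u) v = cls (((gen_b, True) # replicate 3 (gen_a, True)) @ u) v"
      using word_eq_append_right[OF rel_b_inv, of u] by (intro cls_eq word_eq.refl) simp
    then have "P (cls ((gen_b, False) # u) v)"
      using b'[OF a'[OF a'[OF a'[OF Cons]]]] by (simp add: numeral_eq_Suc)
    moreover obtain x e where "l = (x, e)" by (rule prod.exhaust)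
    ultimately show ?case using a'[OF Cons] b'[OF Cons] by (cases x; cases e) simp_all
  qed
  then show ?thesis using carrier_cls[OF g] by blast
qed

lemma elt_a6: "elt_a \<otimes>\<^bsub>dic_cyc\<^esub> (elt_a \<otimes>\<^bsub>dic_cyc\<^esub> (elt_a \<otimes>\<^bsub>dic_cyc\<^esub>
    (elt_a \<otimes>\<^bsub>dic_cyc\<^esub> (elt_a \<otimes>\<^bsub>dic_cyc\<^esub> elt_a)))) = \<one>\<^bsub>dic_cyc\<^esub>"
  using rel_a6 unfolding elt_a_def cls_one cls_mult
  by (intro cls_eq) (simp_all add: numeral_eq_Suc word_eq.refl)

lemma elt_bb: "elt_b \<otimes>\<^bsub>dic_cyc\<^esub> elt_b = elt_a \<otimes>\<^bsub>dic_cyc\<^esub> (elt_a \<otimes>\<^bsub>dic_cyc\<^esub> elt_a)"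
  using rel_bb unfolding elt_a_def elt_b_def cls_mult
  by (intro cls_eq) (simp_all add: numeral_eq_Suc word_eq.refl)

lemma elt_aba: "elt_a \<otimes>\<^bsub>dic_cyc\<^esub> (elt_b \<otimes>\<^bsub>dic_cyc\<^esub> elt_a) = elt_b"
  using rel_aba unfolding elt_a_def elt_b_def cls_mult
  by (intro cls_eq) (simp_all add: word_eq.refl)

lemma elt_cc: "elt_c \<otimes>\<^bsub>dic_cyc\<^esub> elt_c = \<one>\<^bsub>dic_cyc\<^esub>"
  using rel_cc unfolding elt_c_def cls_one cls_mult
  by (intro cls_eq) (simp_all add: word_eq.refl)

lemma elt_ca: "elt_c \<otimes>\<^bsub>dic_cyc\<^esub> elt_a = elt_a \<otimes>\<^bsub>dic_cyc\<^esub> elt_c"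
  by (simp add: elt_a_def elt_c_def cls_mult)

lemma elt_cb: "elt_c \<otimes>\<^bsub>dic_cyc\<^esub> elt_b = elt_b \<otimes>\<^bsub>dic_cyc\<^esub> elt_c"
  by (simp add: elt_b_def elt_c_def cls_mult)

text \<open>Here \<open>z ^ 6 = -1\<close>, and z^6 + 1 is the product of z^2 + 1, nonzero because
  \<open>z ^ 4\<close> is not 1, and z^4 - z^2 + 1. So \<open>z ^ 2\<close> is a root of the sixth
  cyclotomic polynomial.\<close>

lemma mult_order_12:
  assumes "has_mult_order (z::'k::field) 12"
  shows "(z ^ 2) ^ 3 = -1" "(z ^ 2) ^ 2 = z ^ 2 - 1" "(z ^ 2) ^ d = 1 \<Longrightarrow> 6 dvd d"
proof -
  have z12: "z ^ 12 = 1" and min: "\<And>m. 0 < m \<Longrightarrow> m < 12 \<Longrightarrow> z ^ m \<noteq> 1"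
    using assms by (auto simp: has_mult_order_def)
  have "(z ^ 6 - 1) * (z ^ 6 + 1) = z ^ 12 - 1"
    by (simp add: algebra_simps flip: power_add)
  then have z6: "z ^ 6 = -1" using z12 min[of 6] by (simp add: eq_neg_iff_add_eq_0)
  then show "(z ^ 2) ^ 3 = -1" by (simp flip: power_mult)
  have "(z ^ 2 + 1) * ((z ^ 2) ^ 2 - z ^ 2 + 1) = z ^ 6 + 1"
    by (simp add: algebra_simps flip: power_mult power_add)
  moreover have "z ^ 2 + 1 \<noteq> 0"
  proof
    assume "z ^ 2 + 1 = 0"
    then have "(z ^ 2) ^ 2 = 1" by (simp add: eq_neg_iff_add_eq_0[symmetric])
    then show False using min[of 4] by (simp flip: power_mult)
  qed
  ultimately have "(z ^ 2) ^ 2 - z ^ 2 + 1 = 0" using z6 by simp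
  then show "(z ^ 2) ^ 2 = z ^ 2 - 1" by (simp add: algebra_simps eq_diff_eq add_eq_0_iff)
  show "6 dvd d" if "(z ^ 2) ^ d = 1"
  proof -
    have "(z ^ 2) ^ d = (z ^ 2) ^ (6 * (d div 6) + d mod 6)" by simp
    also have "\<dots> = ((z ^ 2) ^ 6) ^ (d div 6) * (z ^ 2) ^ (d mod 6)" by (simp only: power_add power_mult)
    also have "(z ^ 2) ^ 6 = 1" using z12 by (simp flip: power_mult)
    finally have "z ^ (2 * (d mod 6)) = 1" using that by (simp flip: power_mult)
    then have "\<not> 0 < 2 * (d mod 6)" using min[of "2 * (d mod 6)"] by auto
    then show ?thesis by presburger
  qed
qed

text \<open>Orthogonality of the characters of the cyclic group of order 6. It serves twice: to
  discard monomials in the lower bound and to split linear forms into weights in the upper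
  bound.\<close>

lemma sum_powers_root:
  assumes "has_mult_order (z::'k::field) 12"
  shows "(\<Sum>k<6. (z ^ 2) ^ (d * k)) = (if 6 dvd d then 6 else 0)"
proof -
  have z6: "(z ^ 2) ^ 6 = 1" using assms by (simp add: has_mult_order_def flip: power_mult)
  show ?thesis
  proof (cases "6 dvd d")
    case True
    then have "(z ^ 2) ^ d = 1" using z6 by (auto simp: dvd_def power_mult)
    then show ?thesis using True by (simp add: power_mult)
  next
    case False
    then have "(z ^ 2) ^ d \<noteq> 1" using mult_order_12(3)[OF assms] by blast
    moreover have "((z ^ 2) ^ d) ^ 6 = 1" using z6 by (metis power_mult mult.commute power_one)
    ultimately show ?thesis using False by (simp add: power_mult geometric_sum)
  qed
qed

section \<open>The lower bound\<close>

definition mat22 :: "'k::field \<Rightarrow> 'k \<Rightarrow> 'k \<Rightarrow> 'k \<Rightarrow> 'k mat" where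
  "mat22 p q r s = mat 2 2 (\<lambda>(i, j). if i = 0 then if j = 0 then p else q else if j = 0 then r else s)"

definition vec2 :: "'k::field \<Rightarrow> 'k \<Rightarrow> 'k vec" where
  "vec2 x y = vec 2 (\<lambda>i. if i = 0 then x else y)"

lemma mat22_mult: "mat22 p q r s * mat22 p' q' r' s' =
    mat22 (p * p' + q * r') (p * q' + q * s') (r * p' + s * r') (r * q' + s * s')"
  by (rule eq_matI) (auto simp: mat22_def scalar_prod_def sum.atLeast0_lessThan_Suc numeral_2_eq_2)

lemma mat22_one: "1\<^sub>m 2 = mat22 1 0 0 1"
  by (rule eq_matI) (auto simp: mat22_def)

lemma mat22_carrier: "mat22 p q r s \<in> carrier_mat 2 2"
  by (simp add: mat22_def)

lemma mat22_vec2: "mat22 p q r s *\<^sub>v vec2 x y = vec2 (p * x + q * y) (r * x + s * y)"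
  by (rule eq_vecI) (auto simp: mat22_def vec2_def scalar_prod_def sum.atLeast0_lessThan_Suc numeral_2_eq_2)

lemma vec2_carrier: "vec2 x y \<in> carrier_vec 2"
  by (simp add: vec2_def)

lemma vec2_nth: "vec2 x y $ 0 = x" "vec2 x y $ 1 = y" "vec2 x y $ Suc 0 = y"
  by (simp_all add: vec2_def)

text \<open>The fifth power of \<open>\<zeta>\<close> is its inverse. The factor C2 acts trivially,
  so only words of the dicyclic factor receive matrices.\<close>

fun letter_mat :: "'k::field \<Rightarrow> dic_gen \<times> bool \<Rightarrow> 'k mat" where
  "letter_mat \<zeta> (gen_a, True) = mat22 \<zeta> 0 0 (\<zeta> ^ 5)"
| "letter_mat \<zeta> (gen_a, False) = mat22 (\<zeta> ^ 5) 0 0 \<zeta>"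
| "letter_mat \<zeta> (gen_b, True) = mat22 0 (-1) 1 0"
| "letter_mat \<zeta> (gen_b, False) = mat22 0 1 (-1) 0"

fun word_mat :: "'k::field \<Rightarrow> dic_gen word \<Rightarrow> 'k mat" where
  "word_mat \<zeta> [] = 1\<^sub>m 2"
| "word_mat \<zeta> (l # u) = letter_mat \<zeta> l * word_mat \<zeta> u"

lemma letter_mat_carrier: "letter_mat \<zeta> l \<in> carrier_mat 2 2"
  by (cases "(\<zeta>, l)" rule: letter_mat.cases) (simp_all add: mat22_carrier)

lemma word_mat_carrier: "word_mat \<zeta> u \<in> carrier_mat 2 2"
proof (induction u)
  case (Cons l u)
  show ?case unfolding word_mat.simps by (rule mult_carrier_mat[OF letter_mat_carrier Cons])
qed simp

lemma word_mat_append: "word_mat \<zeta> (u @ v) = word_mat \<zeta> u * word_mat \<zeta> v"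
proof (induction u)
  case Nil
  show ?case by (simp only: append.simps word_mat.simps left_mult_one_mat[OF word_mat_carrier])
next
  case (Cons l u)
  show ?case
    unfolding append.simps word_mat.simps Cons
    by (rule assoc_mult_mat[OF letter_mat_carrier word_mat_carrier word_mat_carrier, symmetric])
qed

text \<open>The matrices obey the defining relations: the cube of the first and the square of the
  second are both -1.\<close>

lemma word_mat_eq:
  assumes z: "\<zeta> ^ 3 = (-1::'k::field)" and uv: "word_eq dic_rels u v"
  shows "word_mat \<zeta> u = word_mat \<zeta> v"
  using uv
proof (induction rule: word_eq.induct)
  case (cancel u x e v)
  have z6: "\<zeta> * \<zeta> ^ 5 = 1" using z power_mult[of \<zeta> 3 2] power_Suc[of \<zeta> 5] by simp
  have "letter_mat \<zeta> (x, e) * letter_mat \<zeta> (x, \<not> e) = 1\<^sub>m 2"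
    using z6 by (cases x; cases e) (simp_all add: mat22_mult mat22_one mult.commute)
  then have "word_mat \<zeta> ([(x, e), (x, \<not> e)] @ v) = word_mat \<zeta> v"
    using assoc_mult_mat[OF letter_mat_carrier letter_mat_carrier word_mat_carrier, of \<zeta> "(x, e)" \<zeta> "(x, \<not> e)" \<zeta> v]
      left_mult_one_mat[OF word_mat_carrier, of \<zeta> v] by (simp only: append.simps word_mat.simps)
  then show ?case by (simp only: word_mat_append)
next
  case (rel l r u v)
  have z6: "\<zeta> * \<zeta> ^ 5 = 1" using z power_mult[of \<zeta> 3 2] power_Suc[of \<zeta> 5] by simp
  have "\<zeta> ^ 5 * (\<zeta> ^ 5 * \<zeta> ^ 5) = (\<zeta> ^ 3) ^ 5" by (simp flip: power_add power_mult)
  then have z15: "\<zeta> ^ 5 * (\<zeta> ^ 5 * \<zeta> ^ 5) = -1" by (simp add: z)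
  have a3: "word_mat \<zeta> (replicate 3 (gen_a, True)) = mat22 (-1) 0 0 (-1)"
    using z z15 by (simp add: numeral_3_eq_3 mat22_mult mat22_one)
  have "replicate 6 (gen_a, True) = replicate 3 (gen_a, True) @ replicate 3 (gen_a, True)"
    by (simp flip: replicate_add)
  then have a6: "word_mat \<zeta> (replicate 6 (gen_a, True)) = 1\<^sub>m 2"
    using a3 by (simp add: word_mat_append mat22_mult mat22_one)
  have "replicate 2 (gen_b, True) = [(gen_b, True), (gen_b, True)]" by (simp add: numeral_2_eq_2)
  then have b2: "word_mat \<zeta> (replicate 2 (gen_b, True)) = mat22 (-1) 0 0 (-1)"
    by (simp add: mat22_mult mat22_one)
  have "word_mat \<zeta> l = word_mat \<zeta> r"
    using rel a3 a6 b2 z6 by (auto simp: dic_rels_def mat22_mult mat22_one)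
  then show ?case by (simp only: word_mat_append)
qed simp_all

text \<open>An element is a class of words, and any word of the class may be evaluated, by
  \<open>word_mat_eq\<close>.\<close>

definition dic_rep :: "'k::field \<Rightarrow> dic_gen word set \<times> cyc_gen word set \<Rightarrow> 'k mat" where
  "dic_rep \<zeta> g = word_mat \<zeta> (SOME u. fst g = word_class dic_rels u)"

lemma dic_rep_cls:
  assumes "\<zeta> ^ 3 = (-1::'k::field)"
  shows "dic_rep \<zeta> (cls u v) = word_mat \<zeta> u"
proof -
  have "word_class dic_rels u = word_class dic_rels (SOME u'. word_class dic_rels u = word_class dic_rels u')"
    by (rule someI[of "\<lambda>u'. word_class dic_rels u = word_class dic_rels u'" u]) simp
  then show ?thesis
    using word_mat_eq[OF assms] by (simp add: dic_rep_def cls_def word_class_eq_iff)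
qed

lemma kg_module_dic_rep:
  assumes "\<zeta> ^ 3 = (-1::'k::field)"
  shows "kg_module dic_cyc 2 (dic_rep \<zeta>)"
  unfolding kg_module_def
proof (intro conjI ballI)
  show "dic_rep \<zeta> g \<in> carrier_mat 2 2" for g by (simp add: dic_rep_def word_mat_carrier)
  show "dic_rep \<zeta> \<one>\<^bsub>dic_cyc\<^esub> = 1\<^sub>m 2" unfolding cls_one dic_rep_cls[OF assms] by simp
next
  fix g h assume "g \<in> carrier dic_cyc" "h \<in> carrier dic_cyc"
  then obtain u v u' v' where "g = cls u v" "h = cls u' v'" using carrier_cls by metis
  then show "dic_rep \<zeta> (g \<otimes>\<^bsub>dic_cyc\<^esub> h) = dic_rep \<zeta> g * dic_rep \<zeta> h"
    by (simp only: cls_mult dic_rep_cls[OF assms] word_mat_append)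
qed

lemma invariant_eval:
  assumes G: "group G" and M: "kg_module G n \<rho>" and f: "f \<in> invariants G n \<rho>"
    and g: "g \<in> carrier G" and v: "v \<in> carrier_vec n"
  shows "mpoly_eval f (\<rho> g *\<^sub>v v) = mpoly_eval f v"
proof -
  interpret group G by fact
  have "mpoly_act G n \<rho> (inv\<^bsub>G\<^esub> g) f = f" "f \<in> coord_ring n" using f g by (auto simp: invariants_def)
  then show ?thesis using mpoly_eval_act[OF G M _ _ v, of "inv\<^bsub>G\<^esub> g" f] g by simp
qed

text \<open>The generator \<open>a\<close> multiplies x y by \<open>\<zeta> ^ 6 = 1\<close> and
  preserves sixth powers; \<open>b\<close> maps (x, y) to (-y, x) and reverses the sign of both
  factors. Only constancy on orbits is required, so the octic appears as a function.\<close>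

lemma dic_rep_octic:
  assumes z: "\<zeta> ^ 3 = (-1::'k::field)" and g: "g \<in> carrier dic_cyc"
  shows "\<exists>x' y'. dic_rep \<zeta> g *\<^sub>v vec2 x y = vec2 x' y' \<and>
    x' * y' * (x' ^ 6 - y' ^ 6) = x * y * (x ^ 6 - y ^ 6)"
proof -
  have rep: "dic_rep \<zeta> (g \<otimes>\<^bsub>dic_cyc\<^esub> h) = dic_rep \<zeta> g * dic_rep \<zeta> h"
    "dic_rep \<zeta> g \<in> carrier_mat 2 2" if "g \<in> carrier dic_cyc" "h \<in> carrier dic_cyc" for g h
    using kg_module_dic_rep[OF z] that by (auto simp: kg_module_def)
  have gens: "dic_rep \<zeta> elt_a = mat22 \<zeta> 0 0 (\<zeta> ^ 5)" "dic_rep \<zeta> elt_b = mat22 0 (-1) 1 0"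
    "dic_rep \<zeta> elt_c = mat22 1 0 0 1"
    unfolding elt_a_def elt_b_def elt_c_def dic_rep_cls[OF z]
    by (simp_all add: right_mult_one_mat[OF mat22_carrier] mat22_one mat22_mult)
  have z6: "\<zeta> ^ 6 = 1" using z power_mult[of \<zeta> 3 2] by simp
  then have z5: "\<zeta> * \<zeta> ^ 5 = 1" "(\<zeta> ^ 5) ^ 6 = 1"
    using power_Suc[of \<zeta> 5] power_mult[of \<zeta> 6 5] power_mult[of \<zeta> 5 6] by simp_all
  show ?thesis
    using g
  proof (induction g rule: dic_cyc_induct)
    case one
    have "dic_rep \<zeta> \<one>\<^bsub>dic_cyc\<^esub> = mat22 1 0 0 1"
      using kg_module_dic_rep[OF z] unfolding kg_module_def mat22_one by blast
    then have "dic_rep \<zeta> \<one>\<^bsub>dic_cyc\<^esub> *\<^sub>v vec2 x y = vec2 x y" by (simp only: mat22_vec2) simp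
    then show ?case by blast
  next
    case (a h)
    then obtain x' y' where h: "dic_rep \<zeta> h *\<^sub>v vec2 x y = vec2 x' y'"
      "x' * y' * (x' ^ 6 - y' ^ 6) = x * y * (x ^ 6 - y ^ 6)" by blast
    have "dic_rep \<zeta> (elt_a \<otimes>\<^bsub>dic_cyc\<^esub> h) *\<^sub>v vec2 x y = vec2 (\<zeta> * x') (\<zeta> ^ 5 * y')"
      using rep[OF elt_carrier(1) a(1)] rep(2)[OF a(1) a(1)] h(1)
      by (simp add: assoc_mult_mat_vec[of _ 2 2 _ 2] vec2_carrier gens mat22_vec2)
    moreover have "\<zeta> * x' * (\<zeta> ^ 5 * y') * ((\<zeta> * x') ^ 6 - (\<zeta> ^ 5 * y') ^ 6)
        = x * y * (x ^ 6 - y ^ 6)"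
    proof -
      have "\<zeta> * x' * (\<zeta> ^ 5 * y') * ((\<zeta> * x') ^ 6 - (\<zeta> ^ 5 * y') ^ 6)
          = (\<zeta> * \<zeta> ^ 5) * (x' * y' * (x' ^ 6 - y' ^ 6))"
        unfolding power_mult_distrib z6 z5(2) by (simp add: mult_ac)
      then show ?thesis unfolding z5(1) h(2) by simp
    qed
    ultimately show ?case by blast
  next
    case (b h)
    then obtain x' y' where h: "dic_rep \<zeta> h *\<^sub>v vec2 x y = vec2 x' y'"
      "x' * y' * (x' ^ 6 - y' ^ 6) = x * y * (x ^ 6 - y ^ 6)" by blast
    have "dic_rep \<zeta> (elt_b \<otimes>\<^bsub>dic_cyc\<^esub> h) *\<^sub>v vec2 x y = vec2 (- y') x'"
      using rep[OF elt_carrier(2) b(1)] rep(2)[OF b(1) b(1)] h(1)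
      by (simp add: assoc_mult_mat_vec[of _ 2 2 _ 2] vec2_carrier gens mat22_vec2)
    moreover have "(- y') * x' * ((- y') ^ 6 - x' ^ 6) = x * y * (x ^ 6 - y ^ 6)"
      unfolding h(2)[symmetric] by (simp add: algebra_simps)
    ultimately show ?case by blast
  next
    case (c h)
    then obtain x' y' where h: "dic_rep \<zeta> h *\<^sub>v vec2 x y = vec2 x' y'"
      "x' * y' * (x' ^ 6 - y' ^ 6) = x * y * (x ^ 6 - y ^ 6)" by blast
    have "dic_rep \<zeta> (elt_c \<otimes>\<^bsub>dic_cyc\<^esub> h) *\<^sub>v vec2 x y = vec2 x' y'"
      using rep[OF elt_carrier(3) c(1)] rep(2)[OF c(1) c(1)] h(1)
      by (simp add: assoc_mult_mat_vec[of _ 2 2 _ 2] vec2_carrier gens mat22_vec2)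
    then show ?case using h(2) by blast
  qed
qed

lemma mpoly_eval_vec2:
  assumes "f \<in> coord_ring 2"
  shows "mpoly_eval f (vec2 x y) = (\<Sum>m\<in>Poly_Mapping.keys f. Poly_Mapping.lookup f m *
    (x ^ Poly_Mapping.lookup m 0 * y ^ Poly_Mapping.lookup m 1))"
  unfolding mpoly_eval_def mpoly_subst_def
proof (intro sum.cong HOL.refl arg_cong2[where f = "(*)"])
  fix m assume "m \<in> Poly_Mapping.keys f"
  then have "Poly_Mapping.keys m \<subseteq> {..<2}" using assms by (auto simp: coord_ring_def)
  then have "(\<Prod>i\<in>Poly_Mapping.keys m. (vec2 x y $ i) ^ Poly_Mapping.lookup m i) =
      (\<Prod>i\<in>{..<2}. (vec2 x y $ i) ^ Poly_Mapping.lookup m i)"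
    by (intro prod.mono_neutral_left) (auto simp: in_keys_iff)
  then show "(\<Prod>i\<in>Poly_Mapping.keys m. (vec2 x y $ i) ^ Poly_Mapping.lookup m i) =
      x ^ Poly_Mapping.lookup m 0 * y ^ Poly_Mapping.lookup m 1"
    by (simp add: numeral_2_eq_2 vec2_nth)
qed

text \<open>Averaging over the twelve elements a^k and a^k b discards x^i y^j unless i and j agree
  modulo 6. In degree at most 7 this leaves i = j, where the contributions of the two cosets are
  exchanged by y to -y, and exponents 6 and 0, where signs disappear. The first exponents to escape
  are 7 and 1, those of the octic.\<close>

lemma low_degree_invariant_eq:
  assumes z: "has_mult_order (z::'k::field_char_0) 12"
    and f: "f \<in> invariants dic_cyc 2 (dic_rep (z ^ 2))" "mpoly_degree f \<le> 7"
  shows "mpoly_eval f (vec2 1 2) = mpoly_eval f (vec2 1 (-2))"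
proof -
  define \<zeta> where "\<zeta> = z ^ 2"
  have z3: "\<zeta> ^ 3 = -1" using mult_order_12(1)[OF z] by (simp add: \<zeta>_def)
  have fc: "f \<in> coord_ring 2" using f by (simp add: invariants_def)
  have inv: "mpoly_eval f (dic_rep \<zeta> g *\<^sub>v vec2 x y) = mpoly_eval f (vec2 x y)" if "g \<in> carrier dic_cyc" for g x y
    using invariant_eval[OF group_dic_cyc kg_module_dic_rep[OF z3] _ that vec2_carrier] f(1) by (simp add: \<zeta>_def)
  have gens: "dic_rep \<zeta> elt_a = mat22 \<zeta> 0 0 (\<zeta> ^ 5)" "dic_rep \<zeta> elt_b = mat22 0 (-1) 1 0"
    unfolding elt_a_def elt_b_def dic_rep_cls[OF z3]
    by (simp_all add: right_mult_one_mat[OF mat22_carrier])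
  have a: "mpoly_eval f (vec2 (\<zeta> ^ k * x) (\<zeta> ^ (5 * k) * y)) = mpoly_eval f (vec2 x y)" for k x y
  proof (induction k)
    case (Suc k)
    have "vec2 (\<zeta> ^ Suc k * x) (\<zeta> ^ (5 * Suc k) * y) = dic_rep \<zeta> elt_a *\<^sub>v vec2 (\<zeta> ^ k * x) (\<zeta> ^ (5 * k) * y)"
      by (simp add: gens mat22_vec2 power_add mult.assoc)
    then show ?case using inv[OF elt_carrier(1)] Suc by simp
  qed simp
  have b: "mpoly_eval f (vec2 (- y) x) = mpoly_eval f (vec2 x y)" for x y
    using inv[OF elt_carrier(2), of x y] by (simp add: gens mat22_vec2)
  have avg: "12 * mpoly_eval f (vec2 x y) =
      (\<Sum>m\<in>Poly_Mapping.keys f. Poly_Mapping.lookup f m *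
        ((\<Sum>k<6. \<zeta> ^ ((Poly_Mapping.lookup m 0 + 5 * Poly_Mapping.lookup m 1) * k)) *
         (x ^ Poly_Mapping.lookup m 0 * y ^ Poly_Mapping.lookup m 1 +
          (- y) ^ Poly_Mapping.lookup m 0 * x ^ Poly_Mapping.lookup m 1)))" for x y
  proof -
    have "(\<Sum>k<6::nat. mpoly_eval f (vec2 (\<zeta> ^ k * x) (\<zeta> ^ (5 * k) * y)) +
        mpoly_eval f (vec2 (\<zeta> ^ k * (- y)) (\<zeta> ^ (5 * k) * x))) = 12 * mpoly_eval f (vec2 x y)"
      unfolding a b by simp
    moreover have "mpoly_eval f (vec2 (\<zeta> ^ k * x) (\<zeta> ^ (5 * k) * y)) +
        mpoly_eval f (vec2 (\<zeta> ^ k * (- y)) (\<zeta> ^ (5 * k) * x)) =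
        (\<Sum>m\<in>Poly_Mapping.keys f. Poly_Mapping.lookup f m *
          (\<zeta> ^ ((Poly_Mapping.lookup m 0 + 5 * Poly_Mapping.lookup m 1) * k) *
           (x ^ Poly_Mapping.lookup m 0 * y ^ Poly_Mapping.lookup m 1 +
            (- y) ^ Poly_Mapping.lookup m 0 * x ^ Poly_Mapping.lookup m 1)))" for k
    proof -
      have pow: "\<zeta> ^ ((i + 5 * j) * k) = (\<zeta> ^ k) ^ i * (\<zeta> ^ (5 * k)) ^ j" for i j
        by (simp add: algebra_simps flip: power_mult power_add)
      have factor: "s * (p * q * (r * t)) + s * (p * q' * (r * t')) = s * (p * r * (q * t + q' * t'))"
        for s p q r t q' t' :: 'k by (simp add: algebra_simps)
      show ?thesis
        unfolding mpoly_eval_vec2[OF fc] pow power_mult_distrib sum.distrib[symmetric]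
        unfolding factor ..
    qed
    ultimately have "12 * mpoly_eval f (vec2 x y) = (\<Sum>k<6. \<Sum>m\<in>Poly_Mapping.keys f. Poly_Mapping.lookup f m *
        (\<zeta> ^ ((Poly_Mapping.lookup m 0 + 5 * Poly_Mapping.lookup m 1) * k) *
         (x ^ Poly_Mapping.lookup m 0 * y ^ Poly_Mapping.lookup m 1 +
          (- y) ^ Poly_Mapping.lookup m 0 * x ^ Poly_Mapping.lookup m 1)))" by simp
    then show ?thesis
      by (subst (asm) sum.swap) (simp add: sum_distrib_left sum_distrib_right)
  qed
  have "12 * mpoly_eval f (vec2 1 2) = 12 * mpoly_eval f (vec2 1 (-2))"
    unfolding avg
  proof (rule sum.cong[OF HOL.refl], rule arg_cong2[where f = "(*)", OF HOL.refl])
    fix m assume m: "m \<in> Poly_Mapping.keys f"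
    define i j where "i = Poly_Mapping.lookup m 0" and "j = Poly_Mapping.lookup m 1"
    have "f \<in> coord_ring_upto 2 7" using fc f(2) by (simp add: coord_ring_upto_iff)
    then have deg: "Poly_Mapping.keys m \<subseteq> {..<2}" "monom_degree m \<le> 7"
      using m by (auto simp: coord_ring_upto_def)
    have "monom_degree m = (\<Sum>i\<in>{..<2}. Poly_Mapping.lookup m i)"
      unfolding monom_degree_def by (rule sum.mono_neutral_left) (use deg in \<open>auto simp: in_keys_iff\<close>)
    then have ij: "i + j \<le> 7" using deg(2) by (simp add: i_def j_def numeral_2_eq_2)
    have "(\<Sum>k<6. \<zeta> ^ ((i + 5 * j) * k)) * (1 ^ i * 2 ^ j + (- 2) ^ i * 1 ^ j) =
        (\<Sum>k<6. \<zeta> ^ ((i + 5 * j) * k)) * (1 ^ i * (- 2) ^ j + (- (- 2)) ^ i * (1::'k) ^ j)"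
    proof (cases "6 dvd i + 5 * j")
      case False
      then show ?thesis using sum_powers_root[OF z] by (simp add: \<zeta>_def)
    next
      case True
      \<comment> \<open>Both exponents are at most 7, so the congruence is settled by inspecting 64
        pairs.\<close>
      have "(i, j) \<in> set (List.product [0..<8] [0..<8])" using ij by auto
      moreover have "\<forall>p \<in> set (List.product [0..<8] [0..<8]). 6 dvd fst p + 5 * snd p \<longrightarrow>
          fst p + snd p \<le> 7 \<longrightarrow> fst p = snd p \<or> even (fst p) \<and> even (snd p)"
        by code_simp
      ultimately have "i = j \<or> even i \<and> even j" using True ij by (metis fst_conv snd_conv)
      then have "1 ^ i * 2 ^ j + (- 2) ^ i * 1 ^ j = 1 ^ i * (- 2) ^ j + (- (- 2)) ^ i * (1::'k) ^ j"
        by (elim disjE) (simp_all add: add.commute)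
      then show ?thesis by (rule arg_cong)
    qed
    then show "(\<Sum>k<6. \<zeta> ^ ((Poly_Mapping.lookup m 0 + 5 * Poly_Mapping.lookup m 1) * k)) *
        (1 ^ Poly_Mapping.lookup m 0 * 2 ^ Poly_Mapping.lookup m 1 +
          (- 2) ^ Poly_Mapping.lookup m 0 * 1 ^ Poly_Mapping.lookup m 1) =
        (\<Sum>k<6. \<zeta> ^ ((Poly_Mapping.lookup m 0 + 5 * Poly_Mapping.lookup m 1) * k)) *
        (1 ^ Poly_Mapping.lookup m 0 * (- 2) ^ Poly_Mapping.lookup m 1 +
          (- (- 2)) ^ Poly_Mapping.lookup m 0 * 1 ^ Poly_Mapping.lookup m 1)"
      by (simp only: i_def j_def)
  qed
  then show ?thesis by simp
qed

lemma beta_sep_ge: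
  assumes z: "has_mult_order (z::'k::field_char_0) 12"
  shows "8 \<le> beta_sep TYPE('k) dic_cyc"
proof -
  define \<zeta> where "\<zeta> = z ^ 2"
  have z3: "\<zeta> ^ 3 = -1" using mult_order_12(1)[OF z] by (simp add: \<zeta>_def)
  let ?S = "\<lambda>d. {f \<in> invariants dic_cyc 2 (dic_rep \<zeta>). mpoly_degree f \<le> d}"
  have "orbit_of dic_cyc (dic_rep \<zeta>) (vec2 1 2) \<noteq> orbit_of dic_cyc (dic_rep \<zeta>) (vec2 1 (-2))"
  proof
    assume eq: "orbit_of dic_cyc (dic_rep \<zeta>) (vec2 1 2) = orbit_of dic_cyc (dic_rep \<zeta>) (vec2 1 (-2))"
    have "vec2 1 (-2) = dic_rep \<zeta> \<one>\<^bsub>dic_cyc\<^esub> *\<^sub>v vec2 1 (-2)"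
      using kg_module_dic_rep[OF z3] one_mult_mat_vec[OF vec2_carrier] unfolding kg_module_def by metis
    moreover have "\<one>\<^bsub>dic_cyc\<^esub> \<in> carrier dic_cyc" unfolding cls_one by (rule cls_carrier)
    ultimately have "vec2 1 (-2) \<in> orbit_of dic_cyc (dic_rep \<zeta>) (vec2 1 (-2))"
      unfolding orbit_of_def by (rule image_eqI)
    then have "vec2 1 (-2) \<in> orbit_of dic_cyc (dic_rep \<zeta>) (vec2 1 2)" using eq by simp
    then obtain g where g: "g \<in> carrier dic_cyc" "vec2 1 (-2) = dic_rep \<zeta> g *\<^sub>v vec2 1 2"
      unfolding orbit_of_def by blast
    \<comment> \<open>The octic is -126 at (1, 2) and 126 at (1, -2).\<close>
    obtain x y where xy: "vec2 1 (-2) = vec2 x y" "x * y * (x ^ 6 - y ^ 6) = 1 * 2 * (1 ^ 6 - (2::'k) ^ 6)"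
      using dic_rep_octic[OF z3 g(1), of 1 2] g(2) by metis
    have "x = 1" "y = -2" using arg_cong[OF xy(1), of "\<lambda>u. u $ 0"] arg_cong[OF xy(1), of "\<lambda>u. u $ 1"]
      by (simp_all add: vec2_nth)
    then show False using xy(2) by simp
  qed
  moreover have "mpoly_eval f (vec2 1 2) = mpoly_eval f (vec2 1 (-2))" if "f \<in> ?S d" "d \<le> 7" for f d
    using low_degree_invariant_eq[OF z, of f] that by (simp add: \<zeta>_def)
  ultimately have "\<not> separating_set dic_cyc 2 (dic_rep \<zeta>) (?S d)" if "d \<le> 7" for d
    using that vec2_carrier unfolding separating_set_def by blast
  then have "8 \<le> beta_sep_module dic_cyc 2 (dic_rep \<zeta>)"
    unfolding beta_sep_module_def
  proof (intro Inf_greatest)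
    fix t assume "t \<in> {enat d |d. 0 < d \<and> separating_set dic_cyc 2 (dic_rep \<zeta>) (?S d)}"
    then obtain d where d: "t = enat d" "separating_set dic_cyc 2 (dic_rep \<zeta>) (?S d)" by blast
    then have "\<not> d \<le> 7" using \<open>\<And>d. d \<le> 7 \<Longrightarrow> \<not> separating_set dic_cyc 2 (dic_rep \<zeta>) (?S d)\<close> by blast
    then show "8 \<le> t" by (simp add: d(1) numeral_eq_enat)
  qed
  also have "\<dots> \<le> beta_sep TYPE('k) dic_cyc"
    unfolding beta_sep_def by (rule Sup_upper) (use kg_module_dic_rep[OF z3] in blast)
  finally show ?thesis .
qed

section \<open>The upper bound\<close>

declare carrier_DirProd [simp del] one_DirProd [simp del] mult_DirProd' [simp del]

locale dic_module =
  fixes n :: nat and \<rho> :: "dic_gen word set \<times> cyc_gen word set \<Rightarrow> 'k::field_char_0 mat" and z :: 'k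
  assumes module: "kg_module dic_cyc n \<rho>" and order: "has_mult_order z 12"
begin

text \<open>Linearity is demanded on \<open>carrier_vec n\<close> only, since the type of vectors
  contains all dimensions.\<close>

definition linear_form :: "('k vec \<Rightarrow> 'k) \<Rightarrow> bool" where
  "linear_form x \<longleftrightarrow> (\<exists>r. \<forall>u\<in>carrier_vec n. x u = (\<Sum>j<n. r j * u $ j))"

definition act :: "dic_gen word set \<times> cyc_gen word set \<Rightarrow> 'k vec \<Rightarrow> 'k vec" where
  "act g u = \<rho> g *\<^sub>v u"

definition forms :: "nat \<Rightarrow> nat \<Rightarrow> ('k vec \<Rightarrow> 'k) set" where
  "forms i e = {x. linear_form x \<and> (\<forall>u\<in>carrier_vec n.
     x (act elt_a u) = (z ^ 2) ^ i * x u \<and> x (act elt_c u) = (-1) ^ e * x u)}"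

lemma rho_carrier: "g \<in> carrier dic_cyc \<Longrightarrow> \<rho> g \<in> carrier_mat n n"
  using module by (simp add: kg_module_def)

lemma act_closed: "g \<in> carrier dic_cyc \<Longrightarrow> u \<in> carrier_vec n \<Longrightarrow> act g u \<in> carrier_vec n"
  unfolding act_def by (rule mult_mat_vec_carrier[OF rho_carrier])

lemma act_act:
  assumes "g \<in> carrier dic_cyc" "h \<in> carrier dic_cyc" "u \<in> carrier_vec n"
  shows "act g (act h u) = act (g \<otimes>\<^bsub>dic_cyc\<^esub> h) u"
proof -
  have "\<rho> (g \<otimes>\<^bsub>dic_cyc\<^esub> h) = \<rho> g * \<rho> h" using module assms by (simp add: kg_module_def)
  then show ?thesis
    unfolding act_def by (simp add: assoc_mult_mat_vec[OF rho_carrier rho_carrier] assms)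
qed

lemma act_one: "u \<in> carrier_vec n \<Longrightarrow> act \<one>\<^bsub>dic_cyc\<^esub> u = u"
  using module unfolding act_def kg_module_def by (metis one_mult_mat_vec)

lemma act_a6:
  assumes "u \<in> carrier_vec n"
  shows "act elt_a (act elt_a (act elt_a (act elt_a (act elt_a (act elt_a u))))) = u"
proof -
  interpret group dic_cyc by (rule group_dic_cyc)
  show ?thesis
    by (simp only: act_act elt_carrier m_closed assms act_closed elt_a6 act_one m_assoc)
qed

lemma act_bb: "u \<in> carrier_vec n \<Longrightarrow> act elt_b (act elt_b u) = act elt_a (act elt_a (act elt_a u))"
proof -
  assume u: "u \<in> carrier_vec n"
  interpret group dic_cyc by (rule group_dic_cyc)
  show ?thesis by (simp only: act_act elt_carrier m_closed u act_closed elt_bb m_assoc)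
qed

lemma act_aba: "u \<in> carrier_vec n \<Longrightarrow> act elt_a (act elt_b (act elt_a u)) = act elt_b u"
proof -
  assume u: "u \<in> carrier_vec n"
  interpret group dic_cyc by (rule group_dic_cyc)
  show ?thesis by (simp only: act_act elt_carrier m_closed u act_closed elt_aba m_assoc)
qed

lemma act_cc: "u \<in> carrier_vec n \<Longrightarrow> act elt_c (act elt_c u) = u"
  by (simp only: act_act elt_carrier elt_cc act_one)

lemma act_ca: "u \<in> carrier_vec n \<Longrightarrow> act elt_c (act elt_a u) = act elt_a (act elt_c u)"
  by (simp only: act_act elt_carrier elt_ca)

lemma act_cb: "u \<in> carrier_vec n \<Longrightarrow> act elt_c (act elt_b u) = act elt_b (act elt_c u)"
  by (simp only: act_act elt_carrier elt_cb)

lemma orbit_act: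
  assumes g: "g \<in> carrier dic_cyc" and u: "u \<in> carrier_vec n"
  shows "orbit_of dic_cyc \<rho> (act g u) = orbit_of dic_cyc \<rho> u"
proof -
  interpret group dic_cyc by (rule group_dic_cyc)
  have sub: "orbit_of dic_cyc \<rho> (act g u) \<subseteq> orbit_of dic_cyc \<rho> u"
    if g: "g \<in> carrier dic_cyc" and u: "u \<in> carrier_vec n" for g u
  proof
    fix t assume "t \<in> orbit_of dic_cyc \<rho> (act g u)"
    then obtain h where h: "h \<in> carrier dic_cyc" "t = act h (act g u)"
      by (auto simp: orbit_of_def act_def)
    have "t = act (h \<otimes>\<^bsub>dic_cyc\<^esub> g) u" unfolding h(2) by (rule act_act[OF h(1) g u])
    then show "t \<in> orbit_of dic_cyc \<rho> u"
      unfolding orbit_of_def act_def using m_closed[OF h(1) g] by blast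
  qed
  have "act (inv\<^bsub>dic_cyc\<^esub> g) (act g u) = u"
    by (simp only: act_act inv_closed g u l_inv act_one)
  then have "orbit_of dic_cyc \<rho> u \<subseteq> orbit_of dic_cyc \<rho> (act g u)"
    using sub[OF inv_closed[OF g] act_closed[OF g u]] by simp
  then show ?thesis using sub[OF g u] by blast
qed

lemma linear_form_act:
  assumes x: "linear_form x" and g: "g \<in> carrier dic_cyc"
  shows "linear_form (\<lambda>u. x (act g u))"
proof -
  obtain r where r: "\<And>u. u \<in> carrier_vec n \<Longrightarrow> x u = (\<Sum>j<n. r j * u $ j)"
    using x by (auto simp: linear_form_def)
  have "x (act g u) = (\<Sum>k<n. (\<Sum>j<n. r j * \<rho> g $$ (j, k)) * u $ k)" if u: "u \<in> carrier_vec n" for u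
  proof -
    have "act g u $ j = (\<Sum>k<n. \<rho> g $$ (j, k) * u $ k)" if "j < n" for j
      using that u rho_carrier[OF g] by (auto simp: act_def scalar_prod_def lessThan_atLeast0 intro!: sum.cong)
    then have "x (act g u) = (\<Sum>j<n. r j * (\<Sum>k<n. \<rho> g $$ (j, k) * u $ k))"
      using r[OF act_closed[OF g u]] by simp
    also have "\<dots> = (\<Sum>k<n. (\<Sum>j<n. r j * \<rho> g $$ (j, k)) * u $ k)"
      unfolding sum_distrib_left sum_distrib_right by (subst sum.swap) (simp add: mult.assoc)
    finally show ?thesis .
  qed
  then show ?thesis unfolding linear_form_def by (intro exI[of _ "\<lambda>k. \<Sum>j<n. r j * \<rho> g $$ (j, k)"]) blast
qed

lemma linear_form_add:
  assumes "linear_form x" "linear_form y" shows "linear_form (\<lambda>u. x u + y u)"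
proof -
  obtain r s where "\<forall>u\<in>carrier_vec n. x u = (\<Sum>j<n. r j * u $ j)" "\<forall>u\<in>carrier_vec n. y u = (\<Sum>j<n. s j * u $ j)"
    using assms by (auto simp: linear_form_def)
  then show ?thesis
    unfolding linear_form_def by (intro exI[of _ "\<lambda>j. r j + s j"]) (simp add: sum.distrib algebra_simps)
qed

lemma linear_form_scale:
  assumes "linear_form x" shows "linear_form (\<lambda>u. t * x u)"
proof -
  obtain r where "\<forall>u\<in>carrier_vec n. x u = (\<Sum>j<n. r j * u $ j)"
    using assms by (auto simp: linear_form_def)
  then show ?thesis
    unfolding linear_form_def by (intro exI[of _ "\<lambda>j. t * r j"]) (simp add: sum_distrib_left mult.assoc)
qed

lemma linear_form_sum:
  "(\<And>k. k \<in> A \<Longrightarrow> linear_form (x k)) \<Longrightarrow> linear_form (\<lambda>u. \<Sum>k\<in>A. x k u)"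
proof (induction A rule: infinite_finite_induct)
  case (insert k A)
  then show ?case using linear_form_add[of "x k" "\<lambda>u. \<Sum>k\<in>A. x k u"] by simp
qed (auto simp: linear_form_def intro!: exI[of _ "\<lambda>_. 0"])

lemma linear_form_coord: "l < n \<Longrightarrow> linear_form (\<lambda>u. u $ l)"
  unfolding linear_form_def
  by (intro exI[of _ "\<lambda>j. if j = l then 1 else 0"]) (simp add: if_distrib[of "\<lambda>t. t * _"] cong: if_cong)

lemma act_a_power_closed: "u \<in> carrier_vec n \<Longrightarrow> (act elt_a ^^ k) u \<in> carrier_vec n"
  by (induction k) (simp_all add: act_closed)

text \<open>Every coordinate function is, up to the factor 12, the sum of its projections onto the
  joint eigenspaces of the commuting actions of \<open>c\<close> and \<open>a\<close>.\<close>

lemma forms_separate: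
  assumes v: "v \<in> carrier_vec n" and w: "w \<in> carrier_vec n"
    and eq: "\<And>i e x. i < 6 \<Longrightarrow> e < 2 \<Longrightarrow> x \<in> forms i e \<Longrightarrow> x v = x w"
  shows "v = w"
proof (rule eq_vecI)
  show "dim_vec v = dim_vec w" using v w by simp
  fix l assume "l < dim_vec w"
  then have l: "l < n" using w by simp
  define \<zeta> where "\<zeta> = z ^ 2"
  have z6: "\<zeta> ^ 6 = 1" using order by (simp add: has_mult_order_def \<zeta>_def flip: power_mult)
  define s where "s = (\<lambda>e u. u $ l + (-1) ^ e * act elt_c u $ l)"
  \<comment> \<open>As \<open>\<zeta> ^ 5\<close> is the inverse of \<open>\<zeta>\<close>, this is
    six times the projection of \<open>s e\<close> onto weight \<open>i\<close>.\<close>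
  define p where "p = (\<lambda>i e u. \<Sum>k<6. \<zeta> ^ (5 * i * k) * s e ((act elt_a ^^ k) u))"
  have s_lin: "linear_form (s e)" for e
    unfolding s_def
    by (intro linear_form_add linear_form_scale linear_form_act[OF linear_form_coord] linear_form_coord l elt_carrier)
  have lin_pow: "linear_form (\<lambda>u. x ((act elt_a ^^ k) u))" if "linear_form x" for x k
    using that
  proof (induction k arbitrary: x)
    case (Suc k)
    show ?case using Suc.IH[OF linear_form_act[OF Suc.prems elt_carrier(1)]] by simp
  qed simp
  have p_lin: "linear_form (p i e)" for i e
    unfolding p_def by (intro linear_form_sum linear_form_scale lin_pow s_lin)
  have s_c: "s e (act elt_c u) = (-1) ^ e * s e u" if "u \<in> carrier_vec n" for e u
    using act_cc[OF that] by (simp add: s_def algebra_simps flip: power_add)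
  have pow_c: "(act elt_a ^^ k) (act elt_c u) = act elt_c ((act elt_a ^^ k) u)" if "u \<in> carrier_vec n" for k u
    by (induction k) (simp_all add: act_ca act_a_power_closed that)
  have p_c: "p i e (act elt_c u) = (-1) ^ e * p i e u" if "u \<in> carrier_vec n" for i e u
    unfolding p_def sum_distrib_left
    by (rule sum.cong[OF HOL.refl]) (simp add: pow_c s_c act_a_power_closed that)
  have p_a: "p i e (act elt_a u) = \<zeta> ^ i * p i e u" if u: "u \<in> carrier_vec n" for i e u
  proof -
    define q where "q = (\<lambda>k. \<zeta> ^ (5 * i * k) * s e ((act elt_a ^^ k) u))"
    have "q 6 = q 0"
    proof -
      have "(act elt_a ^^ 6) u = u" using act_a6[OF u] by (simp add: numeral_eq_Suc)
      moreover have "\<zeta> ^ (5 * i * 6) = (\<zeta> ^ 6) ^ (5 * i)" by (simp flip: power_mult add: mult.commute)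
      ultimately show ?thesis by (simp add: q_def z6)
    qed
    then have shift: "(\<Sum>k<6. q (Suc k)) = (\<Sum>k<6. q k)"
      by (simp add: numeral_eq_Suc)
    have "\<zeta> ^ (5 * i * k) = \<zeta> ^ i * \<zeta> ^ (5 * i * Suc k)" for k
    proof -
      have "\<zeta> ^ i * \<zeta> ^ (5 * i * Suc k) = (\<zeta> ^ 6) ^ i * \<zeta> ^ (5 * i * k)"
        by (simp flip: power_add power_mult add: algebra_simps)
      then show ?thesis by (simp add: z6)
    qed
    then have "p i e (act elt_a u) = (\<Sum>k<6. \<zeta> ^ i * q (Suc k))"
      unfolding p_def q_def by (intro sum.cong[OF HOL.refl]) (simp add: funpow_swap1 mult.assoc)
    then show ?thesis by (simp only: sum_distrib_left[symmetric] shift) (simp add: p_def q_def)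
  qed
  have p_form: "p i e \<in> forms i e" for i e
    unfolding forms_def using p_lin p_a p_c by (simp add: \<zeta>_def)
  have total: "(\<Sum>i<6. p i e u) = 6 * s e u" for e u
  proof -
    have "(\<Sum>i<6. p i e u) = (\<Sum>k<6. (\<Sum>i<6. \<zeta> ^ (5 * k * i)) * s e ((act elt_a ^^ k) u))"
      unfolding p_def sum_distrib_right by (subst sum.swap) (simp add: mult_ac)
    also have "\<dots> = (\<Sum>k<6. (if 6 dvd 5 * k then 6 else 0) * s e ((act elt_a ^^ k) u))"
      unfolding \<zeta>_def sum_powers_root[OF order] ..
    also have "\<dots> = (\<Sum>k<6::nat. if k = 0 then 6 * s e u else 0)"
    proof (rule sum.cong[OF HOL.refl])
      fix k :: nat assume "k \<in> {..<6}"
      then have "k < 6" by simp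
      then have "6 dvd 5 * k \<longleftrightarrow> k = 0" by presburger
      then show "(if 6 dvd 5 * k then 6 else 0) * s e ((act elt_a ^^ k) u) = (if k = 0 then 6 * s e u else 0)"
        by simp
    qed
    also have "\<dots> = 6 * s e u" by simp
    finally show ?thesis .
  qed
  have s_eq: "s e v = s e w" if "e < 2" for e
  proof -
    have "6 * s e v = 6 * s e w"
      unfolding total[symmetric] by (intro sum.cong[OF HOL.refl] eq[OF _ that p_form]) simp
    then show ?thesis by simp
  qed
  have "2 * u $ l = s 0 u + s 1 u" for u by (simp add: s_def)
  then have "2 * v $ l = 2 * w $ l" using s_eq[of 0] s_eq[of 1] by simp
  then show "v $ l = w $ l" by simp
qed

text \<open>The relation a b a = b shows that passing from u to a u divides
  \<open>x (act elt_b u)\<close> by the \<open>i\<close>-th power of \<open>z ^ 2\<close>, which is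
  multiplication by its \<open>5 * i\<close>-th power.\<close>

lemma form_b:
  assumes "x \<in> forms i e" shows "(\<lambda>u. x (act elt_b u)) \<in> forms (5 * i) e"
proof -
  have x: "linear_form x" "\<And>u. u \<in> carrier_vec n \<Longrightarrow> x (act elt_a u) = (z ^ 2) ^ i * x u"
    "\<And>u. u \<in> carrier_vec n \<Longrightarrow> x (act elt_c u) = (-1) ^ e * x u"
    using assms by (auto simp: forms_def)
  have "x (act elt_b (act elt_a u)) = (z ^ 2) ^ (5 * i) * x (act elt_b u)" if u: "u \<in> carrier_vec n" for u
  proof -
    have "x (act elt_b u) = (z ^ 2) ^ i * x (act elt_b (act elt_a u))"
      using x(2)[of "act elt_b (act elt_a u)"] act_aba[OF u] by (simp add: act_closed u)
    moreover have "(z ^ 2) ^ (5 * i) * (z ^ 2) ^ i = (z ^ 12) ^ i"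
      by (simp flip: power_mult power_add)
    ultimately show ?thesis using order by (simp add: has_mult_order_def mult.assoc[symmetric])
  qed
  then show ?thesis
    unfolding forms_def using x(1,3) linear_form_act[OF x(1) elt_carrier(2)]
    by (simp add: act_cb[symmetric] act_closed)
qed

sublocale weighted_forms "carrier_vec n" "act elt_a" "act elt_b" "act elt_c" forms "z ^ 2" "orbit_of dic_cyc \<rho>"
proof
  show "forms (i mod 6) (e mod 2) = forms i e" for i e
  proof -
    have "z ^ 12 = 1" using order by (simp add: has_mult_order_def)
    moreover have "(z ^ 2) ^ i = (z ^ 2) ^ (6 * (i div 6) + i mod 6)" by simp
    ultimately have "(z ^ 2) ^ i = (z ^ 2) ^ (i mod 6)"
      unfolding power_add power_mult[of "z ^ 2" 6] by (simp flip: power_mult)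
    moreover have "(-1::'k) ^ (e mod 2) = (-1) ^ e" by (simp add: minus_one_power_iff)
    ultimately show ?thesis by (simp add: forms_def)
  qed
  show "(z ^ 2) ^ 3 = -1" "(z ^ 2) ^ 2 = z ^ 2 - 1" using mult_order_12[OF order] by simp_all
  show "x (act elt_a u) = (z ^ 2) ^ i * x u" "x (act elt_c u) = (-1) ^ e * x u"
    if "x \<in> forms i e" "u \<in> carrier_vec n" for x i e u using that by (simp_all add: forms_def)
qed (auto simp: act_closed act_bb form_b orbit_act intro: forms_separate)

section \<open>Invariant polynomials from products of weight forms\<close>

lemma mon_polynomial:
  "mon m i e f \<Longrightarrow> \<exists>p\<in>coord_ring_upto n m. \<forall>u\<in>carrier_vec n. mpoly_eval p u = f u"
proof (induction rule: mon.induct)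
  case mon_one
  show ?case using coord_ring_upto_one[of n 0] by (intro bexI[of _ 1]) auto
next
  case (mon_times x i e m j d g)
  obtain q where q: "q \<in> coord_ring_upto n m" "\<forall>u\<in>carrier_vec n. mpoly_eval q u = g u"
    using mon_times.IH by blast
  obtain r where r: "\<forall>u\<in>carrier_vec n. x u = (\<Sum>j<n. r j * u $ j)"
    using mon_times(1) by (auto simp: forms_def linear_form_def)
  let ?p = "(\<Sum>j<n. mpoly_const (r j) * mpoly_var j) * q"
  have "?p \<in> coord_ring_upto n (1 + m)" by (rule coord_ring_upto_mult[OF coord_ring_upto_linear q(1)])
  moreover have "\<forall>u\<in>carrier_vec n. mpoly_eval ?p u = x u * g u"
    using q(2) r by (simp add: mpoly_eval_mult mpoly_eval_sum)
  ultimately show ?case by (intro bexI[of _ ?p]) simp_all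
qed

abbreviation poly_act :: "dic_gen word set \<times> cyc_gen word set \<Rightarrow> 'k mpoly \<Rightarrow> 'k mpoly" where
  "poly_act \<equiv> mpoly_act dic_cyc n \<rho>"

lemma eval_poly_act_gen:
  assumes g: "g \<in> carrier dic_cyc" and q: "q \<in> coord_ring n"
    and f: "\<And>u. u \<in> carrier_vec n \<Longrightarrow> mpoly_eval q u = f u" "\<And>u. u \<in> carrier_vec n \<Longrightarrow> f (act g u) = f u"
    and u: "u \<in> carrier_vec n"
  shows "mpoly_eval (poly_act g q) u = f u"
proof -
  interpret group dic_cyc by (rule group_dic_cyc)
  let ?u = "act (inv\<^bsub>dic_cyc\<^esub> g) u"
  have u': "?u \<in> carrier_vec n" by (rule act_closed[OF inv_closed[OF g] u])
  have "act g ?u = u" by (simp only: act_act inv_closed g u r_inv act_one)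
  then have "f u = f ?u" using f(2)[OF u'] by simp
  then show ?thesis
    using mpoly_eval_act[OF group_dic_cyc module g q u] f(1)[OF u'] by (simp add: act_def)
qed

lemma invariant_if_generators:
  assumes t: "t \<in> coord_ring n" "poly_act elt_a t = t" "poly_act elt_b t = t" "poly_act elt_c t = t"
  shows "t \<in> invariants dic_cyc n \<rho>"
  unfolding invariants_def
proof (intro CollectI conjI ballI t(1))
  fix g assume "g \<in> carrier dic_cyc"
  then show "poly_act g t = t"
  proof (induction g rule: dic_cyc_induct)
    case one
    show ?case by (rule mpoly_act_one[OF group_dic_cyc module t(1)])
  qed (metis mpoly_act_act[OF group_dic_cyc module _ _ t(1)] elt_carrier t(2,3,4))+
qed

text \<open>Invariance is an identity of formal polynomials, so a polynomial with values
  \<open>f\<close> is itself summed: over \<open>c\<close>, over the powers of \<open>a\<close>, and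
  finally over \<open>b\<close>. On values the first two sums contribute 2 * 6 = 12, the order of A,
  because \<open>f\<close> is invariant under A.\<close>

lemma symmetrised_invariant:
  assumes f: "inv_mon 8 f"
  shows "\<exists>t\<in>invariants dic_cyc n \<rho>. mpoly_degree t \<le> 8 \<and>
    (\<forall>u\<in>carrier_vec n. mpoly_eval t u = 12 * (f u + f (act elt_b u)))"
proof -
  interpret group dic_cyc by (rule group_dic_cyc)
  let ?R = "coord_ring_upto n 8 :: 'k mpoly set"
  have R: "p \<in> coord_ring n" if "p \<in> ?R" for p using that by (simp add: coord_ring_upto_iff)
  have comp: "poly_act g (poly_act h p) = poly_act (g \<otimes>\<^bsub>dic_cyc\<^esub> h) p"
    if "g \<in> carrier dic_cyc" "h \<in> carrier dic_cyc" "p \<in> ?R" for g h p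
    using mpoly_act_act[OF group_dic_cyc module] that R by blast
  have closed: "poly_act g p \<in> ?R" if "p \<in> ?R" for g p by (rule mpoly_act_upto[OF that])
  have one: "poly_act \<one>\<^bsub>dic_cyc\<^esub> p = p" if "p \<in> ?R" for p
    by (rule mpoly_act_one[OF group_dic_cyc module R[OF that]])
  note simps = comp closed elt_carrier m_closed m_assoc
  have a6: "poly_act elt_a (poly_act elt_a (poly_act elt_a (poly_act elt_a (poly_act elt_a (poly_act elt_a p))))) = p"
    if "p \<in> ?R" for p by (simp only: simps that elt_a6 one)
  have bb: "poly_act elt_b (poly_act elt_b p) = poly_act elt_a (poly_act elt_a (poly_act elt_a p))"
    if "p \<in> ?R" for p by (simp only: simps that elt_bb)
  have aba: "poly_act elt_a (poly_act elt_b (poly_act elt_a p)) = poly_act elt_b p"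
    if "p \<in> ?R" for p by (simp only: simps that elt_aba)
  have cc: "poly_act elt_c (poly_act elt_c p) = p" if "p \<in> ?R" for p
    by (simp only: simps that elt_cc one)
  have ca: "poly_act elt_c (poly_act elt_a p) = poly_act elt_a (poly_act elt_c p)" if "p \<in> ?R" for p
    by (simp only: comp elt_carrier that elt_ca)
  have cb: "poly_act elt_c (poly_act elt_b p) = poly_act elt_b (poly_act elt_c p)" if "p \<in> ?R" for p
    by (simp only: comp elt_carrier that elt_cb)
  obtain m i e where "mon m i e f" "m \<le> 8" using f by (auto simp: inv_mon_def)
  then obtain p where p: "p \<in> ?R" "\<And>u. u \<in> carrier_vec n \<Longrightarrow> mpoly_eval p u = f u"
    using mon_polynomial coord_ring_upto_mono by meson
  define q where "q = p + poly_act elt_c p"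
  have q: "q \<in> ?R" unfolding q_def by (intro coord_ring_upto_add closed p)
  have qc: "poly_act elt_c q = q" unfolding q_def by (simp add: mpoly_act_add cc p add.commute)
  have q_eval: "mpoly_eval q u = 2 * f u" if "u \<in> carrier_vec n" for u
    unfolding q_def mpoly_eval_add p(2)[OF that]
    using eval_poly_act_gen[OF elt_carrier(3) R[OF p(1)] p(2) inv_mon_c[OF f] that] by simp
  define s where "s = (\<lambda>k. (poly_act elt_a ^^ k) q)"
  have sR: "s k \<in> ?R" for k unfolding s_def by (induction k) (simp_all add: q closed)
  have sSuc: "poly_act elt_a (s k) = s (Suc k)" for k by (simp add: s_def)
  have sc: "poly_act elt_c (s k) = s k" for k
  proof (induction k)
    case 0
    show ?case using qc by (simp add: s_def)
  next
    case (Suc k)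
    then show ?case using ca[OF sR[of k]] sSuc by metis
  qed
  have s_eval: "mpoly_eval (s k) u = 2 * f u" if "u \<in> carrier_vec n" for k u
    using that
  proof (induction k arbitrary: u)
    case 0
    then show ?case by (simp add: s_def q_eval)
  next
    case (Suc k)
    show ?case
      unfolding sSuc[symmetric]
      by (rule eval_poly_act_gen[OF elt_carrier(1) R[OF sR] Suc.IH _ Suc.prems])
        (simp_all add: inv_mon_a[OF f])
  qed
  define r where "r = (\<Sum>k<6. s k)"
  have rR: "r \<in> ?R" unfolding r_def by (rule coord_ring_upto_sum[OF sR])
  have "s 6 = s 0" using a6[OF q] by (simp add: s_def numeral_eq_Suc)
  then have ra: "poly_act elt_a r = r"
    unfolding r_def mpoly_act_sum sSuc by (simp add: numeral_eq_Suc add_ac)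
  have rc: "poly_act elt_c r = r" unfolding r_def mpoly_act_sum sc ..
  have r_eval: "mpoly_eval r u = 12 * f u" if "u \<in> carrier_vec n" for u
    unfolding r_def mpoly_eval_sum by (simp add: s_eval[OF that])
  define t where "t = r + poly_act elt_b r"
  have tR: "t \<in> ?R" unfolding t_def by (intro coord_ring_upto_add closed rR)
  \<comment> \<open>As \<open>r\<close> is fixed by \<open>a\<close>, the relation a b a = b gives a
    b r = b r; in the next line b b r = a a a r = r.\<close>
  have "poly_act elt_a t = t" using aba[OF rR] unfolding t_def mpoly_act_add ra by simp
  moreover have "poly_act elt_b t = t" using bb[OF rR] unfolding t_def mpoly_act_add ra by (simp add: add.commute)
  moreover have "poly_act elt_c t = t" using cb[OF rR] unfolding t_def mpoly_act_add rc by simp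
  ultimately have "t \<in> invariants dic_cyc n \<rho>" using R[OF tR] invariant_if_generators by blast
  moreover have "mpoly_degree t \<le> 8" using tR by (simp add: coord_ring_upto_iff)
  moreover have "mpoly_eval t u = 12 * (f u + f (act elt_b u))" if u: "u \<in> carrier_vec n" for u
  proof -
    let ?u = "act (inv\<^bsub>dic_cyc\<^esub> elt_b) u"
    have u': "?u \<in> carrier_vec n" by (rule act_closed[OF inv_closed[OF elt_carrier(2)] u])
    have "act elt_b ?u = u" by (simp only: act_act inv_closed elt_carrier u r_inv act_one)
    \<comment> \<open>The action evaluates at the inverse translate, which differs from
      \<open>act elt_b u\<close> by the square of \<open>b\<close> only.\<close>
    then have "f ?u = f (act elt_b u)" using inv_mon_b_b[OF f u'] by simp
    moreover have "mpoly_eval (poly_act elt_b r) u = 12 * f ?u"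
      using mpoly_eval_act[OF group_dic_cyc module elt_carrier(2) R[OF rR] u] r_eval[OF u'] by (simp add: act_def)
    ultimately show ?thesis unfolding t_def mpoly_eval_add r_eval[OF u] by (simp add: distrib_left)
  qed
  ultimately show ?thesis by blast
qed

lemma beta_sep_module_le: "beta_sep_module dic_cyc n \<rho> \<le> 8"
proof -
  have "orbit_of dic_cyc \<rho> v = orbit_of dic_cyc \<rho> w"
    if v: "v \<in> carrier_vec n" and w: "w \<in> carrier_vec n"
      and eq: "\<And>t. t \<in> invariants dic_cyc n \<rho> \<Longrightarrow> mpoly_degree t \<le> 8 \<Longrightarrow> mpoly_eval t v = mpoly_eval t w" for v w
  proof (rule orb_eq_if_sum_agree[OF v w])
    show "sum_agree v w"
      unfolding sum_agree_def
    proof (intro allI impI)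
      fix f assume "inv_mon 8 f"
      then obtain t where t: "t \<in> invariants dic_cyc n \<rho>" "mpoly_degree t \<le> 8"
        "\<forall>u\<in>carrier_vec n. mpoly_eval t u = 12 * (f u + f (act elt_b u))"
        using symmetrised_invariant by blast
      have "12 * (f v + f (act elt_b v)) = 12 * (f w + f (act elt_b w))"
        using eq[OF t(1,2)] t(3) v w by metis
      then show "f v + f (act elt_b v) = f w + f (act elt_b w)" by (simp only: mult_cancel_left) simp
    qed
  qed
  then have "separating_set dic_cyc n \<rho> {f \<in> invariants dic_cyc n \<rho>. mpoly_degree f \<le> 8}"
    unfolding separating_set_def by blast
  then show ?thesis
    unfolding beta_sep_module_def numeral_eq_enat by (intro Inf_lower) force
qed

end

theorem theorem4p5:
  assumes "\<exists>z::'k::field_char_0. has_mult_order z 12"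
  shows "beta_sep TYPE('k) (Dic12 \<times>\<times> C2) = 8"
proof -
  obtain z :: 'k where z: "has_mult_order z 12" using assms by blast
  have "beta_sep_module dic_cyc n \<rho> \<le> 8" if "kg_module dic_cyc n \<rho>"
    for n and \<rho> :: "dic_gen word set \<times> cyc_gen word set \<Rightarrow> 'k mat"
    using that z by (intro dic_module.beta_sep_module_le dic_module.intro)
  then have "beta_sep TYPE('k) dic_cyc \<le> 8"
    unfolding beta_sep_def by (intro Sup_least) blast
  then show ?thesis using beta_sep_ge[OF z] by (rule antisym)
qed

end
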